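(* Let $X$ be an essential, locally finite, cocompact CAT(0) cube complex. The following are equivalent: (1) $\partial X = B(X)$. (2) $X$ has caged hyperplanes. (3) Every open set in $\mathcal{U}(X)$ which contains an ultrafilter in $\partial X$ contains a hyperplane. Additionally, if $X$ has straight links, then conditions (1), (2) and (3) are equivalent to: (4) $X$ does not contain a tight cage.
   Context: Conventions. CAT(0) cube complexes are connected, with unit cubes; distances are combinatorial (1-skeleton). $X$ is locally finite if every vertex has finite valence, and cocompact if its group of isometries (cubical automorphisms) acts cocompactly. For a hyperplane $\hat h$, the closures $h,h^*$ of the two components of $X\setminus\hat h$ are its halfspaces; the hyperplane bounding $h$ is always denoted $\hat h$, and for a set $H$ of halfspaces $\hat H$ is the set of bounding hyperplanes. The carrier $\mathcal{C}(\hat h)\cong \hat h\times[0,1]$ is the union of all cubes meeting $\hat h$; $\mathcal{C}^+(h)$ is the subcomplex $\hat h\times\{1\}$ of the carrier, labelled so that it lies in $h$. $X$ is essential if for every halfspace $h$ there are vertices in $h$ arbitrarily far from $\hat h$. An edge is adjacent to a vertex, or to a subset $Y$, if an endpoint is that vertex, respectively is in $Y$. Ultrafilters. An ultrafilter on $X$ is a set $\alpha$ of halfspaces such that for every halfspace $h$ exactly one of $h,h^*$ is in $\alpha$, and if $h\in\alpha$, $h\subset k$ then $k\in\alpha$. $\mathcal{U}(X)$ is the set of ultrafilters, with topology having as basis $\mathcal{U}(X)$ together with the sets $\mathcal{U}_H=\{\alpha:H\subset\alpha\}$, $H$ a finite set of halfspaces. Vertices $v$ are identified with the ultrafilters $\alpha_v=\{h:v\in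 h\}$. The Roller boundary $\partial X$ is the set of ultrafilters containing an infinite strictly descending chain of halfspaces (i.e. failing the descending chain condition). An ultrafilter $\alpha$ is non-terminating if for every $h\in\alpha$ there is $k\in\alpha$ with $k\subsetneq h$. $B(X)$ is the closure in $\mathcal{U}(X)$ of the set of non-terminating ultrafilters in $\partial X$. An open set $U\subset\mathcal{U}(X)$ contains a hyperplane $\hat h$ if for every edge dual to $\hat h$ both endpoints are in $U$. Caged hyperplanes. A cage in an ultrafilter $\alpha$ is a subset $K\subset\alpha$ with $\bigcap_{k\in K}\mathcal{C}^+(k)\neq\emptyset$. $X$ has caged hyperplanes if for every $\alpha\in\partial X$ and every cage $K\subset\alpha$ there is a hyperplane $\hat h\subset\bigcap_{k\in K}k$, where containment of a hyperplane in a halfspace $k$ is understood as $\hat h\subset k$ and $\hat h\ne\hat k$. Straight links. $X$ has straight links if for every vertex $v$ and every edge $e$ adjacent to $v$ there is an edge $f$ adjacent to $v$ such that the hyperplane dual to $e$ does not intersect the hyperplane dual to $f$. Tight cage. A tight cage is a pair $(\mathcal{S},\mathcal{T})$ of finite sets of halfspaces ($\mathcal{S}$ possibly empty) such that: (i) $|\mathcal{T}|\ge2$; (ii) $\hat s\cap\hat h\neq\emptyset$ for all $s\in\mathcal{S}$ and $h\in\mathcal{S}\cup\mathcal{T}$; (iii) the core $Y=\bigcap_{t\in\mathcal{T}}\mathcal{C}^+(t)\cap\bigcap_{s\in\mathcal{S}}s$ is unbounded; (iv) every hyperplane dual to an edge adjacent to $Y$ either is in $\hat{\mathcal{S}}\cup\hat{\mathcal{T}}$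 or intersects every hyperplane in $\hat{\mathcal{T}}$. *)

theory Defs
  imports "HOL-Analysis.Analysis"
begin

section \<open>Cube complexes\<close>

text \<open>
  A cube complex is given by the set \<open>X\<close> of the vertex sets of its cubes. This is the combinatorial
  form of a cubical complex in the sense of Bridson and Haefliger (I.7.32): the cubes are
  embedded and two cubes meet in the empty set or in one common face. Nothing is lost for CAT(0)
  cube complexes, all of which have these two properties.

  The vertex set of the \<open>n\<close>-cube is \<open>Pow {..<n}\<close>, and the vertex sets of its faces are the intervals
  \<open>{A. L \<subseteq> A \<and> A \<subseteq> U}\<close>.
\<close>

definition is_cube_face_poset :: "'v set \<Rightarrow> 'v set set \<Rightarrow> bool" where
  "is_cube_face_poset c F \<longleftrightarrow>
     (\<exists>(n::nat) \<phi>. bij_betw \<phi> (Pow {..<n}) c \<and>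
        F = {\<phi> ` {A. L \<subseteq> A \<and> A \<subseteq> U} | L U. L \<subseteq> U \<and> U \<subseteq> {..<n}})"

definition cube_complex :: "'v set set \<Rightarrow> bool" where
  "cube_complex X \<longleftrightarrow>
     (\<forall>c\<in>X. is_cube_face_poset c {d\<in>X. d \<subseteq> c}) \<and>
     (\<forall>c\<in>X. \<forall>d\<in>X. c \<inter> d \<noteq> {} \<longrightarrow> c \<inter> d \<in> X)"

definition verts :: "'v set set \<Rightarrow> 'v set" where
  "verts X = \<Union>X"

definition cc_edges :: "'v set set \<Rightarrow> 'v set set" where
  "cc_edges X = {e\<in>X. card e = 2}"

definition squares :: "'v set set \<Rightarrow> 'v set set" where
  "squares X = {s\<in>X. card s = 4}"

definition neighbours :: "'v set set \<Rightarrow> 'v \<Rightarrow> 'v set" where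
  "neighbours X v = {w. {v, w} \<in> cc_edges X}"

definition locally_finite_cc :: "'v set set \<Rightarrow> bool" where
  "locally_finite_cc X \<longleftrightarrow> (\<forall>v\<in>verts X. finite (neighbours X v))"

text \<open>
  The vertices of the link of \<open>v\<close> are the edges at \<open>v\<close>, represented by their other endpoints; each
  cube containing \<open>v\<close> contributes the simplex spanned by its edges at \<open>v\<close> (the cube \<open>{v}\<close> contributes
  the empty simplex).
\<close>

definition cc_link :: "'v set set \<Rightarrow> 'v \<Rightarrow> 'v set set" where
  "cc_link X v = {c \<inter> neighbours X v | c. c \<in> X \<and> v \<in> c}"

definition flag_complex :: "'w set set \<Rightarrow> bool" where
  "flag_complex L \<longleftrightarrow>
     (\<forall>N. finite N \<and> N \<subseteq> \<Union>L \<and> (\<forall>a\<in>N. \<forall>b\<in>N. a \<noteq> b \<longrightarrow> {a, b} \<in> L) \<and> N \<noteq> {} \<longrightarrow> N \<in> L)"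

definition edge_path :: "'v set set \<Rightarrow> 'v list \<Rightarrow> bool" where
  "edge_path X p \<longleftrightarrow>
     p \<noteq> [] \<and> set p \<subseteq> verts X \<and> successively (\<lambda>a b. {a, b} \<in> cc_edges X) p"

definition connected_cc :: "'v set set \<Rightarrow> bool" where
  "connected_cc X \<longleftrightarrow>
     verts X \<noteq> {} \<and>
     (\<forall>v\<in>verts X. \<forall>w\<in>verts X. \<exists>p. edge_path X p \<and> hd p = v \<and> last p = w)"

text \<open>
  Simple connectivity is expressed by the edge-path group: two edge paths are homotopic if they
  differ by finitely many insertions or deletions of backtracks and moves across squares.
\<close>

inductive elem_homotopic :: "'v set set \<Rightarrow> 'v list \<Rightarrow> 'v list \<Rightarrow> bool" for X where
  backtrack: "{a, b} \<in> cc_edges X \<Longrightarrow> elem_homotopic X (p @ [a, b, a] @ q) (p @ [a] @ q)"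
| square: "\<lbrakk>{a, b, c, d} \<in> squares X; {a, b} \<in> cc_edges X; {b, c} \<in> cc_edges X;
            {a, d} \<in> cc_edges X; {d, c} \<in> cc_edges X\<rbrakk>
           \<Longrightarrow> elem_homotopic X (p @ [a, b, c] @ q) (p @ [a, d, c] @ q)"

definition edge_homotopic :: "'v set set \<Rightarrow> 'v list \<Rightarrow> 'v list \<Rightarrow> bool" where
  "edge_homotopic X = equivclp (elem_homotopic X)"

definition simply_connected_cc :: "'v set set \<Rightarrow> bool" where
  "simply_connected_cc X \<longleftrightarrow>
     connected_cc X \<and>
     (\<forall>p. edge_path X p \<and> hd p = last p \<longrightarrow> edge_homotopic X p [hd p])"

definition CAT0_cube_complex :: "'v set set \<Rightarrow> bool" where
  "CAT0_cube_complex X \<longleftrightarrow>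
     cube_complex X \<and> simply_connected_cc X \<and> (\<forall>v\<in>verts X. flag_complex (cc_link X v))"

definition cc_dist :: "'v set set \<Rightarrow> 'v \<Rightarrow> 'v \<Rightarrow> nat" where
  "cc_dist X v w = (LEAST n. \<exists>p. edge_path X p \<and> hd p = v \<and> last p = w \<and> length p = Suc n)"

definition cc_automorphism :: "'v set set \<Rightarrow> ('v \<Rightarrow> 'v) \<Rightarrow> bool" where
  "cc_automorphism X g \<longleftrightarrow>
     bij_betw g (verts X) (verts X) \<and> (\<forall>c. c \<subseteq> verts X \<longrightarrow> (c \<in> X \<longleftrightarrow> g ` c \<in> X))"

text \<open>
  A compact subset lies in a finite subcomplex, and finite subcomplexes are compact.
\<close>

definition cocompact_cc :: "'v set set \<Rightarrow> bool" where
  "cocompact_cc X \<longleftrightarrow>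
     (\<exists>K. finite K \<and> K \<subseteq> X \<and> (\<forall>c\<in>X. \<exists>g k. cc_automorphism X g \<and> k \<in> K \<and> c = g ` k))"


section \<open>Hyperplanes and halfspaces\<close>

text \<open>
  A hyperplane is represented by the set of edges dual to it, a class of the equivalence relation
  generated by being opposite edges of a square.
\<close>

definition opposite :: "'v set set \<Rightarrow> 'v set \<Rightarrow> 'v set \<Rightarrow> bool" where
  "opposite X e f \<longleftrightarrow>
     e \<in> cc_edges X \<and> f \<in> cc_edges X \<and> e \<inter> f = {} \<and> e \<union> f \<in> squares X"

definition dual_hyp :: "'v set set \<Rightarrow> 'v set \<Rightarrow> 'v set set" where
  "dual_hyp X e = {f\<in>cc_edges X. equivclp (opposite X) e f}"

definition hyperplanes :: "'v set set \<Rightarrow> 'v set set set" where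
  "hyperplanes X = dual_hyp X ` cc_edges X"

text \<open>
  Two hyperplanes have a common point iff some cube contains a midcube of each: all midcubes of a
  cube pass through its centre. As with nonempty intersection of point sets, every hyperplane meets
  itself.
\<close>

definition hyps_meet :: "'v set set \<Rightarrow> 'v set set \<Rightarrow> 'v set set \<Rightarrow> bool" where
  "hyps_meet X H H' \<longleftrightarrow> (\<exists>c\<in>X. (\<exists>e\<in>H. e \<subseteq> c) \<and> (\<exists>f\<in>H'. f \<subseteq> c))"

text \<open>
  Halfspaces are represented by their vertex sets: the components of the 1-skeleton after removal of
  the (open) edges dual to a hyperplane.
\<close>

definition sides :: "'v set set \<Rightarrow> 'v set set \<Rightarrow> 'v set set" where
  "sides X H =
     {{w. (\<lambda>a b. {a, b} \<in> cc_edges X - H)\<^sup>*\<^sup>* v w} | v. v \<in> verts X}"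

definition halfspaces :: "'v set set \<Rightarrow> 'v set set" where
  "halfspaces X = (\<Union>H\<in>hyperplanes X. sides X H)"

definition opp_halfspace :: "'v set set \<Rightarrow> 'v set \<Rightarrow> 'v set" where
  "opp_halfspace X h = verts X - h"

definition bounding_hyp :: "'v set set \<Rightarrow> 'v set \<Rightarrow> 'v set set" where
  "bounding_hyp X h = (THE H. H \<in> hyperplanes X \<and> h \<in> sides X H)"

text \<open>The vertex set of $\mathcal{C}^+(h)$.\<close>

definition carrier_side :: "'v set set \<Rightarrow> 'v set \<Rightarrow> 'v set" where
  "carrier_side X h = {v\<in>h. \<exists>e\<in>bounding_hyp X h. v \<in> e}"

text \<open>
  A hyperplane other than the one bounding \<open>k\<close> lies in the halfspace \<open>k\<close> iff all edges dual to it do.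
\<close>

definition hyp_in_halfspace :: "'v set set \<Rightarrow> 'v set set \<Rightarrow> 'v set \<Rightarrow> bool" where
  "hyp_in_halfspace X H k \<longleftrightarrow> H \<noteq> bounding_hyp X k \<and> (\<forall>e\<in>H. e \<subseteq> k)"

definition essential_cc :: "'v set set \<Rightarrow> bool" where
  "essential_cc X \<longleftrightarrow>
     (\<forall>h\<in>halfspaces X. \<forall>n. \<exists>v\<in>h. \<forall>e\<in>bounding_hyp X h. \<forall>u\<in>e. n \<le> cc_dist X v u)"


section \<open>Ultrafilters and boundaries\<close>

definition ultrafilters :: "'v set set \<Rightarrow> 'v set set set" where
  "ultrafilters X =
     {\<alpha>. \<alpha> \<subseteq> halfspaces X \<and>
         (\<forall>h\<in>halfspaces X. (h \<in> \<alpha>) \<noteq> (opp_halfspace X h \<in> \<alpha>)) \<and>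
         (\<forall>h\<in>\<alpha>. \<forall>k\<in>halfspaces X. h \<subseteq> k \<longrightarrow> k \<in> \<alpha>)}"

definition uf_basic :: "'v set set \<Rightarrow> 'v set set \<Rightarrow> 'v set set set" where
  "uf_basic X H = {\<alpha>\<in>ultrafilters X. H \<subseteq> \<alpha>}"

definition uf_topology :: "'v set set \<Rightarrow> 'v set set topology" where
  "uf_topology X =
     topology_generated_by
       (insert (ultrafilters X) {uf_basic X H | H. finite H \<and> H \<subseteq> halfspaces X})"

definition vertex_uf :: "'v set set \<Rightarrow> 'v \<Rightarrow> 'v set set" where
  "vertex_uf X v = {h\<in>halfspaces X. v \<in> h}"

definition roller_boundary :: "'v set set \<Rightarrow> 'v set set set" where
  "roller_boundary X =
     {\<alpha>\<in>ultrafilters X. \<exists>c::nat \<Rightarrow> 'v set. \<forall>n. c n \<in> \<alpha> \<and> c (Suc n) \<subset> c n}"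

definition non_terminating :: "'v set set \<Rightarrow> bool" where
  "non_terminating \<alpha> \<longleftrightarrow> (\<forall>h\<in>\<alpha>. \<exists>k\<in>\<alpha>. k \<subset> h)"

definition B_boundary :: "'v set set \<Rightarrow> 'v set set set" where
  "B_boundary X = uf_topology X closure_of {\<alpha>\<in>roller_boundary X. non_terminating \<alpha>}"

definition uf_set_contains_hyp :: "'v set set \<Rightarrow> 'v set set set \<Rightarrow> 'v set set \<Rightarrow> bool" where
  "uf_set_contains_hyp X U H \<longleftrightarrow> (\<forall>e\<in>H. \<forall>v\<in>e. vertex_uf X v \<in> U)"


section \<open>Caged hyperplanes, straight links and tight cages\<close>

text \<open>
  The sets $\mathcal{C}^+(k)$ are subcomplexes, so an intersection of them is nonempty iff it contains
  a vertex. The intersection over the empty set is all of \<open>X\<close>.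
\<close>

definition is_cage :: "'v set set \<Rightarrow> 'v set set \<Rightarrow> 'v set set \<Rightarrow> bool" where
  "is_cage X \<alpha> K \<longleftrightarrow> K \<subseteq> \<alpha> \<and> (\<exists>v\<in>verts X. \<forall>k\<in>K. v \<in> carrier_side X k)"

definition caged_hyperplanes :: "'v set set \<Rightarrow> bool" where
  "caged_hyperplanes X \<longleftrightarrow>
     (\<forall>\<alpha>\<in>roller_boundary X. \<forall>K. is_cage X \<alpha> K \<longrightarrow>
        (\<exists>H\<in>hyperplanes X. \<forall>k\<in>K. hyp_in_halfspace X H k))"

definition straight_links :: "'v set set \<Rightarrow> bool" where
  "straight_links X \<longleftrightarrow>
     (\<forall>v\<in>verts X. \<forall>e\<in>cc_edges X. v \<in> e \<longrightarrow>
        (\<exists>f\<in>cc_edges X. v \<in> f \<and> \<not> hyps_meet X (dual_hyp X e) (dual_hyp X f)))"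

definition core :: "'v set set \<Rightarrow> 'v set set \<Rightarrow> 'v set set \<Rightarrow> 'v set" where
  "core X S T = {v\<in>verts X. (\<forall>t\<in>T. v \<in> carrier_side X t) \<and> (\<forall>s\<in>S. v \<in> s)}"

definition unbounded_cc :: "'v set set \<Rightarrow> 'v set \<Rightarrow> bool" where
  "unbounded_cc X Y \<longleftrightarrow> (\<forall>n. \<exists>v\<in>Y. \<exists>w\<in>Y. n < cc_dist X v w)"

definition tight_cage :: "'v set set \<Rightarrow> 'v set set \<Rightarrow> 'v set set \<Rightarrow> bool" where
  "tight_cage X S T \<longleftrightarrow>
     finite S \<and> S \<subseteq> halfspaces X \<and> finite T \<and> T \<subseteq> halfspaces X \<and>
     2 \<le> card T \<and>
     (\<forall>s\<in>S. \<forall>h\<in>S \<union> T. hyps_meet X (bounding_hyp X s) (bounding_hyp X h)) \<and>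
     unbounded_cc X (core X S T) \<and>
     (\<forall>e\<in>cc_edges X. e \<inter> core X S T \<noteq> {} \<longrightarrow>
        dual_hyp X e \<in> bounding_hyp X ` (S \<union> T) \<or>
        (\<forall>t\<in>T. hyps_meet X (dual_hyp X e) (bounding_hyp X t)))"

end

theory Submission
  imports Defs
begin

text \<open>
  Everything rests on one fact about edge paths. Call two paths swap-equivalent if moves across
  squares lead from one to the other, and call a path reduced if swaps never produce a backtrack
  in it. Prepending an edge to a reduced path, and cancelling the backtrack if one arises, acts on
  swap classes. Since links are flag, this action respects backtracks and squares, so that every
  homotopy class contains a single reduced path up to swaps; this is van der Waerden's argument
  for normal forms in free groups. Simple connectivity makes reduced paths with common endpoints
  swap-equivalent, hence they are the geodesics, and the quadrangle condition follows: two
  neighbours of a vertex that are both closer to \<open>x\<close> span a square with it, whose fourth vertex is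
  closer still. The usual geometry of halfspaces follows from this condition: a halfspace is the
  set \<open>hs a b\<close> of vertices closer to \<open>a\<close> than to \<open>b\<close> for an edge \<open>{a, b}\<close>, convex sets have gates
  and the Helly property, two disjoint convex sets are separated by the hyperplane of an edge
  leaving one of them, and two different hyperplanes meet iff all four quarters contain vertices.

  The conditions are compared through the finite sets \<open>S\<close> of halfspaces that lie in a common
  boundary ultrafilter; these describe the basic open sets that meet the boundary. The condition
  on open sets says that each such \<open>S\<close> admits a hyperplane inside all its members (\<open>hyp_dense\<close>),
  and \<open>\<partial>X = B(X)\<close> that each such \<open>S\<close> lies in a non-terminating ultrafilter (\<open>nonterm_dense\<close>).
  Caged hyperplanes are \<open>hyp_dense\<close> for cages. Cages are finite, and conversely every basic
  neighbourhood of \<open>\<alpha>\<close> contains all vertices allowed by the cage of \<open>\<alpha>\<close> at a well chosen vertex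
  (\<open>cage_neighbourhood\<close>).

  \<open>hyp_dense\<close> implies \<open>nonterm_dense\<close>: a hyperplane inside \<open>S\<close>, and inside finitely many further
  members of \<open>\<alpha>\<close>, has a side contained in every member of \<open>S\<close>. This side is infinite by
  essentiality, so it has a boundary point. Thus each member of \<open>S\<close> can be replaced by a smaller
  halfspace, and doing this along an enumeration of all halfspaces builds a non-terminating
  ultrafilter.

  \<open>nonterm_dense\<close> implies \<open>hyp_dense\<close>: let \<open>H\<close> be a smallest \<open>S\<close> of this kind without a hyperplane
  inside, contained in a non-terminating \<open>\<beta>\<close>. By minimality, a member of \<open>\<beta>\<close> deep inside one
  member of \<open>H\<close> crosses all the others, so \<open>H\<close> may be taken pairwise crossing. Remove \<open>h1\<close>,
  leaving \<open>R\<close>, and take a descending chain in \<open>\<beta>\<close> below \<open>h1\<close>. By cocompactness some automorphism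
  fixes every member of \<open>R\<close> and maps a member of the chain to a smaller one. Powers of its inverse
  give ascending halfspaces \<open>q m\<close> that exhaust \<open>X\<close>, and no hyperplane is inside \<open>q m\<close> and all of
  \<open>R\<close>. On the other hand, \<open>nonterm_dense\<close> makes halfspaces \<open>b\<close> that branch off the core of \<open>R\<close>
  appear within a uniform distance of every core point. Each of them crosses \<open>q m\<close> for large \<open>m\<close>.
  Start from a core point \<open>w0\<close> near to the largest possible number of them. Its gates \<open>W m\<close> in the
  part of the core outside \<open>q m\<close> are near to exactly the same ones, while they run to a boundary
  ultrafilter \<open>\<alpha>\<close>. One \<open>b\<close> is then compatible with the cages of \<open>\<alpha>\<close> at infinitely many \<open>W m\<close>. So
  infinitely many \<open>W m\<close> are separated from \<open>b\<close> by a member of \<open>\<alpha>\<close>, and only finitely many members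
  of \<open>\<alpha>\<close> can occur here; one of them misses infinitely many \<open>W m\<close>, which is absurd for points
  converging to \<open>\<alpha>\<close>.

  Tight cages: the unbounded core of a tight cage contains a ray, so \<open>S \<union> T\<close> lies in a boundary
  ultrafilter. A hyperplane inside all members could be separated from the core by an edge leaving
  the core, but the last property of a tight cage moves the other end of this edge into the core.
  Conversely, if \<open>nonterm_dense\<close> fails, some finite \<open>H\<close> lies in boundary ultrafilters and has a
  member \<open>t\<close> that is minimal in all of them. For the simplest such \<open>H\<close>, the members \<open>T\<close> of this
  kind and the remaining ones \<open>S\<close> form a tight cage: an edge at the core that violates the last
  property extends, by straight links, to a geodesic ray, and the limit of the ray contains a
  halfspace below some \<open>t\<close>.
\<close>

section \<open>Cubes, edges and squares\<close>

text \<open>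
  Symmetric difference with a fixed set is a symmetry of the cube that permutes its intervals, so
  a chart may be moved to send the empty set to any given vertex.
\<close>

lemma cube_pointed_chart:
  assumes "is_cube_face_poset c F" "w \<in> c"
  obtains n \<phi> where "bij_betw \<phi> (Pow {..<n::nat}) c" "\<phi> {} = w"
    "F = {\<phi> ` {A. L \<subseteq> A \<and> A \<subseteq> U} | L U. L \<subseteq> U \<and> U \<subseteq> {..<n}}"
proof -
  obtain n \<psi> where bij: "bij_betw \<psi> (Pow {..<n::nat}) c"
    and F: "F = {\<psi> ` {A. L \<subseteq> A \<and> A \<subseteq> U} | L U. L \<subseteq> U \<and> U \<subseteq> {..<n}}"
    using assms(1) unfolding is_cube_face_poset_def by blast
  obtain A0 where A0: "A0 \<subseteq> {..<n}" "\<psi> A0 = w"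
    using bij assms(2) by (metis PowD bij_betw_def imageE)
  define \<tau> where "\<tau> A = (A - A0) \<union> (A0 - A)" for A
  have \<tau>\<tau>: "\<tau> (\<tau> A) = A" for A unfolding \<tau>_def by blast
  have \<tau>P: "\<tau> A \<subseteq> {..<n}" if "A \<subseteq> {..<n}" for A using that A0 unfolding \<tau>_def by blast
  have bij\<tau>: "bij_betw \<tau> (Pow {..<n}) (Pow {..<n})"
    by (rule bij_betw_byWitness[where f' = \<tau>]) (auto simp: \<tau>\<tau> dest: \<tau>P)
  have int: "\<tau> ` {A. L \<subseteq> A \<and> A \<subseteq> U} = {A. \<tau> L - (U - L) \<subseteq> A \<and> A \<subseteq> \<tau> L \<union> (U - L)}" if "L \<subseteq> U" for L U
  proof (intro equalityI subsetI)
    fix B assume "B \<in> \<tau> ` {A. L \<subseteq> A \<and> A \<subseteq> U}"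
    then show "B \<in> {A. \<tau> L - (U - L) \<subseteq> A \<and> A \<subseteq> \<tau> L \<union> (U - L)}" using that unfolding \<tau>_def by auto
  next
    fix B assume "B \<in> {A. \<tau> L - (U - L) \<subseteq> A \<and> A \<subseteq> \<tau> L \<union> (U - L)}"
    then have "L \<subseteq> \<tau> B \<and> \<tau> B \<subseteq> U" using that unfolding \<tau>_def by auto
    then show "B \<in> \<tau> ` {A. L \<subseteq> A \<and> A \<subseteq> U}" using \<tau>\<tau>[of B] by (metis (mono_tags, lifting) image_eqI mem_Collect_eq)
  qed
  show thesis
  proof
    show "bij_betw (\<psi> \<circ> \<tau>) (Pow {..<n}) c" using bij_betw_trans[OF bij\<tau> bij] .
    show "(\<psi> \<circ> \<tau>) {} = w" using A0 by (simp add: \<tau>_def)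
    show "F = {(\<psi> \<circ> \<tau>) ` {A. L \<subseteq> A \<and> A \<subseteq> U} | L U. L \<subseteq> U \<and> U \<subseteq> {..<n}}" (is "F = ?G")
    proof (intro equalityI subsetI)
      fix d assume "d \<in> F"
      then obtain L U where LU: "L \<subseteq> U" "U \<subseteq> {..<n}" "d = \<psi> ` {A. L \<subseteq> A \<and> A \<subseteq> U}" unfolding F by blast
      define L' where "L' = \<tau> L - (U - L)"
      define U' where "U' = \<tau> L \<union> (U - L)"
      have U': "L' \<subseteq> U'" "U' \<subseteq> {..<n}"
        using LU \<tau>P[of L] unfolding L'_def U'_def by blast+
      have 1: "{A. L' \<subseteq> A \<and> A \<subseteq> U'} = \<tau> ` {A. L \<subseteq> A \<and> A \<subseteq> U}"
        unfolding int[OF LU(1)] L'_def U'_def ..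
      have "\<tau> ` {A. L' \<subseteq> A \<and> A \<subseteq> U'} = {A. L \<subseteq> A \<and> A \<subseteq> U}"
        unfolding 1 image_image \<tau>\<tau> by simp
      then have "d = (\<psi> \<circ> \<tau>) ` {A. L' \<subseteq> A \<and> A \<subseteq> U'}" unfolding LU(3) by (metis image_comp)
      then show "d \<in> ?G" using U' by blast
    next
      fix d assume "d \<in> ?G"
      then obtain L U where LU: "L \<subseteq> U" "U \<subseteq> {..<n}" "d = (\<psi> \<circ> \<tau>) ` {A. L \<subseteq> A \<and> A \<subseteq> U}" by blast
      have "d = \<psi> ` {A. \<tau> L - (U - L) \<subseteq> A \<and> A \<subseteq> \<tau> L \<union> (U - L)}"
        unfolding LU(3) image_comp[symmetric] int[OF LU(1)] ..
      moreover have "\<tau> L \<union> (U - L) \<subseteq> {..<n}" using LU \<tau>P[of L] by blast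
      ultimately show "d \<in> F" unfolding F by blast
    qed
  qed
qed

lemma image_interval_edge:
  assumes "i \<notin> A" shows "\<phi> ` {B. A \<subseteq> B \<and> B \<subseteq> insert i A} = {\<phi> A, \<phi> (insert i A)}"
proof -
  have "{B. A \<subseteq> B \<and> B \<subseteq> insert i A} = {A, insert i A}" using assms by auto
  then show ?thesis by simp
qed

lemma image_interval_square:
  assumes "i \<notin> A" "j \<notin> A"
  shows "\<phi> ` {B. A \<subseteq> B \<and> B \<subseteq> insert i (insert j A)} = {\<phi> A, \<phi> (insert i A), \<phi> (insert i (insert j A)), \<phi> (insert j A)}"
proof -
  have "{B. A \<subseteq> B \<and> B \<subseteq> insert i (insert j A)} = {A, insert i A, insert i (insert j A), insert j A}"
    using assms by auto
  then show ?thesis by simp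
qed

locale cat0_complex =
  fixes X :: "'v set set"
  assumes cat0: "CAT0_cube_complex X"
begin

lemma cubes: "cube_complex X" and sc: "simply_connected_cc X" and conn: "connected_cc X"
  using cat0 unfolding CAT0_cube_complex_def simply_connected_cc_def by auto

lemma flag: "v \<in> verts X \<Longrightarrow> flag_complex (cc_link X v)"
  using cat0 unfolding CAT0_cube_complex_def by auto

definition adj :: "'v \<Rightarrow> 'v \<Rightarrow> bool" where "adj v w \<longleftrightarrow> {v, w} \<in> cc_edges X"

lemma adj_sym: "adj v w \<Longrightarrow> adj w v" by (simp add: adj_def insert_commute)

lemma adj_commute: "adj v w \<longleftrightarrow> adj w v" using adj_sym by blast

lemma adj_neq: "adj v w \<Longrightarrow> v \<noteq> w" unfolding adj_def cc_edges_def by auto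

lemma adj_verts: "adj v w \<Longrightarrow> v \<in> verts X \<and> w \<in> verts X"
  unfolding adj_def cc_edges_def verts_def by auto

lemma in_neighbours: "w \<in> neighbours X v \<longleftrightarrow> adj v w" unfolding neighbours_def adj_def by simp

lemma edge_obtain:
  assumes "e \<in> cc_edges X" obtains a b where "e = {a, b}" "adj a b"
  using assms unfolding adj_def cc_edges_def by (metis (mono_tags, lifting) card_2_iff mem_Collect_eq)

lemma cube_chart:
  assumes "c \<in> X" "w \<in> c"
  obtains n \<phi> where "bij_betw \<phi> (Pow {..<n::nat}) c" "\<phi> {} = w"
    "\<And>L U. L \<subseteq> U \<Longrightarrow> U \<subseteq> {..<n} \<Longrightarrow> \<phi> ` {A. L \<subseteq> A \<and> A \<subseteq> U} \<in> X"
    "\<And>i. i < n \<Longrightarrow> adj w (\<phi> {i})"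
    "\<And>A B. A \<subseteq> {..<n} \<Longrightarrow> B \<subseteq> {..<n} \<Longrightarrow> adj (\<phi> A) (\<phi> B) \<Longrightarrow> \<exists>i<n. i \<notin> A \<and> B = insert i A \<or> i \<notin> B \<and> A = insert i B"
proof -
  have fp: "is_cube_face_poset c {d \<in> X. d \<subseteq> c}" using cubes assms(1) unfolding cube_complex_def by blast
  obtain n \<phi> where bij: "bij_betw \<phi> (Pow {..<n::nat}) c" and w: "\<phi> {} = w"
    and F: "{d \<in> X. d \<subseteq> c} = {\<phi> ` {A. L \<subseteq> A \<and> A \<subseteq> U} | L U. L \<subseteq> U \<and> U \<subseteq> {..<n}}"
    by (rule cube_pointed_chart[OF fp assms(2)]) (rule that; assumption)
  have inj: "inj_on \<phi> (Pow {..<n})" using bij by (simp add: bij_betw_def)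
  have face: "\<phi> ` {A. L \<subseteq> A \<and> A \<subseteq> U} \<in> X" if "L \<subseteq> U" "U \<subseteq> {..<n}" for L U
    using F that by blast
  have e: "adj w (\<phi> {i})" if "i < n" for i
  proof -
    have "{w, \<phi> {i}} \<in> X" using face[of "{}" "{i}"] image_interval_edge[of i "{}" \<phi>] that w by auto
    moreover have "w \<noteq> \<phi> {i}" using inj that w by (auto simp: inj_on_def)
    ultimately show ?thesis unfolding adj_def cc_edges_def by auto
  qed
  have e3: "\<exists>i<n. i \<notin> A \<and> B = insert i A \<or> i \<notin> B \<and> A = insert i B"
    if AB: "A \<subseteq> {..<n}" "B \<subseteq> {..<n}" "adj (\<phi> A) (\<phi> B)" for A B
  proof -
    have "\<phi> A \<in> c" "\<phi> B \<in> c" using bij AB by (auto simp: bij_betw_def)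
    then have wu: "{\<phi> A, \<phi> B} \<in> {d \<in> X. d \<subseteq> c}" using AB unfolding adj_def cc_edges_def by auto
    have "\<exists>L U. L \<subseteq> U \<and> U \<subseteq> {..<n} \<and> {\<phi> A, \<phi> B} = \<phi> ` {A. L \<subseteq> A \<and> A \<subseteq> U}"
      using subsetD[OF equalityD1[OF F] wu] by (elim CollectE exE conjE) (intro exI conjI)
    then obtain L U where LU: "L \<subseteq> U" "U \<subseteq> {..<n}" "{\<phi> A, \<phi> B} = \<phi> ` {A. L \<subseteq> A \<and> A \<subseteq> U}" by (elim exE conjE)
    have int: "{C. L \<subseteq> C \<and> C \<subseteq> U} = (\<lambda>B. L \<union> B) ` Pow (U - L)"
    proof (intro equalityI subsetI)
      fix C assume "C \<in> {C. L \<subseteq> C \<and> C \<subseteq> U}"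
      then show "C \<in> (\<lambda>B. L \<union> B) ` Pow (U - L)" by (intro image_eqI[of _ _ "C - L"]) auto
    qed (use LU in auto)
    have fin: "finite (U - L)" using LU(2) finite_subset by blast
    have "inj_on \<phi> {C. L \<subseteq> C \<and> C \<subseteq> U}" by (rule inj_on_subset[OF inj]) (use LU in auto)
    then have "card {\<phi> A, \<phi> B} = card {C. L \<subseteq> C \<and> C \<subseteq> U}" unfolding LU(3) by (rule card_image)
    also have "\<dots> = card (Pow (U - L))" unfolding int by (rule card_image) (auto simp: inj_on_def)
    finally have "2 ^ card (U - L) = (2 ^ 1 :: nat)" using adj_neq[OF AB(3)] fin by (simp add: card_Pow)
    then have "card (U - L) = 1" by (subst (asm) power_inject_exp) auto
    then obtain i where i: "U - L = {i}" by (meson card_1_singletonE)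
    then have U: "U = insert i L" "i \<notin> L" "i < n" using LU by auto
    then have e: "{\<phi> A, \<phi> B} = {\<phi> L, \<phi> (insert i L)}" using LU(3) image_interval_edge[of i L \<phi>] by simp
    have P: "L \<subseteq> {..<n}" "insert i L \<subseteq> {..<n}" using LU U by auto
    have i1: "C = D" if "\<phi> C = \<phi> D" "C \<subseteq> {..<n}" "D \<subseteq> {..<n}" for C D
      using inj_onD[OF inj that(1)] that by auto
    have "\<phi> A = \<phi> L \<and> \<phi> B = \<phi> (insert i L) \<or> \<phi> A = \<phi> (insert i L) \<and> \<phi> B = \<phi> L"
      using e by (auto simp: doubleton_eq_iff)
    then have "A = L \<and> B = insert i L \<or> A = insert i L \<and> B = L" using i1 AB P by metis
    then show ?thesis using U by blast
  qed
  show thesis by (rule that[OF bij w face e e3])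
qed

lemma cube_chart_neighbour:
  assumes "bij_betw \<phi> (Pow {..<n::nat}) c" "\<phi> {} = w"
    and "\<And>A B. A \<subseteq> {..<n} \<Longrightarrow> B \<subseteq> {..<n} \<Longrightarrow> adj (\<phi> A) (\<phi> B) \<Longrightarrow> \<exists>i<n. i \<notin> A \<and> B = insert i A \<or> i \<notin> B \<and> A = insert i B"
    and "u \<in> c" "adj w u"
  shows "\<exists>i<n. u = \<phi> {i}"
proof -
  have "u \<in> \<phi> ` Pow {..<n}" using assms(1,4) by (simp add: bij_betw_def)
  then obtain B where B: "B \<subseteq> {..<n}" "u = \<phi> B" by blast
  have "adj (\<phi> {}) (\<phi> B)" using assms(2,5) B by simp
  from assms(3)[OF empty_subsetI B(1) this] show ?thesis using B by auto
qed

lemma cube_chart_adj: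
  assumes "bij_betw \<phi> (Pow {..<n::nat}) c"
    "\<And>L U. L \<subseteq> U \<Longrightarrow> U \<subseteq> {..<n} \<Longrightarrow> \<phi> ` {A. L \<subseteq> A \<and> A \<subseteq> U} \<in> X"
    "A \<subseteq> {..<n}" "i < n" "i \<notin> A"
  shows "adj (\<phi> A) (\<phi> (insert i A))"
proof -
  have "{\<phi> A, \<phi> (insert i A)} \<in> X" using assms(2)[of A "insert i A"] image_interval_edge[OF assms(5), of \<phi>] assms(3,4) by (simp add: subset_insertI)
  moreover have "\<phi> A \<noteq> \<phi> (insert i A)"
    using inj_onD[OF bij_betw_imp_inj_on[OF assms(1)], of A "insert i A"] assms(3-5) by auto
  ultimately show ?thesis unfolding adj_def cc_edges_def by auto
qed

definition sq :: "'v \<Rightarrow> 'v \<Rightarrow> 'v \<Rightarrow> 'v \<Rightarrow> bool" where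
  "sq a b c d \<longleftrightarrow> {a, b, c, d} \<in> squares X \<and> adj a b \<and> adj b c \<and> adj c d \<and> adj d a"

lemma cube_chart_sq:
  assumes "bij_betw \<phi> (Pow {..<n::nat}) c"
    "\<And>L U. L \<subseteq> U \<Longrightarrow> U \<subseteq> {..<n} \<Longrightarrow> \<phi> ` {A. L \<subseteq> A \<and> A \<subseteq> U} \<in> X"
    "A \<subseteq> {..<n}" "i < n" "i \<notin> A" "j < n" "j \<notin> A" "i \<noteq> j"
  shows "sq (\<phi> A) (\<phi> (insert i A)) (\<phi> (insert i (insert j A))) (\<phi> (insert j A))"
proof -
  have inj: "inj_on \<phi> (Pow {..<n})" using assms(1) by (simp add: bij_betw_def)
  let ?I = "{B. A \<subseteq> B \<and> B \<subseteq> insert i (insert j A)}"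
  have I: "?I = {A, insert i A, insert i (insert j A), insert j A}"
    by blast
  have "A \<noteq> insert i A" "A \<noteq> insert j A" "A \<noteq> insert i (insert j A)" "insert i A \<noteq> insert j A"
    "insert i A \<noteq> insert i (insert j A)" "insert j A \<noteq> insert i (insert j A)" using assms(5,7,8) by (blast, blast, blast, blast, (metis insert_iff)+)
  then have "card ?I = 4" unfolding I by simp
  moreover have "inj_on \<phi> ?I" by (rule inj_on_subset[OF inj]) (use assms(3,4,6) in auto)
  ultimately have "card (\<phi> ` ?I) = 4" by (simp add: card_image)
  moreover have "\<phi> ` ?I \<in> X" by (rule assms(2)) (use assms(3,4,6) in auto)
  ultimately have "{\<phi> A, \<phi> (insert i A), \<phi> (insert i (insert j A)), \<phi> (insert j A)} \<in> squares X"
    unfolding squares_def using image_interval_square[OF assms(5,7), of \<phi>] by simp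
  moreover have "adj (\<phi> A) (\<phi> (insert i A))" "adj (\<phi> A) (\<phi> (insert j A))"
    using assms(4-7) by (auto intro!: cube_chart_adj[OF assms(1,2,3)])
  moreover have "adj (\<phi> (insert j A)) (\<phi> (insert i (insert j A)))"
    by (rule cube_chart_adj[OF assms(1,2)]) (use assms(3-8) in auto)
  moreover have "adj (\<phi> (insert i A)) (\<phi> (insert j (insert i A)))"
    by (rule cube_chart_adj[OF assms(1,2)]) (use assms(3-8) in auto)
  ultimately show ?thesis unfolding sq_def by (simp add: adj_commute insert_commute)
qed

lemma cube_card: "c \<in> X \<Longrightarrow> \<exists>n. card c = 2 ^ n"
  using cubes unfolding cube_complex_def is_cube_face_poset_def
  by (metis bij_betw_same_card card_Pow card_lessThan finite_lessThan)

lemma cube_inter: "c \<in> X \<Longrightarrow> d \<in> X \<Longrightarrow> c \<inter> d \<noteq> {} \<Longrightarrow> c \<inter> d \<in> X"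
  using cubes unfolding cube_complex_def by blast

lemma sq_distinct: "sq a b c d \<Longrightarrow> distinct [a, b, c, d]"
proof -
  assume "sq a b c d"
  then have "card {a, b, c, d} = 4" unfolding sq_def squares_def by auto
  then show ?thesis by (intro card_distinct) simp
qed

lemma sq_rot: "sq a b c d \<Longrightarrow> sq b c d a" unfolding sq_def by (auto simp: insert_commute)
lemma sq_flip: "sq a b c d \<Longrightarrow> sq a d c b" unfolding sq_def by (auto simp: insert_commute adj_commute)

text \<open>
  Otherwise the two squares would meet in three vertices, which is not the size of a cube.
\<close>

lemma sq_unique:
  assumes "sq a b c d" "sq a b c' d" shows "c = c'"
proof -
  let ?s = "{a, b, c, d}" and ?t = "{a, b, c', d}"
  have s: "?s \<in> X" "?t \<in> X" using assms unfolding sq_def squares_def by auto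
  then have "?s \<inter> ?t \<in> X" by (rule cube_inter) blast
  then obtain n where n: "card (?s \<inter> ?t) = 2 ^ n" using cube_card by auto
  show ?thesis
  proof (rule ccontr)
    assume "c \<noteq> c'"
    then have "?s \<inter> ?t = {a, b, d}" using sq_distinct[OF assms(1)] sq_distinct[OF assms(2)] by auto
    moreover have "card {a, b, d} = 3" using sq_distinct[OF assms(1)] by auto
    ultimately have 3: "2 ^ n = (3::nat)" using n by simp
    show False
    proof (cases n)
      case (Suc m) then have "even (2 ^ n :: nat)" by simp then show False using 3 by simp
    qed (use 3 in simp)
  qed
qed

lemma sq_link:
  assumes "sq a b c d"
  shows "{b, d} \<in> cc_link X a"
proof -
  let ?s = "{a, b, c, d}"
  have s: "?s \<in> X" "card ?s = 4" using assms unfolding sq_def squares_def by auto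
  obtain n \<phi> where ch: "bij_betw \<phi> (Pow {..<n::nat}) ?s" "\<phi> {} = a"
    and e: "\<And>A B. A \<subseteq> {..<n} \<Longrightarrow> B \<subseteq> {..<n} \<Longrightarrow> adj (\<phi> A) (\<phi> B) \<Longrightarrow> \<exists>i<n. i \<notin> A \<and> B = insert i A \<or> i \<notin> B \<and> A = insert i B"
    by (rule cube_chart[OF s(1) insertI1]) (rule that; assumption)
  have "2 ^ n = (2^2 :: nat)" using s(2) bij_betw_same_card[OF ch(1)] by (simp add: card_Pow)
  then have n: "n = 2" by (subst (asm) power_inject_exp) auto
  obtain i j where ij: "i < 2" "j < 2" "b = \<phi> {i}" "d = \<phi> {j}"
    using cube_chart_neighbour[OF ch e, of b] cube_chart_neighbour[OF ch e, of d] assms n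
    unfolding sq_def by (auto simp: adj_commute)
  have "\<not> adj a c"
  proof
    assume "adj a c"
    then obtain k where "k < 2" "c = \<phi> {k}" using cube_chart_neighbour[OF ch e, of c] n by auto
    then have "k = i \<or> k = j \<or> i = j" using ij by auto
    then show False using \<open>c = \<phi> {k}\<close> ij sq_distinct[OF assms] by auto
  qed
  moreover have "\<not> adj a a" using adj_neq by blast
  moreover have "adj a b" "adj a d" using assms adj_sym unfolding sq_def by blast+
  ultimately have "{b, d} = ?s \<inter> neighbours X a" by (auto simp: in_neighbours)
  with s(1) show ?thesis unfolding cc_link_def by (intro CollectI exI[of _ ?s] conjI insertI1)
qed

text \<open>
  The only use of the flag condition: three squares around \<open>w\<close> span a 3-cube, whose remaining
  three squares meet in the vertex \<open>z\<close>.
\<close>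

lemma sq_cube3:
  assumes "sq w v a u" "sq w v b u'" "sq w u t u'" "u \<noteq> u'"
  shows "\<exists>z. sq v a z b \<and> sq u a z t \<and> sq u' b z t \<and> a \<noteq> b"
proof -
  have d: "v \<noteq> u" "v \<noteq> u'" using sq_distinct[OF assms(1)] sq_distinct[OF assms(2)] by auto
  let ?N = "{v, u, u'}"
  have wV: "w \<in> verts X" using adj_verts assms(1) unfolding sq_def by blast
  have adjs: "adj w v" "adj w u" "adj w u'" using assms unfolding sq_def by (auto simp: adj_commute)
  have pr: "{v, u} \<in> cc_link X w" "{v, u'} \<in> cc_link X w" "{u, u'} \<in> cc_link X w"
    using assms sq_link by auto
  have "?N \<in> cc_link X w"
    using flag[OF wV] unfolding flag_complex_def
    by (rule allE[where x = ?N]) (use pr in \<open>auto simp: insert_commute\<close>)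
  then obtain c where c: "c \<in> X" "w \<in> c" "?N = c \<inter> neighbours X w" unfolding cc_link_def by auto
  obtain n \<phi> where ch: "bij_betw \<phi> (Pow {..<n::nat}) c" "\<phi> {} = w"
    and face: "\<And>L U. L \<subseteq> U \<Longrightarrow> U \<subseteq> {..<n} \<Longrightarrow> \<phi> ` {A. L \<subseteq> A \<and> A \<subseteq> U} \<in> X"
    and e: "\<And>A B. A \<subseteq> {..<n} \<Longrightarrow> B \<subseteq> {..<n} \<Longrightarrow> adj (\<phi> A) (\<phi> B) \<Longrightarrow> \<exists>i<n. i \<notin> A \<and> B = insert i A \<or> i \<notin> B \<and> A = insert i B"
    by (rule cube_chart[OF c(1,2)]) (rule that; assumption)
  \<comment> \<open>In a chart at \<open>w\<close>, its three neighbours become singletons and the remaining vertices unions of them.\<close>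
  obtain i j k where ijk: "i < n" "j < n" "k < n" "v = \<phi> {i}" "u = \<phi> {j}" "u' = \<phi> {k}"
    using cube_chart_neighbour[OF ch e, of v] cube_chart_neighbour[OF ch e, of u]
      cube_chart_neighbour[OF ch e, of u'] c(3) adjs by blast
  have ne: "i \<noteq> j" "i \<noteq> k" "j \<noteq> k" using d assms(4) ijk by auto
  note S = cube_chart_sq[OF ch(1) face]
  have "sq w v (\<phi> {i,j}) u" using S[of "{}" i j] ijk ne ch(2) by auto
  then have a: "a = \<phi> {i,j}" using sq_unique assms(1) by blast
  have "sq w v (\<phi> {i,k}) u'" using S[of "{}" i k] ijk ne ch(2) by auto
  then have b: "b = \<phi> {i,k}" using sq_unique assms(2) by blast
  have "sq w u (\<phi> {j,k}) u'" using S[of "{}" j k] ijk ne ch(2) by auto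
  then have t: "t = \<phi> {j,k}" using sq_unique assms(3) by blast
  have "sq (\<phi> {i}) (\<phi> {j,i}) (\<phi> {j,k,i}) (\<phi> {k,i})" using S[of "{i}" j k] ijk ne by auto
  moreover have "sq (\<phi> {j}) (\<phi> {i,j}) (\<phi> {i,k,j}) (\<phi> {k,j})" using S[of "{j}" i k] ijk ne by auto
  moreover have "sq (\<phi> {k}) (\<phi> {i,k}) (\<phi> {i,j,k}) (\<phi> {j,k})" using S[of "{k}" i j] ijk ne by auto
  ultimately have S3: "sq v a (\<phi> {i,j,k}) b" "sq u a (\<phi> {i,j,k}) t" "sq u' b (\<phi> {i,j,k}) t"
    unfolding a b t ijk(4-6) by (simp_all add: insert_commute)
  moreover have "a \<noteq> b" using sq_distinct[OF S3(1)] by simp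
  ultimately show ?thesis by blast
qed

end

section \<open>Edge paths up to square swaps\<close>

context cat0_complex begin

text \<open>
  Edge paths are handled as lists that grow at the head, so the head is the current position and
  the last entry is the fixed base vertex.
\<close>

inductive swap :: "'v list \<Rightarrow> 'v list \<Rightarrow> bool" where
  swap_head: "sq a b c d \<Longrightarrow> swap (a # b # c # p) (a # d # c # p)"
| swap_tail: "swap p q \<Longrightarrow> swap (a # p) (a # q)"

abbreviation swaps :: "'v list \<Rightarrow> 'v list \<Rightarrow> bool" where "swaps \<equiv> swap\<^sup>*\<^sup>*"

lemma swap_sym: "swap p q \<Longrightarrow> swap q p"
  by (induction rule: swap.induct) (auto intro: swap.intros sq_flip)

lemma swaps_sym: "swaps p q \<Longrightarrow> swaps q p"
  by (metis (no_types, lifting) swap_sym symp_def symp_rtranclp)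

lemma swap_inv: "swap p q \<Longrightarrow> length p = length q \<and> hd p = hd q \<and> last p = last q \<and> p \<noteq> [] \<and> q \<noteq> []"
  by (induction rule: swap.induct) auto

lemma swaps_inv: "swaps p q \<Longrightarrow> length p = length q \<and> hd p = hd q \<and> last p = last q"
  by (induction rule: rtranclp_induct) (auto dest: swap_inv)

lemma swaps_Cons: "swaps p q \<Longrightarrow> swaps (a # p) (a # q)"
proof (induction rule: rtranclp_induct)
  case (step y z)
  then show ?case using swap_tail[of y z a] by (meson rtranclp.rtrancl_into_rtrancl)
qed simp

lemma swaps_trans: "swaps p q \<Longrightarrow> swaps q r \<Longrightarrow> swaps p r" by (rule rtranclp_trans)

text \<open>
  If swaps change the second vertex of a path from \<open>w\<close> to \<open>w'\<close>, they amount to one swap across a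
  square at the head, preceded and followed by swaps of the tails. Two consecutive swaps at the
  head are merged into one by means of a 3-cube, and the swaps of the tails needed in between are
  handled by induction on the length.
\<close>

lemma swaps_last_edge:
  "swaps (v # w # p) (v # w' # p') \<Longrightarrow> (w = w' \<and> swaps (w # p) (w' # p')) \<or>
     (\<exists>u s. sq v w u w' \<and> swaps (w # p) (w # u # s) \<and> swaps (w' # p') (w' # u # s))"
proof (induction "length p" arbitrary: v w p w' p' rule: less_induct)
  case less
  define P where "P w' p' \<longleftrightarrow> (w = w' \<and> swaps (w # p) (w' # p')) \<or>
     (\<exists>u s. sq v w u w' \<and> swaps (w # p) (w # u # s) \<and> swaps (w' # p') (w' # u # s))" for w' p'
  have "\<forall>w' p'. q = v # w' # p' \<longrightarrow> P w' p'" if "swaps (v # w # p) q" for q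
    using that
  proof (induction rule: rtranclp_induct)
    case base
    then show ?case by (simp add: P_def)
  next
    case (step y z)
    show ?case
    proof (intro allI impI)
      fix w3 p3 assume z: "z = v # w3 # p3"
      from step(2) show "P w3 p3"
      proof cases
        case (swap_tail y' z' a)
        then have y': "swap y' (w3 # p3)" "y = v # y'" using z by auto
        then obtain p2 where p2: "y' = w3 # p2" using swap_inv[OF y'(1)] by (cases y') auto
        then have "P w3 p2" using step(3) y' by simp
        moreover have "swaps (w3 # p2) (w3 # p3)" using y' p2 by auto
        ultimately show ?thesis unfolding P_def by (meson swaps_sym swaps_trans)
      next
        case (swap_head a b c d r)
        then have y: "y = v # b # c # r" and p3: "p3 = c # r" and s1: "sq v b c w3" using z by auto
        have "P b (c # r)" using step(3) y by simp
        then consider "w = b" "swaps (w # p) (b # c # r)" |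
          u s where "sq v w u b" "swaps (w # p) (w # u # s)" "swaps (b # c # r) (b # u # s)"
          unfolding P_def by auto
        then show ?thesis
        proof cases
          case 1
          then show ?thesis unfolding P_def p3 using s1 by blast
        next
          case 2
          have "length y = Suc (Suc (length p))" using swaps_inv[OF step(1)] by simp
          then have len: "length r < length p" using y by simp
          \<comment> \<open>the tail \<open>b # c # r\<close> reaches \<open>b # u # s\<close> by swaps, so the claim applies to it one level down\<close>
          from less(1)[OF len 2(3)]
          consider "c = u" "swaps (c # r) (u # s)" |
            t s' where "c \<noteq> u" "sq b c t u" "swaps (c # r) (c # t # s')" "swaps (u # s) (u # t # s')"
            using sq_distinct by fastforce
          then show ?thesis
          proof cases
            case 1
            have "sq b v w u" using 2(1) sq_rot by blast
            moreover have "sq b v w3 u" using s1 1 sq_rot sq_flip by blast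
            ultimately have "w = w3" using sq_unique by blast
            moreover have "swaps (w # p) (w # c # r)" using 2(2) swaps_Cons[OF swaps_sym[OF 1(2)], of w] by (rule swaps_trans)
            ultimately show ?thesis unfolding P_def p3 by simp
          next
            case b: 2
            have "sq b v w u" using 2(1) sq_rot by blast
            moreover have "sq b v w3 c" using s1 sq_rot sq_flip by blast
            moreover have "sq b u t c" using b(2) sq_flip by blast
            ultimately obtain z where z: "sq v w z w3" "sq u w z t" "sq c w3 z t"
              using sq_cube3[of b v w u w3 c t] b(1) by auto
            have "sq w u t z" using z(2) sq_rot sq_flip by blast
            then have "swaps (w # u # t # s') (w # z # t # s')" using swap.swap_head by blast
            moreover have "swaps (w # p) (w # u # t # s')" using 2(2) swaps_Cons[OF b(4)] by (rule swaps_trans)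
            ultimately have 3: "swaps (w # p) (w # z # t # s')" using swaps_trans by blast
            have "sq w3 c t z" using z(3) sq_rot sq_flip by blast
            then have "swaps (w3 # c # t # s') (w3 # z # t # s')" using swap.swap_head by blast
            then have "swaps (w3 # c # r) (w3 # z # t # s')" using swaps_Cons[OF b(3)] swaps_trans by blast
            then show ?thesis unfolding P_def p3 using z(1) 3 by blast
          qed
        qed
      qed
    qed
  qed
  then show ?case using less(2) unfolding P_def by blast
qed

lemma swaps_cancel: "swaps (v # w # p) (v # w # p') \<Longrightarrow> swaps (w # p) (w # p')"
  using swaps_last_edge[of v w p w p'] sq_distinct by fastforce

text \<open>
  The last clause forbids that \<open>w # v # p\<close> becomes \<open>w # v # w # q\<close>, a backtrack at the head, after
  swaps of its tail.
\<close>

fun reduced :: "'v list \<Rightarrow> bool" where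
  "reduced [] = False"
| "reduced [v] = (v \<in> verts X)"
| "reduced (w # v # p) = (adj w v \<and> reduced (v # p) \<and> \<not> (\<exists>q. swaps (v # p) (v # w # q)))"

lemma reduced_swap: "swap p q \<Longrightarrow> reduced p \<Longrightarrow> reduced q"
proof (induction rule: swap.induct)
  case (swap_head a b c d p)
  have r: "reduced (b # c # p)" "reduced (c # p)" "\<And>q. \<not> swaps (c # p) (c # b # q)" "\<And>q. \<not> swaps (b # c # p) (b # a # q)"
    using swap_head(2) by auto
  have adjs: "adj d c" "adj a d" using swap_head(1) unfolding sq_def by (auto simp: adj_commute)
  have "\<not> swaps (c # p) (c # d # s)" for s
  proof
    assume "swaps (c # p) (c # d # s)"
    then have "swaps (b # c # p) (b # c # d # s)" by (rule swaps_Cons)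
    moreover have "swap (b # c # d # s) (b # a # d # s)"
      using swap_head(1) sq_rot swap.swap_head by blast
    ultimately show False using r(4) by (meson rtranclp.rtrancl_into_rtrancl)
  qed
  then have "reduced (d # c # p)" using r(2) adjs by auto
  moreover have "\<not> swaps (d # c # p) (d # a # s)" for s
  proof
    assume "swaps (d # c # p) (d # a # s)"
    from swaps_last_edge[OF this] sq_distinct[OF swap_head(1)]
    obtain z s' where z: "sq d c z a" "swaps (c # p) (c # z # s')" by auto
    have "sq d c b a" using swap_head(1) sq_rot sq_flip by blast
    then have "z = b" using z(1) sq_unique by blast
    then show False using z r(3) by blast
  qed
  ultimately show ?case using adjs by auto
next
  case (swap_tail p q a)
  obtain v p' q' where pq: "p = v # p'" "q = v # q'"
    using swap_inv[OF swap_tail(1)] by (metis list.exhaust_sel)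
  have "reduced q" using swap_tail pq by auto
  moreover have "\<not> swaps q (v # a # r)" for r
    using swap_tail(1,3) pq by (auto intro: converse_rtranclp_into_rtranclp)
  ultimately show ?case using swap_tail(3) pq by auto
qed

lemma reduced_swaps: "swaps p q \<Longrightarrow> reduced p \<Longrightarrow> reduced q"
  by (induction rule: rtranclp_induct) (auto intro: reduced_swap)

text \<open>
  One step of the action on reduced paths: cancel the backtrack if swaps produce one, else
  lengthen the path. The chosen path is determined only up to swaps.
\<close>

definition prepend :: "'v \<Rightarrow> 'v list \<Rightarrow> 'v list" where
  "prepend w q = (if \<exists>r. swaps q (hd q # w # r) then w # (SOME r. swaps q (hd q # w # r)) else w # q)"

lemma prepend_eq: assumes "swaps q (a # w # r)" shows "swaps (prepend w q) (w # r)"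
proof -
  have h: "hd q = a" using swaps_inv[OF assms] by simp
  then have "swaps q (hd q # w # (SOME r. swaps q (hd q # w # r)))" using assms by (intro someI) auto
  then have "swaps (a # w # (SOME r. swaps q (hd q # w # r))) (a # w # r)"
    using assms h swaps_sym swaps_trans by metis
  then have "swaps (w # (SOME r. swaps q (hd q # w # r))) (w # r)" by (rule swaps_cancel)
  then show ?thesis unfolding prepend_def using assms h by auto
qed

lemma prepend_new: "(\<And>r. \<not> swaps q (hd q # w # r)) \<Longrightarrow> prepend w q = w # q" unfolding prepend_def by auto

lemma prepend_cong: assumes "swaps q q'" shows "swaps (prepend w q) (prepend w q')"
proof (cases "\<exists>r. swaps q (hd q # w # r)")
  case True
  then obtain r where r: "swaps q (hd q # w # r)" by blast
  then have "swaps q' (hd q # w # r)" using assms swaps_sym swaps_trans by blast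
  then show ?thesis using prepend_eq r swaps_sym swaps_trans by blast
next
  case False
  have h: "hd q = hd q'" using swaps_inv[OF assms] by simp
  then have "\<not> (\<exists>r. swaps q' (hd q' # w # r))" using False assms swaps_trans by metis
  then show ?thesis using False assms swaps_Cons unfolding prepend_def by auto
qed

lemma prepend_reduced:
  assumes "reduced q" "adj w (hd q)"
  shows "reduced (prepend w q) \<and> hd (prepend w q) = w \<and> last (prepend w q) = last q \<and> length (prepend w q) \<le> Suc (length q)"
proof (cases "\<exists>r. swaps q (hd q # w # r)")
  case True
  then obtain r where r: "swaps q (hd q # w # r)" by blast
  then have "reduced (w # r)" using reduced_swaps[OF r assms(1)] by auto
  moreover note e = prepend_eq[OF r]
  ultimately have "reduced (prepend w q)" using reduced_swaps swaps_sym by blast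
  then show ?thesis using swaps_inv[OF e] swaps_inv[OF r] by auto
next
  case False
  obtain v p where q: "q = v # p" using assms(1) by (cases q) auto
  have "prepend w q = w # q" using False prepend_new by blast
  then show ?thesis using assms False q by auto
qed

text \<open>
  Together with \<open>prepend_sq\<close> this says that prepending respects the two elementary homotopies,
  which makes it an action of homotopy classes on swap classes of reduced paths.
\<close>

lemma prepend_back:
  assumes "reduced q" "hd q = a" "adj a b" shows "swaps (prepend a (prepend b q)) q"
proof -
  obtain q0 where q: "q = a # q0" using assms by (cases q) auto
  show ?thesis
  proof (cases "\<exists>r. swaps q (a # b # r)")
    case True
    then obtain r where r: "swaps q (a # b # r)" by blast
    then have "reduced (a # b # r)" using reduced_swaps assms by blast
    then have "prepend a (b # r) = a # b # r" by (intro prepend_new) auto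
    then show ?thesis using prepend_cong[OF prepend_eq[OF r], of a] r swaps_sym swaps_trans by metis
  next
    case False
    then have e: "prepend b q = b # a # q0" using prepend_new[of q b] q by simp
    have "swaps (prepend a (b # a # q0)) (a # q0)" by (rule prepend_eq[of _ b]) simp
    then show ?thesis using e q by simp
  qed
qed

lemma prepend_sq1:
  assumes "reduced q" "hd q = a" "sq a b c d" "swaps q (a # b # r)" "\<And>r. \<not> swaps q (a # d # r)"
  shows "swaps (prepend c (prepend b q)) (prepend c (prepend d q))"
proof -
  have e: "prepend d q = d # q" using prepend_new[of q d] assms by simp
  have "\<not> swaps (b # r) (b # c # s)" for s
  proof
    assume "swaps (b # r) (b # c # s)"
    then have "swaps q (a # b # c # s)" using assms(4) swaps_Cons swaps_trans by blast
    moreover have "swap (a # b # c # s) (a # d # c # s)" using assms(3) swap.swap_head by blast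
    ultimately show False using assms(5) by (meson rtranclp.rtrancl_into_rtrancl)
  qed
  then have "prepend c (b # r) = c # b # r" by (intro prepend_new) auto
  then have 1: "swaps (prepend c (prepend b q)) (c # b # r)" using prepend_cong[OF prepend_eq[OF assms(4)], of c] by simp
  have "swaps (d # q) (d # a # b # r)" using assms(4) by (rule swaps_Cons)
  moreover have "swap (d # a # b # r) (d # c # b # r)" using assms(3) sq_rot swap.swap_head by blast
  ultimately have "swaps (d # q) (d # c # b # r)" by (meson rtranclp.rtrancl_into_rtrancl)
  then have "swaps (prepend c (prepend d q)) (c # b # r)" unfolding e by (rule prepend_eq)
  then show ?thesis using 1 swaps_sym swaps_trans by blast
qed

text \<open>
  The four cases record which of the edges from \<open>a\<close> to its two neighbours in the square can be
  cancelled by swaps.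
\<close>

lemma prepend_sq:
  assumes "reduced q" "hd q = a" "sq a b c d"
  shows "swaps (prepend c (prepend b q)) (prepend c (prepend d q))"
proof -
  obtain q0 where q: "q = a # q0" using assms by (cases q) auto
  note dist = sq_distinct[OF assms(3)]
  consider (bd) r r' where "swaps q (a # b # r)" "swaps q (a # d # r')"
    | (b) r where "swaps q (a # b # r)" "\<And>r. \<not> swaps q (a # d # r)"
    | (d) r where "swaps q (a # d # r)" "\<And>r. \<not> swaps q (a # b # r)"
    | (none) "\<And>r. \<not> swaps q (a # b # r)" "\<And>r. \<not> swaps q (a # d # r)" by blast
  then show ?thesis
  proof cases
    case bd
    then have "swaps (a # b # r) (a # d # r')" using swaps_sym swaps_trans by blast
    from swaps_last_edge[OF this] dist
    obtain u s where u: "sq a b u d" "swaps (b # r) (b # u # s)" "swaps (d # r') (d # u # s)" by auto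
    have "u = c" using u(1) assms(3) sq_unique by blast
    then have "swaps (prepend b q) (b # c # s)" "swaps (prepend d q) (d # c # s)"
      using prepend_eq[OF bd(1)] prepend_eq[OF bd(2)] u swaps_trans by blast+
    then have "swaps (prepend c (prepend b q)) (c # s)" "swaps (prepend c (prepend d q)) (c # s)" by (auto intro: prepend_eq)
    then show ?thesis using swaps_sym swaps_trans by blast
  next
    case b then show ?thesis using prepend_sq1 assms by blast
  next
    case d then show ?thesis using prepend_sq1[OF assms(1,2) sq_flip[OF assms(3)]] swaps_sym by blast
  next
    case none
    have eb: "prepend b q = b # a # q0" and ed: "prepend d q = d # a # q0" using prepend_new[of q b] prepend_new[of q d] none q by auto
    have "\<not> swaps (b # a # q0) (b # c # s)" for s
    proof
      assume "swaps (b # a # q0) (b # c # s)"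
      from swaps_last_edge[OF this] dist
      obtain z s' where z: "sq b a z c" "swaps (a # q0) (a # z # s')" by auto
      have "sq b a d c" using assms(3) sq_rot sq_flip by blast
      then have "z = d" using z(1) sq_unique by blast
      then show False using none(2) z q by blast
    qed
    then have 1: "prepend c (prepend b q) = c # b # a # q0" unfolding eb by (intro prepend_new) auto
    have "\<not> swaps (d # a # q0) (d # c # s)" for s
    proof
      assume "swaps (d # a # q0) (d # c # s)"
      from swaps_last_edge[OF this] dist
      obtain z s' where z: "sq d a z c" "swaps (a # q0) (a # z # s')" by auto
      have "sq d a b c" using assms(3) sq_rot sq_flip by blast
      then have "z = b" using z(1) sq_unique by blast
      then show False using none(1) z q by blast
    qed
    then have 2: "prepend c (prepend d q) = c # d # a # q0" unfolding ed by (intro prepend_new) auto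
    have "sq c b a d" using assms(3) sq_rot sq_flip by blast
    then show ?thesis unfolding 1 2 using swap.swap_head by blast
  qed
qed

fun normal_form :: "'v list \<Rightarrow> 'v list" where
  "normal_form [] = []" | "normal_form [v] = [v]" | "normal_form (w # v # p) = prepend w (normal_form (v # p))"

lemma normal_form_Cons: "p \<noteq> [] \<Longrightarrow> normal_form (w # p) = prepend w (normal_form p)" by (cases p) auto

lemma edge_path_Cons: "edge_path X (w # p) \<longleftrightarrow> w \<in> verts X \<and> (p = [] \<or> adj w (hd p) \<and> edge_path X p)"
  unfolding edge_path_def adj_def[symmetric] by (cases p) auto

lemma edge_path_rev: "edge_path X (rev p) \<longleftrightarrow> edge_path X p"
proof -
  have "(\<lambda>x y. {y, x} \<in> cc_edges X) = (\<lambda>x y. {x, y} \<in> cc_edges X)" by (simp add: insert_commute)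
  from arg_cong[OF this, of "\<lambda>P. successively P p"] show ?thesis
    unfolding edge_path_def successively_rev by simp
qed

lemma edge_path_suffix: "edge_path X (u @ t) \<Longrightarrow> t \<noteq> [] \<Longrightarrow> edge_path X t"
  by (induction u) (auto simp: edge_path_Cons)

lemma normal_form_reduced: "edge_path X p \<Longrightarrow> reduced (normal_form p) \<and> hd (normal_form p) = hd p \<and> last (normal_form p) = last p \<and> length (normal_form p) \<le> length p"
proof (induction p)
  case (Cons w p)
  show ?case
  proof (cases "p = []")
    case True then show ?thesis using Cons(2) by (simp add: edge_path_Cons)
  next
    case False
    then have "adj w (hd p)" "edge_path X p" using Cons(2) by (auto simp: edge_path_Cons)
    then show ?thesis using Cons(1) prepend_reduced[of "normal_form p" w] False normal_form_Cons[OF False, of w] by auto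
  qed
qed (simp add: edge_path_def)

lemma reduced_path: "reduced p \<Longrightarrow> edge_path X p"
  by (induction p rule: reduced.induct) (auto simp: edge_path_Cons dest: adj_verts)

lemma normal_form_id: "reduced p \<Longrightarrow> normal_form p = p"
  by (induction p rule: reduced.induct) (auto simp: prepend_new)

lemma normal_form_append_cong: "swaps (normal_form t) (normal_form t') \<Longrightarrow> t \<noteq> [] \<Longrightarrow> t' \<noteq> [] \<Longrightarrow> swaps (normal_form (u @ t)) (normal_form (u @ t'))"
  by (induction u) (auto simp: normal_form_Cons intro: prepend_cong)

lemma edge_path_append_iff:
  "t \<noteq> [] \<Longrightarrow> t' \<noteq> [] \<Longrightarrow> hd t = hd t' \<Longrightarrow> edge_path X t \<longleftrightarrow> edge_path X t' \<Longrightarrow> edge_path X (u @ t) \<longleftrightarrow> edge_path X (u @ t')"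
  by (induction u) (auto simp: edge_path_Cons hd_append)

lemma normal_form_elem:
  assumes "elem_homotopic X p q" "edge_path X p \<or> edge_path X q"
  shows "edge_path X p \<and> edge_path X q \<and> swaps (normal_form p) (normal_form q)"
  using assms
proof (cases rule: elem_homotopic.cases)
  case (backtrack a b u t)
  have ab: "adj a b" using backtrack(3) by (simp add: adj_def)
  have i: "edge_path X (a # b # a # t) \<longleftrightarrow> edge_path X (a # t)"
    using ab adj_verts by (auto simp: edge_path_Cons adj_commute)
  have iff: "edge_path X p \<longleftrightarrow> edge_path X q"
    unfolding backtrack(1,2) using i edge_path_append_iff[of "a # b # a # t" "a # t" u] by simp
  then have "edge_path X (a # t)" using assms(2) edge_path_suffix[of u "a # t"] backtrack(2) by auto
  then have "swaps (normal_form (a # b # a # t)) (normal_form (a # t))"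
    using normal_form_reduced[of "a # t"] prepend_back[of "normal_form (a # t)" a b] ab by (simp add: normal_form_Cons)
  then show ?thesis using iff assms(2) normal_form_append_cong[of "a # b # a # t" "a # t" u] backtrack(1,2) by simp
next
  case (square a b c d u t)
  have s: "sq c b a d" using square(3-7) unfolding sq_def adj_def by (auto simp: insert_commute)
  have i: "edge_path X (a # b # c # t) \<longleftrightarrow> edge_path X (a # d # c # t)"
    using s adj_verts unfolding sq_def by (auto simp: edge_path_Cons adj_commute)
  have iff: "edge_path X p \<longleftrightarrow> edge_path X q"
    unfolding square(1,2) using i edge_path_append_iff[of "a # b # c # t" "a # d # c # t" u] by simp
  then have "edge_path X (c # t)" using assms(2) edge_path_suffix[of "u @ [a, b]" "c # t"] square(1) by auto
  then have "swaps (normal_form (a # b # c # t)) (normal_form (a # d # c # t))"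
    using normal_form_reduced[of "c # t"] prepend_sq[of "normal_form (c # t)" c b a d] s by (simp add: normal_form_Cons)
  then show ?thesis using iff assms(2) normal_form_append_cong[of "a # b # c # t" "a # d # c # t" u] square(1,2) by simp
qed

lemma normal_form_homotopic: "edge_homotopic X p q \<Longrightarrow> edge_path X p \<Longrightarrow> edge_path X q \<and> swaps (normal_form p) (normal_form q)"
  unfolding edge_homotopic_def
proof (induction rule: equivclp_induct)
  case (step y z)
  then show ?case using normal_form_elem swaps_sym swaps_trans by meson
qed simp

lemma elem_homotopic_append: "elem_homotopic X p q \<Longrightarrow> elem_homotopic X (u @ p @ w) (u @ q @ w)"
proof (induction rule: elem_homotopic.induct)
  case (backtrack a b p q)
  then show ?case using elem_homotopic.backtrack[of a b X "u @ p" "q @ w"] by simp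
next
  case (square a b c d p q)
  then show ?case using elem_homotopic.square[of a b c d X "u @ p" "q @ w"] by simp
qed

lemma edge_homotopic_append: "edge_homotopic X p q \<Longrightarrow> edge_homotopic X (u @ p @ w) (u @ q @ w)"
  unfolding edge_homotopic_def
proof (induction rule: equivclp_induct)
  case (step y z)
  then have "elem_homotopic X (u @ y @ w) (u @ z @ w) \<or> elem_homotopic X (u @ z @ w) (u @ y @ w)"
    using elem_homotopic_append by blast
  then show ?case using step(3) by (metis equivclp_into_equivclp)
qed simp

lemma edge_homotopic_trans: "edge_homotopic X p q \<Longrightarrow> edge_homotopic X q r \<Longrightarrow> edge_homotopic X p r"
  unfolding edge_homotopic_def by (rule equivclp_trans)

lemma edge_homotopic_sym: "edge_homotopic X p q \<Longrightarrow> edge_homotopic X q p"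
  unfolding edge_homotopic_def by (rule equivclp_sym)

lemma path_cancel: "edge_path X p \<Longrightarrow> edge_homotopic X (rev p @ tl p) [last p]"
proof (induction p)
  case (Cons x p)
  show ?case
  proof (cases p)
    case Nil then show ?thesis by (simp add: edge_homotopic_def)
  next
    case (Cons y p')
    have xy: "{y, x} \<in> cc_edges X" "edge_path X p"
      using Cons.prems Cons by (auto simp: edge_path_Cons adj_def insert_commute)
    have "elem_homotopic X (rev p' @ [y, x, y] @ p') (rev p' @ [y] @ p')"
      by (rule elem_homotopic.backtrack[OF xy(1)])
    then have "edge_homotopic X (rev (x # p) @ tl (x # p)) (rev p @ tl p)"
      unfolding edge_homotopic_def Cons by auto
    moreover have "last (x # p) = last p" using Cons by simp
    ultimately show ?thesis using edge_homotopic_trans[OF _ Cons.IH[OF xy(2)]] by simp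
  qed
qed (simp add: edge_path_def)

text \<open>
  The action computes the normal form of a path from its homotopy class alone, and it fixes
  reduced paths. By simple connectivity the two paths are homotopic.
\<close>

lemma reduced_unique:
  assumes "reduced p" "reduced q" "hd p = hd q" "last p = last q"
  shows "swaps p q"
proof -
  have P: "edge_path X p" "edge_path X q" using assms reduced_path by auto
  then have ne: "p \<noteq> []" "q \<noteq> []" by (auto simp: edge_path_def)
  have qe: "q = butlast q @ [last q]" using ne by simp
  have r: "rev p = last q # tl (rev p)" using ne assms(4) by (metis hd_Cons_tl hd_rev rev_is_Nil_conv)
  \<comment> \<open>the closed path runs along \<open>q\<close> and back along \<open>p\<close>\<close>
  then have L: "q @ tl (rev p) = butlast q @ rev p" using qe by (metis append.assoc append_Cons append_Nil)
  have "edge_path X (butlast q @ rev p)"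
    using edge_path_append_iff[of "[last q]" "rev p" "butlast q"] P qe r edge_path_rev ne
    by (metis edge_path_Cons hd_rev last_in_set list.distinct(1) assms(4) list.sel(1) edge_path_def subsetD)
  moreover have "hd (butlast q @ rev p) = hd q"
    using qe r ne by (metis L hd_append2)
  moreover have "last (butlast q @ rev p) = hd p" using ne by (simp add: last_rev)
  ultimately have 1: "edge_homotopic X (butlast q @ rev p) [hd q]"
    using sc assms(3) unfolding simply_connected_cc_def by metis
  have "edge_homotopic X (butlast q @ rev p @ tl p) ([hd q] @ tl p)"
    using edge_homotopic_append[OF 1, of "[]" "tl p"] by simp
  moreover have "[hd q] @ tl p = p" using assms(3) ne by (cases p) auto
  moreover have "edge_homotopic X (butlast q @ rev p @ tl p) q"
    using edge_homotopic_append[OF path_cancel[OF P(1)], of "butlast q" "[]"] qe assms(4) by simp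
  ultimately have "edge_homotopic X p q" using edge_homotopic_trans edge_homotopic_sym by metis
  then show ?thesis using normal_form_homotopic[OF _ P(1)] normal_form_id assms by metis
qed

section \<open>The combinatorial distance\<close>

abbreviation d :: "'v \<Rightarrow> 'v \<Rightarrow> nat" where "d \<equiv> cc_dist X"

lemma reduced_exists: assumes "v \<in> verts X" "w \<in> verts X" obtains p where "reduced p" "hd p = v" "last p = w"
  using conn normal_form_reduced assms unfolding connected_cc_def by metis

text \<open>
  Normalising never lengthens a path, and swaps keep the length, so reduced paths are the
  geodesics.
\<close>

lemma d_reduced: assumes "reduced p" shows "Suc (d (hd p) (last p)) = length p"
proof -
  have P: "edge_path X p" using assms reduced_path by auto
  let ?Q = "\<lambda>n. \<exists>q. edge_path X q \<and> hd q = hd p \<and> last q = last p \<and> length q = Suc n"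
  have len: "length p = Suc (length p - 1)" using P by (cases p) (auto simp: edge_path_def)
  have Q: "?Q (length p - 1)" using P len by blast
  have "?Q (d (hd p) (last p))" unfolding cc_dist_def by (rule LeastI[of ?Q, OF Q])
  then obtain q where q: "edge_path X q" "hd q = hd p" "last q = last p" "length q = Suc (d (hd p) (last p))" by blast
  have "swaps p (normal_form q)" by (rule reduced_unique) (use normal_form_reduced[OF q(1)] q assms in auto)
  then have "length p \<le> Suc (d (hd p) (last p))" using swaps_inv normal_form_reduced[OF q(1)] q by fastforce
  moreover have "d (hd p) (last p) \<le> length p - 1" unfolding cc_dist_def by (rule Least_le[of ?Q, OF Q])
  ultimately show ?thesis using len by linarith
qed

lemma d_sym: "d v w = d w v"
proof -
  have "(\<exists>p. edge_path X p \<and> hd p = v \<and> last p = w \<and> length p = Suc n) \<longleftrightarrow>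
    (\<exists>p. edge_path X p \<and> hd p = w \<and> last p = v \<and> length p = Suc n)" for v w n
  proof -
    have *: "\<exists>p. edge_path X p \<and> hd p = w \<and> last p = v \<and> length p = Suc n"
      if "edge_path X p \<and> hd p = v \<and> last p = w \<and> length p = Suc n" for p v w
      using that edge_path_rev[of p] by (intro exI[of _ "rev p"]) (auto simp: hd_rev last_rev)
    show ?thesis using * by blast
  qed
  then show ?thesis unfolding cc_dist_def by presburger
qed

text \<open>
  In a reduced path from \<open>v\<close>, prepending \<open>w\<close> either cancels or lengthens; so the 1-skeleton is
  bipartite.
\<close>

lemma d_step:
  assumes "adj v w" "x \<in> verts X"
  shows "d w x = Suc (d v x) \<or> d v x = Suc (d w x)"
proof -
  obtain p where p: "reduced p" "hd p = v" "last p = x" using reduced_exists assms adj_verts by blast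
  obtain p0 where p0: "p = v # p0" using p by (cases p) auto
  show ?thesis
  proof (cases "\<exists>q. swaps p (v # w # q)")
    case True
    then obtain q where q: "swaps p (v # w # q)" by blast
    have "reduced (v # w # q)" using reduced_swaps q p by blast
    then have "reduced (w # q)" by auto
    from d_reduced[OF this] d_reduced[OF p(1)] show ?thesis using swaps_inv[OF q] p by auto
  next
    case False
    then have "reduced (w # p)" using p p0 assms(1) adj_commute by auto
    from d_reduced[OF this] d_reduced[OF p(1)] show ?thesis using p p0 by auto
  qed
qed

text \<open>
  The two geodesics through \<open>w\<close> and \<open>w'\<close> are reduced with common endpoints, hence swap-equivalent,
  and \<open>swaps_last_edge\<close> provides the square.
\<close>

lemma quadrangle:
  assumes "adj v w" "adj v w'" "w \<noteq> w'" "x \<in> verts X" "d v x = Suc (d w x)" "d v x = Suc (d w' x)"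
  shows "\<exists>u. sq v w u w' \<and> d w x = Suc (d u x)"
proof -
  have reduced: "\<exists>r. reduced (v # y # r) \<and> last (y # r) = x" if y: "adj v y" "d v x = Suc (d y x)" for y
  proof -
    obtain p where p: "reduced p" "hd p = y" "last p = x"
      using reduced_exists[of y x] adj_verts[OF y(1)] assms(4) by blast
    obtain p0 where p0: "p = y # p0" using p by (cases p) auto
    have "\<not> swaps p (y # v # q)" for q
    proof
      assume q: "swaps p (y # v # q)"
      then have "reduced (y # v # q)" using reduced_swaps p by blast
      then have "reduced (v # q)" by auto
      from d_reduced[OF this] d_reduced[OF p(1)] show False using swaps_inv[OF q] p y by auto
    qed
    then show ?thesis using p p0 y by (intro exI[of _ p0]) auto
  qed
  obtain r where r: "reduced (v # w # r)" "last (w # r) = x" using reduced[OF assms(2,6)] reduced[OF assms(1,5)] by blast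
  obtain r' where r': "reduced (v # w' # r')" "last (w' # r') = x" using reduced[OF assms(2,6)] by blast
  have "swaps (v # w # r) (v # w' # r')" by (rule reduced_unique) (use r r' in auto)
  from swaps_last_edge[OF this] assms(3)
  obtain u s where u: "sq v w u w'" "swaps (w # r) (w # u # s)" by auto
  have "reduced (w # r)" using r by simp
  from reduced_swaps[OF u(2) this] have "reduced (w # u # s)" .
  then have "reduced (u # s)" by auto
  from d_reduced[OF this] d_reduced[OF \<open>reduced (w # u # s)\<close>] have "d w x = Suc (d u x)"
    using swaps_inv[OF u(2)] r(2) by auto
  then show ?thesis using u by blast
qed

lemma d_refl: "v \<in> verts X \<Longrightarrow> d v v = 0" using d_reduced[of "[v]"] by simp

lemma d_closer:
  assumes "v \<in> verts X" "x \<in> verts X" "v \<noteq> x" shows "\<exists>w. adj v w \<and> d v x = Suc (d w x)"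
proof -
  obtain p where p: "reduced p" "hd p = v" "last p = x" using reduced_exists assms by blast
  obtain p0 where p0: "p = v # p0" using p by (cases p) auto
  obtain w q where w: "p = v # w # q" using p0 p assms by (cases p0) auto
  have "reduced (w # q)" using p w by auto
  from d_reduced[OF this] d_reduced[OF p(1)] show ?thesis using p w by auto
qed

lemma d_eq_0: "v \<in> verts X \<Longrightarrow> x \<in> verts X \<Longrightarrow> d v x = 0 \<longleftrightarrow> v = x"
  using d_closer d_refl by fastforce

lemma d_adj: "adj v w \<Longrightarrow> d v w = 1"
  using d_step[of v w w] adj_verts[of v w] d_refl[of w] by auto

lemma d_triangle:
  assumes "v \<in> verts X" "w \<in> verts X" "x \<in> verts X" shows "d v x \<le> d v w + d w x"
  using assms
proof (induction "d v w" arbitrary: v)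
  case 0 then show ?case using d_eq_0 by simp
next
  case (Suc n)
  then obtain u where u: "adj v u" "d v w = Suc (d u w)" using d_closer[of v w] d_refl by force
  then have "d u x \<le> d u w + d w x" using Suc adj_verts by auto
  then show ?case using d_step[OF u(1) Suc(5)] u by auto
qed

end

section \<open>Halfspaces as comparisons of distances\<close>

context cat0_complex begin

abbreviation V where "V \<equiv> verts X"

definition hs :: "'v \<Rightarrow> 'v \<Rightarrow> 'v set" where "hs a b = {x \<in> V. d a x < d b x}"

lemma hs_mem: "adj a b \<Longrightarrow> x \<in> V \<Longrightarrow> x \<in> hs a b \<longleftrightarrow> d b x = Suc (d a x)"
  using d_step[of a b x] unfolding hs_def by auto

lemma hs_not_mem: "adj a b \<Longrightarrow> x \<in> V \<Longrightarrow> x \<notin> hs a b \<longleftrightarrow> d a x = Suc (d b x)"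
  using d_step[of a b x] unfolding hs_def by auto

lemma hs_sub: "hs a b \<subseteq> V" unfolding hs_def by auto

lemma hs_compl: "adj a b \<Longrightarrow> V - hs a b = hs b a"
  using d_step[of a b] unfolding hs_def by fastforce

lemma hs_ends: assumes "adj a b" shows "a \<in> hs a b" "b \<notin> hs a b"
  using assms adj_verts[OF assms] d_adj[OF assms] d_adj[OF adj_sym[OF assms]] d_refl unfolding hs_def by auto

text \<open>
  A vertex on the wrong side would make \<open>b\<close> farther than both \<open>a\<close> and \<open>c\<close>, so by the quadrangle
  condition the fourth vertex \<open>e\<close> of the square would be closer than both, while it is farther
  than \<open>c\<close>.
\<close>

lemma sq_hs_sub: assumes "sq a b c e" shows "hs a b \<subseteq> hs e c"
proof
  have adjs: "adj a b" "adj b c" "adj e c" "adj a e" "adj b a" using assms adj_sym unfolding sq_def by auto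
  fix x assume x: "x \<in> hs a b"
  then have xV: "x \<in> V" using hs_sub by blast
  show "x \<in> hs e c"
  proof (rule ccontr)
    assume "x \<notin> hs e c"
    then have 1: "d e x = Suc (d c x)" using hs_not_mem[OF adjs(3) xV] by blast
    have 2: "d b x = Suc (d a x)" using hs_mem[OF adjs(1) xV] x by blast
    have 3: "d b x = Suc (d c x)" "d e x = Suc (d a x)"
      using 1 2 d_step[OF adjs(2) xV] d_step[OF adjs(4) xV] by linarith+
    have "a \<noteq> c" using sq_distinct[OF assms] by auto
    from quadrangle[OF adjs(5,2) this xV 2 3(1)]
    obtain u where u: "sq b a u c" "d a x = Suc (d u x)" by blast
    have "sq b a e c" using assms sq_rot sq_flip by blast
    then have "u = e" using u sq_unique by blast
    then show False using u(2) 3(2) by simp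
  qed
qed

lemma sq_hs: "sq a b c e \<Longrightarrow> hs a b = hs e c"
  using sq_hs_sub[of a b c e] sq_hs_sub[of e c b a] sq_rot sq_flip by blast

lemma sq_opposite: "sq a b c e \<Longrightarrow> opposite X {a, b} {e, c}"
  using sq_distinct[of a b c e] unfolding sq_def opposite_def adj_def by (auto simp: insert_commute)

lemma opposite_sq:
  assumes "opposite X {a, b} f" "adj a b"
  shows "\<exists>c e. f = {e, c} \<and> sq a b c e"
proof -
  let ?s = "{a, b} \<union> f"
  have f: "f \<in> cc_edges X" "{a, b} \<inter> f = {}" "?s \<in> X" "card ?s = 4" using assms unfolding opposite_def squares_def by auto
  have as: "a \<in> ?s" by simp
  obtain n \<phi> where ch: "bij_betw \<phi> (Pow {..<n::nat}) ?s" "\<phi> {} = a"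
    and face: "\<And>L U. L \<subseteq> U \<Longrightarrow> U \<subseteq> {..<n} \<Longrightarrow> \<phi> ` {A. L \<subseteq> A \<and> A \<subseteq> U} \<in> X"
    and e: "\<And>A B. A \<subseteq> {..<n} \<Longrightarrow> B \<subseteq> {..<n} \<Longrightarrow> adj (\<phi> A) (\<phi> B) \<Longrightarrow> \<exists>i<n. i \<notin> A \<and> B = insert i A \<or> i \<notin> B \<and> A = insert i B"
    by (rule cube_chart[OF f(3) as]) (rule that; assumption)
  have "2 ^ n = (2^2 :: nat)" using f(4) bij_betw_same_card[OF ch(1)] by (simp add: card_Pow)
  then have n: "n = 2" by (subst (asm) power_inject_exp) auto
  obtain i where i: "i < 2" "b = \<phi> {i}" using cube_chart_neighbour[OF ch e, of b] assms(2) n by auto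
  define j where "j = (if i = 0 then 1 else 0 :: nat)"
  have j: "j < 2" "j \<noteq> i" "{..<2} = {i, j}" using i unfolding j_def by auto
  have P: "Pow {..<n} = {{}, {i}, {i, j}, {j}}" unfolding n j(3) by (auto simp: subset_insert_iff Pow_insert)
  have sq: "sq a b (\<phi> {i, j}) (\<phi> {j})" using cube_chart_sq[OF ch(1) face, of "{}" i j] ch(2) i j n by auto
  have "\<phi> ` Pow {..<n} = ?s" using ch(1) by (simp add: bij_betw_def)
  then have "?s = {a, b, \<phi> {i, j}, \<phi> {j}}" unfolding P using ch(2) i by simp
  then have "f = {\<phi> {j}, \<phi> {i, j}}" using f(2) sq_distinct[OF sq] by auto
  then show ?thesis using sq by blast
qed

lemma opposite_sym: "opposite X e f \<Longrightarrow> opposite X f e"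
  unfolding opposite_def by (auto simp: Un_commute Int_commute)

lemma dual_hs:
  assumes "f \<in> dual_hyp X {a, b}" "adj a b"
  shows "\<exists>a' b'. f = {a', b'} \<and> adj a' b' \<and> hs a' b' = hs a b"
proof -
  have "equivclp (opposite X) {a, b} f" using assms unfolding dual_hyp_def by auto
  then show ?thesis
  proof (induction rule: equivclp_induct)
    case base then show ?case using assms by blast
  next
    case (step y z)
    then obtain a' b' where ab: "y = {a', b'}" "adj a' b'" "hs a' b' = hs a b" by blast
    have "opposite X {a', b'} z" using step(2) opposite_sym ab by blast
    from opposite_sq[OF this ab(2)] obtain c e where ce: "z = {e, c}" "sq a' b' c e" by blast
    then show ?case using sq_hs[OF ce(2)] ab unfolding sq_def by (metis adj_sym)
  qed
qed

text \<open>
  The quadrangle condition slides an edge between the two sides across a square towards \<open>a\<close>, until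
  it becomes the edge \<open>{a, b}\<close> itself.
\<close>

lemma edge_sep:
  assumes "adj a b" "adj x y" "x \<in> hs a b" "y \<notin> hs a b"
  shows "{x, y} \<in> dual_hyp X {a, b}"
  using assms(2-)
proof (induction "d a x" arbitrary: x y rule: less_induct)
  case less
  have V: "x \<in> V" "y \<in> V" "a \<in> V" "b \<in> V" using adj_verts less assms by auto
  have k: "d b x = Suc (d a x)" "d a y = Suc (d b y)" using hs_mem[OF assms(1)] hs_not_mem[OF assms(1)] less V by auto
  have sx: "d a y = Suc (d a x) \<or> d a x = Suc (d a y)" "d b y = Suc (d b x) \<or> d b x = Suc (d b y)"
    using d_step[OF less(2)] V d_sym by metis+
  then have k2: "d b y = d a x" "d a y = Suc (d a x)" using k by linarith+
  show ?case
  proof (cases "x = a")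
    case True
    then have "d b y = 0" using k2 d_refl V by simp
    then have "y = b" using d_eq_0 V by metis
    then show ?thesis using True assms(1) unfolding dual_hyp_def adj_def by auto
  next
    case False
    obtain x' where x': "adj x x'" "d x a = Suc (d x' a)" using d_closer[OF V(1,3) False] by blast
    have x'V: "x' \<in> V" using x' adj_verts by blast
    have ax': "d a x = Suc (d a x')" using x'(2) d_sym by metis
    have bx': "d b x = Suc (d b x')"
      using d_step[OF x'(1) V(4)] d_step[OF assms(1) x'V] ax' k d_sym[of x b] d_sym[of x' b] by linarith
    have ne: "y \<noteq> x'" using ax' k2 by auto
    have "d x b = Suc (d y b)" "d x b = Suc (d x' b)" using k k2 bx' d_sym by metis+
    \<comment> \<open>square with the given edge and the first edge from \<open>x\<close> towards \<open>a\<close>; its fourth vertex \<open>u\<close> is the partner of \<open>x'\<close>\<close>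
    from quadrangle[OF less(2) x'(1) ne V(4) this] obtain u where u: "sq x y u x'" "d y b = Suc (d u b)" by blast
    have au: "adj y u" "adj x' u" using u unfolding sq_def by (auto simp: adj_commute)
    have uV: "u \<in> V" using au adj_verts by blast
    have bu: "d b y = Suc (d b u)" using u(2) d_sym by metis
    have "d a u = d a x"
      using d_step[OF au(1) V(3)] d_step[OF au(2) V(3)] ax' k2 d_sym[of u a] d_sym[of y a] d_sym[of x' a] by linarith
    then have 1: "u \<notin> hs a b" using hs_not_mem[OF assms(1) uV] bu k2 by simp
    have 2: "x' \<in> hs a b" using hs_mem[OF assms(1) x'V] bx' ax' k by simp
    have "{x', u} \<in> dual_hyp X {a, b}" using less(1)[OF _ au(2) 2 1] ax' by simp
    moreover have "opposite X {x', u} {x, y}" using opposite_sym[OF sq_opposite[OF u(1)]] by (simp add: insert_commute)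
    ultimately show ?thesis using less(2) unfolding dual_hyp_def adj_def
      by (auto intro: equivclp_into_equivclp)
  qed
qed

text \<open>
  The edge boundary of a vertex set; for a halfspace it is the bounding hyperplane.
\<close>

definition bd :: "'v set \<Rightarrow> 'v set set" where "bd h = {{x, y} | x y. adj x y \<and> x \<in> h \<and> y \<notin> h}"

lemma dual_eq: assumes "adj a b" shows "dual_hyp X {a, b} = bd (hs a b)"
proof (intro equalityI subsetI)
  fix f assume "f \<in> dual_hyp X {a, b}"
  from dual_hs[OF this assms] show "f \<in> bd (hs a b)" unfolding bd_def using hs_ends by blast
next
  fix f assume "f \<in> bd (hs a b)"
  then show "f \<in> dual_hyp X {a, b}" unfolding bd_def using edge_sep[OF assms] by blast
qed

lemma bd_compl: "h \<subseteq> V \<Longrightarrow> bd (V - h) = bd h"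
proof -
  have *: "bd (V - h) \<subseteq> bd h" for h
  proof
    fix f assume "f \<in> bd (V - h)"
    then obtain x y where "f = {x, y}" "adj x y" "x \<in> V - h" "y \<notin> V - h" unfolding bd_def by blast
    then have "f = {y, x}" "adj y x" "y \<in> h" "x \<notin> h" using adj_verts[of x y] adj_sym by auto
    then show "f \<in> bd h" unfolding bd_def by blast
  qed
  assume "h \<subseteq> V"
  then have "V - (V - h) = h" by blast
  then show ?thesis using *[of h] *[of "V - h"] by auto
qed

text \<open>
  A geodesic towards \<open>a\<close> stays on the side of \<open>a\<close>, so this side is connected. No edge outside the
  hyperplane leaves it, by \<open>edge_sep\<close>.
\<close>

lemma component_hs:
  assumes "adj a b" "v \<in> hs a b"
  shows "{w. (\<lambda>x y. {x, y} \<in> cc_edges X - dual_hyp X {a, b})\<^sup>*\<^sup>* v w} = hs a b" (is "{w. ?R\<^sup>*\<^sup>* v w} = _")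
proof -
  have sym: "symp ?R" by (auto simp: symp_def insert_commute)
  have R: "?R x y" if "adj x y" "x \<in> hs a b" "y \<in> hs a b" for x y
  proof -
    have "{x, y} \<notin> bd (hs a b)" using that unfolding bd_def by (auto simp: doubleton_eq_iff)
    then show ?thesis using that unfolding dual_eq[OF assms(1)] adj_def by auto
  qed
  have aV: "a \<in> V" "b \<in> V" using adj_verts assms by auto
  have toa: "?R\<^sup>*\<^sup>* x a" if "x \<in> hs a b" for x
    using that
  proof (induction "d a x" arbitrary: x rule: less_induct)
    case less
    have xV: "x \<in> V" using less hs_sub by blast
    show ?case
    proof (cases "x = a")
      case False
      obtain x' where x': "adj x x'" "d x a = Suc (d x' a)" using d_closer[OF xV aV(1) False] by blast
      have x'V: "x' \<in> V" using x' adj_verts by blast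
      have ax': "d a x = Suc (d a x')" using x'(2) d_sym by metis
      have "d b x = Suc (d a x)" using hs_mem[OF assms(1) xV] less(2) by blast
      then have "d b x' = Suc (d a x')" using ax' d_step[OF x'(1) aV(2)] d_step[OF assms(1) x'V]
          d_sym[of x b] d_sym[of x' b] by linarith
      then have "x' \<in> hs a b" using hs_mem[OF assms(1) x'V] by blast
      then show ?thesis using less(1)[of x'] ax' R[OF x'(1) less(2)] by (auto intro: converse_rtranclp_into_rtranclp)
    qed simp
  qed
  show ?thesis
  proof (intro equalityI subsetI)
    fix w assume "w \<in> {w. ?R\<^sup>*\<^sup>* v w}"
    then have "?R\<^sup>*\<^sup>* v w" by simp
    then show "w \<in> hs a b"
    proof (induction rule: rtranclp_induct)
      case (step y z)
      then have "adj y z" "{y, z} \<notin> dual_hyp X {a, b}" by (auto simp: adj_def)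
      then show ?case using edge_sep[OF assms(1)] step by blast
    qed (rule assms)
  next
    fix w assume "w \<in> hs a b"
    then have "?R\<^sup>*\<^sup>* a w" using toa sym by (metis (no_types, lifting) symp_def symp_rtranclp)
    then show "w \<in> {w. ?R\<^sup>*\<^sup>* v w}" using toa[OF assms(2)] by (auto intro: rtranclp_trans)
  qed
qed

lemma sides_eq: assumes "adj a b" shows "sides X (dual_hyp X {a, b}) = {hs a b, hs b a}"
proof -
  have ba: "adj b a" using assms adj_sym by blast
  have comm: "dual_hyp X {b, a} = dual_hyp X {a, b}" by (simp add: insert_commute)
  show ?thesis
  proof (intro equalityI subsetI)
    fix h assume "h \<in> sides X (dual_hyp X {a, b})"
    then obtain v where v: "v \<in> V" "h = {w. (\<lambda>x y. {x, y} \<in> cc_edges X - dual_hyp X {a, b})\<^sup>*\<^sup>* v w}" unfolding sides_def by blast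
    show "h \<in> {hs a b, hs b a}"
    proof (cases "v \<in> hs a b")
      case True then show ?thesis using component_hs[OF assms True] v(2) by simp
    next
      case False
      then have "v \<in> hs b a" using hs_compl[OF assms] v by blast
      then show ?thesis using component_hs[OF ba, unfolded comm] v(2) by simp
    qed
  next
    fix h assume "h \<in> {hs a b, hs b a}"
    then show "h \<in> sides X (dual_hyp X {a, b})"
    proof (elim insertE emptyE)
      assume "h = hs a b"
      then show ?thesis unfolding sides_def component_hs[OF assms hs_ends(1)[OF assms], symmetric]
        using adj_verts[OF assms] by (intro CollectI exI[of _ a]) simp
    next
      assume "h = hs b a"
      then show ?thesis unfolding sides_def component_hs[OF ba hs_ends(1)[OF ba], unfolded comm, symmetric]
        using adj_verts[OF assms] by (intro CollectI exI[of _ b]) simp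
    qed
  qed
qed

lemma hyperplane_cases: assumes "H \<in> hyperplanes X" obtains a b where "adj a b" "H = dual_hyp X {a, b}"
proof -
  obtain e where e: "e \<in> cc_edges X" "H = dual_hyp X e" using assms unfolding hyperplanes_def by blast
  then show ?thesis using edge_obtain[OF e(1)] that by metis
qed

lemma dual_hyperplane: "adj a b \<Longrightarrow> dual_hyp X {a, b} \<in> hyperplanes X"
  unfolding hyperplanes_def adj_def by blast

abbreviation hss :: "'v set set" where "hss \<equiv> halfspaces X"

lemma halfspace_iff: "h \<in> hss \<longleftrightarrow> (\<exists>a b. adj a b \<and> h = hs a b)"
proof
  assume "h \<in> hss"
  then obtain H where H: "H \<in> hyperplanes X" "h \<in> sides X H" unfolding halfspaces_def by blast
  obtain a b where ab0: "adj a b" "H = dual_hyp X {a, b}" using hyperplane_cases[OF H(1)] by blast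
  then have ab: "adj a b" "h \<in> sides X (dual_hyp X {a, b})" using H by auto
  then have "h = hs a b \<or> h = hs b a" using sides_eq[OF ab(1)] by blast
  then show "\<exists>a b. adj a b \<and> h = hs a b" using ab(1) adj_sym by blast
next
  assume "\<exists>a b. adj a b \<and> h = hs a b"
  then obtain a b where ab: "adj a b" "h = hs a b" by blast
  then have "h \<in> sides X (dual_hyp X {a, b})" using sides_eq[OF ab(1)] by blast
  then show "h \<in> hss" unfolding halfspaces_def using dual_hyperplane[OF ab(1)] by blast
qed

lemma bounding_hyp_eq: assumes "h \<in> hss" shows "bounding_hyp X h = bd h"
proof -
  obtain a b where ab: "adj a b" "h = hs a b" using assms halfspace_iff by blast
  show ?thesis unfolding bounding_hyp_def
  proof (rule the_equality)
    show "bd h \<in> hyperplanes X \<and> h \<in> sides X (bd h)"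
      unfolding ab(2) dual_eq[OF ab(1), symmetric] using dual_hyperplane[OF ab(1)] sides_eq[OF ab(1)] by blast
  next
    fix H assume H: "H \<in> hyperplanes X \<and> h \<in> sides X H"
    obtain a' b' where ab': "adj a' b'" "H = dual_hyp X {a', b'}" using hyperplane_cases H by blast
    have "h \<in> {hs a' b', hs b' a'}" using H ab'(2) sides_eq[OF ab'(1)] by simp
    then have "h = hs a' b' \<or> h = V - hs a' b'" using hs_compl[OF ab'(1)] by simp
    then have "bd h = bd (hs a' b')" using bd_compl[OF hs_sub] by auto
    then show "H = bd h" using ab' dual_eq by simp
  qed
qed

lemma dual_hyp_eq: "adj a b \<Longrightarrow> dual_hyp X {a, b} = bounding_hyp X (hs a b)"
  using dual_eq bounding_hyp_eq halfspace_iff by metis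

lemma hs_halfspace: "adj a b \<Longrightarrow> hs a b \<in> hss" using halfspace_iff by blast

lemma halfspace_sub: "h \<in> hss \<Longrightarrow> h \<subseteq> V" using halfspace_iff hs_sub by blast

lemma halfspace_compl: "h \<in> hss \<Longrightarrow> V - h \<in> hss" using halfspace_iff hs_compl adj_sym by metis

lemma halfspace_dcompl: "h \<in> hss \<Longrightarrow> V - (V - h) = h" using halfspace_sub by blast

lemma halfspace_ne: "h \<in> hss \<Longrightarrow> h \<noteq> {}" using halfspace_iff hs_ends by blast

lemma halfspace_ne_compl: "h \<in> hss \<Longrightarrow> V - h \<noteq> {}" using halfspace_compl halfspace_ne by blast

lemma opp_eq: "opp_halfspace X h = V - h" unfolding opp_halfspace_def ..

text \<open>
  Both sides of the hyperplane are recovered from any one of its edges.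
\<close>

lemma bd_eq_iff: assumes "h \<in> hss" "k \<in> hss" shows "bd h = bd k \<longleftrightarrow> h = k \<or> h = V - k"
proof
  assume e: "bd h = bd k"
  obtain a b where ab: "adj a b" "h = hs a b" using assms halfspace_iff by blast
  obtain a' b' where ab': "adj a' b'" "k = hs a' b'" using assms halfspace_iff by blast
  have "sides X (bd h) = {h, V - h}" "sides X (bd k) = {k, V - k}"
    using sides_eq[OF ab(1)] sides_eq[OF ab'(1)] dual_eq[OF ab(1)] dual_eq[OF ab'(1)]
      hs_compl[OF ab(1)] hs_compl[OF ab'(1)] ab(2) ab'(2) by simp_all
  then have "{h, V - h} = {k, V - k}" using e by simp
  then show "h = k \<or> h = V - k" by blast
qed (use bd_compl[OF halfspace_sub[OF assms(2)]] in auto)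

lemma hs_eqI: assumes "h \<in> hss" "adj v w" "v \<in> h" "w \<notin> h" shows "h = hs v w"
proof -
  obtain a b where ab: "adj a b" "h = hs a b" using assms halfspace_iff by blast
  have "{v, w} \<in> dual_hyp X {a, b}" using edge_sep ab assms by blast
  from dual_hs[OF this ab(1)] obtain a' b' where "{v, w} = {a', b'}" "adj a' b'" and hs': "hs a' b' = hs a b" by blast
  moreover from this(2) have "a' \<in> h" "b' \<notin> h" using ab hs' hs_ends[of a' b'] by blast+
  ultimately have "v = a' \<and> w = b'" using assms(3,4) by (auto simp: doubleton_eq_iff)
  then show ?thesis using ab hs' by simp
qed

abbreviation car :: "'v set \<Rightarrow> 'v set" where "car \<equiv> carrier_side X"

lemma car_iff: assumes "h \<in> hss" shows "v \<in> car h \<longleftrightarrow> v \<in> h \<and> (\<exists>w. adj v w \<and> w \<notin> h)"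
proof
  assume "v \<in> car h"
  then have "v \<in> h" "\<exists>e\<in>bd h. v \<in> e" unfolding carrier_side_def bounding_hyp_eq[OF assms] by auto
  then show "v \<in> h \<and> (\<exists>w. adj v w \<and> w \<notin> h)" unfolding bd_def by auto
next
  assume "v \<in> h \<and> (\<exists>w. adj v w \<and> w \<notin> h)"
  then show "v \<in> car h" unfolding carrier_side_def bounding_hyp_eq[OF assms] bd_def by blast
qed

section \<open>Convex sets, gates and the Helly property\<close>

text \<open>
  Closed under the first step of every geodesic; by \<open>conv_between\<close> this is the usual geodesic
  convexity.
\<close>

definition conv :: "'v set \<Rightarrow> bool" where
  "conv C \<longleftrightarrow> C \<subseteq> V \<and> (\<forall>p\<in>C. \<forall>c\<in>C. \<forall>q. adj p q \<and> d p c = Suc (d q c) \<longrightarrow> q \<in> C)"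

lemma conv_sub: "conv C \<Longrightarrow> C \<subseteq> V" unfolding conv_def by blast

lemma conv_V: "conv V" unfolding conv_def using adj_verts by blast

lemma conv_halfspace: assumes "h \<in> hss" shows "conv h"
  unfolding conv_def
proof (intro conjI ballI allI impI)
  fix p c q assume pc: "p \<in> h" "c \<in> h" and q: "adj p q \<and> d p c = Suc (d q c)"
  show "q \<in> h"
  proof (rule ccontr)
    assume "q \<notin> h"
    then have "h = hs p q" using hs_eqI assms pc q by blast
    then show False using pc(2) q unfolding hs_def by auto
  qed
qed (rule halfspace_sub[OF assms])

lemma conv_step: assumes "conv C" "x \<in> C" "adj x w" "C \<inter> hs w x \<noteq> {}" shows "w \<in> C"
proof -
  obtain c where c: "c \<in> C" "c \<in> hs w x" using assms by blast
  then have "d x c = Suc (d w c)" using hs_mem[OF adj_sym[OF assms(3)]] conv_sub[OF assms(1)] by blast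
  then show ?thesis using assms c unfolding conv_def by blast
qed

lemma conv_between:
  assumes "conv C" "x \<in> C" "y \<in> C" "z \<in> V" "d x y = d x z + d z y" shows "z \<in> C"
  using assms(2,5)
proof (induction "d x z" arbitrary: x)
  case 0 then show ?case using d_eq_0[of x z] assms conv_sub by auto
next
  case (Suc n)
  have V: "x \<in> V" "y \<in> V" using assms Suc conv_sub by auto
  then have "x \<noteq> z" using Suc d_refl by auto
  then obtain u where u: "adj x u" "d x z = Suc (d u z)" using d_closer[OF V(1) assms(4)] by blast
  have uV: "u \<in> V" using u adj_verts by blast
  have "d u y \<le> d u z + d z y" using d_triangle uV V assms by blast
  then have e: "d x y = Suc (d u y)" using d_step[OF u(1) V(2)] Suc(4) u(2) by linarith
  then have "u \<in> C" using assms Suc u unfolding conv_def by blast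
  then show ?case using Suc(1)[of u] Suc(2,4) u e by auto
qed

lemma conv_Int: "conv C \<Longrightarrow> conv D \<Longrightarrow> conv (C \<inter> D)" unfolding conv_def by blast

lemma conv_edge:
  assumes "conv C" "x \<in> C" "y \<in> C" "x \<in> h" "y \<notin> h"
  obtains u w where "u \<in> C" "w \<in> C" "adj u w" "u \<in> h" "w \<notin> h"
proof -
  have "\<exists>u w. u \<in> C \<and> w \<in> C \<and> adj u w \<and> u \<in> h \<and> w \<notin> h" using assms(2,4)
  proof (induction "d x y" arbitrary: x)
    case 0 then show ?case using d_eq_0[of x y] assms conv_sub by auto
  next
    case (Suc n)
    have V: "x \<in> V" "y \<in> V" using assms Suc conv_sub by auto
    have "x \<noteq> y" using Suc assms by auto
    then obtain u where u: "adj x u" "d x y = Suc (d u y)" using d_closer[OF V] by blast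
    then have "u \<in> C" using assms Suc unfolding conv_def by blast
    then show ?case using Suc u by (cases "u \<in> h") auto
  qed
  then show ?thesis using that by blast
qed

text \<open>
  The edge from \<open>y\<close> to \<open>x\<close> is carried along a geodesic from \<open>y\<close> to \<open>p\<close> by the quadrangle
  condition. It arrives as an edge at \<open>p\<close> that leads towards \<open>c\<close>.
\<close>

lemma gate_transport:
  assumes "c \<in> V" "p \<in> V"
  shows "adj x y \<Longrightarrow> d y c = d y p + d p c \<Longrightarrow> d y c = Suc (d x c) \<Longrightarrow> d x p = Suc (d y p)
    \<Longrightarrow> \<exists>z. adj p z \<and> d p c = Suc (d z c) \<and> d x z \<le> d y p"
proof (induction "d y p" arbitrary: x y)
  case 0
  have "y \<in> V" "x \<in> V" using 0 adj_verts by auto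
  then have "y = p" using 0 d_eq_0 assms by metis
  then show ?case using 0 d_refl \<open>x \<in> V\<close> adj_sym by (intro exI[of _ x]) auto
next
  case (Suc n)
  have V: "y \<in> V" "x \<in> V" using Suc adj_verts by auto
  have "y \<noteq> p" using Suc(2) d_refl V by auto
  then obtain y' where y': "adj y y'" "d y p = Suc (d y' p)" using d_closer[OF V(1) assms(2)] by blast
  have y'V: "y' \<in> V" using y' adj_verts by blast
  have "d y' c \<le> d y' p + d p c" using d_triangle y'V assms by blast
  then have yc: "d y c = Suc (d y' c)" using d_step[OF y'(1) assms(1)] Suc(4) y' by linarith
  have ne: "x \<noteq> y'" using y' Suc by auto
  from quadrangle[OF adj_sym[OF Suc(3)] y'(1) ne assms(1) Suc(5) yc]
  obtain u where u: "sq y x u y'" "d x c = Suc (d u c)" by blast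
  have au: "adj u y'" "adj x u" using u unfolding sq_def by auto
  have "d u p = Suc (d y' p)"
    using d_step[OF au(1) assms(2)] d_step[OF au(2) assms(2)] y' Suc(6) by linarith
  moreover have "d y' c = Suc (d u c)" using u(2) yc Suc(5) by linarith
  ultimately obtain z where z: "adj p z" "d p c = Suc (d z c)" "d u z \<le> d y' p"
    using Suc(1)[of y' u] Suc(2) Suc(4) y' yc au by (metis add_Suc nat.inject)
  have "z \<in> V" using adj_verts z(1) by blast
  then have "d x z \<le> Suc (d u z)" using d_step[OF au(2), of z] by linarith
  then have "d x z \<le> d y p" using z y' by linarith
  then show ?case using z by blast
qed

text \<open>
  The gate is a nearest point. If some \<open>c\<close> were reached more quickly than through \<open>p\<close>, then
  \<open>gate_transport\<close> would give a neighbour of \<open>p\<close> in \<open>C\<close> that is closer to \<open>v\<close>.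
\<close>

lemma gate_exists:
  assumes "conv C" "C \<noteq> {}" "v \<in> V"
  obtains p where "p \<in> C" "\<And>c. c \<in> C \<Longrightarrow> d v c = d v p + d p c"
proof -
  obtain p where p: "p \<in> C" "\<And>c. c \<in> C \<Longrightarrow> d v p \<le> d v c"
    using ex_has_least_nat[of "\<lambda>p. p \<in> C" _ "d v"] assms(2) by blast
  have "d v c = d v p + d p c" if c: "c \<in> C" for c
    using assms(3) p(2)
  proof (induction "d v p" arbitrary: v)
    case 0
    then show ?case using d_eq_0[of v p] p(1) conv_sub[OF assms(1)] d_refl by auto
  next
    case (Suc n)
    have pV: "p \<in> V" "c \<in> V" using p c conv_sub assms by auto
    have "v \<noteq> p" using Suc d_refl by auto
    then obtain y where y: "adj v y" "d v p = Suc (d y p)" using d_closer[OF Suc(3) pV(1)] by blast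
    have yV: "y \<in> V" using y adj_verts by blast
    have "d y p \<le> d y e" if "e \<in> C" for e
    proof -
      have "e \<in> V" using that conv_sub[OF assms(1)] by blast
      then show ?thesis using Suc(4)[OF that] y(2) d_step[OF y(1), of e] by linarith
    qed
    moreover have "n = d y p" using Suc(2) y(2) by linarith
    ultimately have yc: "d y c = d y p + d p c" using Suc(1)[of y] yV by blast
    show ?case
    proof (cases "d y c = Suc (d v c)")
      case True
      from gate_transport[OF pV(2,1) y(1) yc True y(2)]
      obtain z where z: "adj p z" "d p c = Suc (d z c)" "d v z \<le> d y p" by blast
      then have "z \<in> C" using assms(1) p c unfolding conv_def by blast
      then show ?thesis using Suc(4)[of z] z y by linarith
    next
      case False
      then have "d v c = Suc (d y c)" using d_step[OF y(1) pV(2)] by blast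
      then show ?thesis using yc y by linarith
    qed
  qed
  then show ?thesis using that p by blast
qed

text \<open>
  The first edge of a geodesic to the gate already separates \<open>v\<close> from \<open>k\<close>.
\<close>

lemma gate_step:
  assumes "conv k" "k \<noteq> {}" "v \<in> V - k"
  obtains w where "adj v w" "k \<subseteq> hs w v"
proof -
  have vV: "v \<in> V" using assms by blast
  obtain p where p: "p \<in> k" "\<And>c. c \<in> k \<Longrightarrow> d v c = d v p + d p c" using gate_exists[OF assms(1,2) vV] by blast
  have pV: "p \<in> V" using conv_sub assms p by blast
  have "v \<noteq> p" using p assms by auto
  then obtain w where w: "adj v w" "d v p = Suc (d w p)" using d_closer[OF vV pV] by blast
  have "c \<in> hs w v" if "c \<in> k" for c
  proof -
    have cV: "c \<in> V" using conv_sub assms that by blast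
    have "d w c \<le> d w p + d p c" using d_triangle adj_verts[OF w(1)] pV cV by blast
    then show ?thesis using p(2)[OF that] w(2) cV unfolding hs_def by auto
  qed
  then show ?thesis using that w by blast
qed

text \<open>
  The gate in \<open>C\<close> of a point of \<open>A \<inter> B\<close> lies on geodesics from this point to \<open>A \<inter> C\<close> and to
  \<open>B \<inter> C\<close>.
\<close>

lemma helly3:
  assumes "conv A" "conv B" "conv C" "A \<inter> B \<noteq> {}" "A \<inter> C \<noteq> {}" "B \<inter> C \<noteq> {}"
  shows "A \<inter> B \<inter> C \<noteq> {}"
proof -
  obtain x where x: "x \<in> A" "x \<in> B" using assms by blast
  have xV: "x \<in> V" using x conv_sub assms by blast
  obtain p where p: "p \<in> C" "\<And>c. c \<in> C \<Longrightarrow> d x c = d x p + d p c" using gate_exists[OF assms(3) _ xV] assms by blast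
  have pV: "p \<in> V" using p conv_sub assms by blast
  obtain y where "y \<in> A" "y \<in> C" using assms by blast
  then have "p \<in> A" using conv_between[OF assms(1) x(1)] p pV by blast
  moreover obtain y where "y \<in> B" "y \<in> C" using assms by blast
  then have "p \<in> B" using conv_between[OF assms(2) x(2)] p pV by blast
  ultimately show ?thesis using p by blast
qed

lemma helly:
  assumes "finite F" "\<And>C. C \<in> F \<Longrightarrow> conv C" "\<And>C D. C \<in> F \<Longrightarrow> D \<in> F \<Longrightarrow> C \<inter> D \<noteq> {}"
  shows "conv C \<Longrightarrow> C \<noteq> {} \<Longrightarrow> (\<And>D. D \<in> F \<Longrightarrow> C \<inter> D \<noteq> {}) \<Longrightarrow> C \<inter> \<Inter>F \<noteq> {}"
  using assms
proof (induction F arbitrary: C rule: finite_induct)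
  case (insert D F)
  have "conv (C \<inter> D)" using insert conv_Int by simp
  moreover have "C \<inter> D \<noteq> {}" using insert by simp
  moreover have "(C \<inter> D) \<inter> E \<noteq> {}" if "E \<in> F" for E
    by (rule helly3) (use insert that in auto)
  ultimately have "(C \<inter> D) \<inter> \<Inter>F \<noteq> {}" using insert by simp
  then show ?case by (simp add: Int_assoc)
qed simp

text \<open>
  If a step of a geodesic between carrier points starts at \<open>p\<close>, then the quadrangle condition with
  respect to a vertex just across the hyperplane completes this step and the dual edge at \<open>p\<close> to a
  square, whose opposite edge is dual to the same hyperplane.
\<close>

lemma conv_car: assumes "h \<in> hss" shows "conv (car h)"
  unfolding conv_def
proof (intro conjI ballI allI impI)
  show "car h \<subseteq> V" using car_iff[OF assms] halfspace_sub[OF assms] by blast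
next
  fix p c q assume pc: "p \<in> car h" "c \<in> car h" and q: "adj p q \<and> d p c = Suc (d q c)"
  obtain p' where p': "p \<in> h" "adj p p'" "p' \<notin> h" using pc car_iff assms by blast
  obtain c' where c': "c \<in> h" "adj c c'" "c' \<notin> h" using pc car_iff assms by blast
  have qh: "q \<in> h" using conv_halfspace[OF assms] p' c' q unfolding conv_def by blast
  have V: "p \<in> V" "p' \<in> V" "c \<in> V" "c' \<in> V" "q \<in> V" using adj_verts p' c' q by auto
  have hp: "h = hs p p'" "h = hs c c'" using hs_eqI assms p' c' by blast+
  have 1: "d p' c = Suc (d p c)" using hs_mem[OF p'(2) V(3)] c' hp by blast
  have 2: "d c' p = Suc (d c p)" using hs_mem[OF c'(2) V(1)] p' hp by blast
  have 3: "d c p' = Suc (d c' p')" using hs_not_mem[OF c'(2) V(2)] p' hp by blast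
  have 4: "d c' q = Suc (d c q)" using hs_mem[OF c'(2) V(5)] qh hp by blast
  have ne: "q \<noteq> p'" using qh p' by auto
  have "d p c' = Suc (d q c')" "d p c' = Suc (d p' c')"
    using 1 2 3 4 q d_sym[of c p] d_sym[of c' p] d_sym[of c q] d_sym[of c' q] d_sym[of c p'] d_sym[of c' p'] by linarith+
  \<comment> \<open>both \<open>q\<close> and \<open>p'\<close> are closer to \<open>c'\<close> than \<open>p\<close> is\<close>
  from quadrangle[OF conjunct1[OF q] p'(2) ne V(4) this] obtain u where u: "sq p q u p'" by blast
  have "hs q u = hs p p'" using sq_hs[of p p' u q] sq_flip[OF u] by simp
  moreover have "adj q u" using u unfolding sq_def by blast
  ultimately have "u \<notin> h" using hp hs_ends by metis
  then show "q \<in> car h" using car_iff[OF assms] qh \<open>adj q u\<close> by blast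
qed

text \<open>
  Along a geodesic each edge contributes one new halfspace.
\<close>

lemma separating_halfspaces: assumes "x \<in> V" "y \<in> V"
  shows "finite {h \<in> hss. x \<in> h \<and> y \<notin> h} \<and> card {h \<in> hss. x \<in> h \<and> y \<notin> h} = d x y"
  using assms(1)
proof (induction "d x y" arbitrary: x)
  case 0
  then have "x = y" using d_eq_0 assms by metis
  then have E: "{h \<in> hss. x \<in> h \<and> y \<notin> h} = {}" by blast
  show ?case unfolding E using 0 by simp
next
  case (Suc n)
  have "x \<noteq> y" using Suc d_refl by auto
  then obtain u where u: "adj x u" "d x y = Suc (d u y)" using d_closer[OF Suc(3) assms(2)] by blast
  have uV: "u \<in> V" using u adj_verts by blast
  have y: "y \<in> hs u x" using u assms(2) unfolding hs_def by auto
  then have y': "y \<notin> hs x u" using u(2) unfolding hs_def by auto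
  let ?S = "{h \<in> hss. u \<in> h \<and> y \<notin> h}"
  have S: "finite ?S" "card ?S = d u y" using Suc(1)[of u] Suc(2) u uV by auto
  have "{h \<in> hss. x \<in> h \<and> y \<notin> h} = insert (hs x u) ?S"
  proof (intro equalityI subsetI)
    fix h assume "h \<in> {h \<in> hss. x \<in> h \<and> y \<notin> h}"
    then show "h \<in> insert (hs x u) ?S" using hs_eqI[OF _ u(1)] by blast
  next
    fix h assume "h \<in> insert (hs x u) ?S"
    then show "h \<in> {h \<in> hss. x \<in> h \<and> y \<notin> h}"
      using hs_eqI[OF _ adj_sym[OF u(1)]] hs_halfspace[OF u(1)] hs_ends[OF u(1)] y y' by blast
  qed
  moreover have "hs x u \<notin> ?S" using hs_ends[OF u(1)] by blast
  ultimately show ?case using S u by simp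
qed

lemma sep_finite: "x \<in> V \<Longrightarrow> y \<in> V \<Longrightarrow> finite {h \<in> hss. x \<in> h \<and> y \<notin> h}"
  using separating_halfspaces by blast

lemma sep_card: "x \<in> V \<Longrightarrow> y \<in> V \<Longrightarrow> card {h \<in> hss. x \<in> h \<and> y \<notin> h} = d x y"
  using separating_halfspaces by blast

section \<open>Crossing halfspaces\<close>

text \<open>
  By \<open>hyps_meet_iff\<close> this says that the hyperplanes are different and have a common point.
\<close>

definition cross :: "'v set \<Rightarrow> 'v set \<Rightarrow> bool" where
  "cross h k \<longleftrightarrow> h \<inter> k \<noteq> {} \<and> h - k \<noteq> {} \<and> k - h \<noteq> {} \<and> V - (h \<union> k) \<noteq> {}"

lemma cross_sym: "cross h k \<Longrightarrow> cross k h" unfolding cross_def by (auto simp: Un_commute)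

lemma cross_compl: "h \<subseteq> V \<Longrightarrow> k \<subseteq> V \<Longrightarrow> cross h k \<Longrightarrow> cross (V - h) k" unfolding cross_def by blast

lemma not_cross:
  assumes "\<not> cross h k" "h \<subseteq> V" "k \<subseteq> V"
  obtains "h \<inter> k = {}" | "h \<subseteq> k" | "k \<subseteq> h" | "V - h \<subseteq> k"
  using assms unfolding cross_def by blast

lemma conv_meets_car:
  assumes "conv C" "h \<in> hss" "C \<inter> h \<noteq> {}" "C - h \<noteq> {}" shows "C \<inter> car h \<noteq> {}"
proof -
  obtain x y where "x \<in> C" "y \<in> C" "x \<in> h" "y \<notin> h" using assms by blast
  then obtain u w where "u \<in> C" "w \<in> C" "adj u w" "u \<in> h" "w \<notin> h" using conv_edge[OF assms(1)] by metis
  then show ?thesis using car_iff[OF assms(2)] by blast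
qed

lemma cross_car_meets:
  assumes "h \<in> hss" "k \<in> hss" "cross h k" shows "car h \<inter> k \<noteq> {}" "car h - k \<noteq> {}"
proof -
  show "car h \<inter> k \<noteq> {}" using conv_meets_car[OF conv_halfspace[OF assms(2)] assms(1)] assms(3) unfolding cross_def by blast
  have "(V - k) \<inter> car h \<noteq> {}"
    using conv_meets_car[OF conv_halfspace[OF halfspace_compl[OF assms(2)]] assms(1)] assms(3) halfspace_sub assms unfolding cross_def by blast
  then show "car h - k \<noteq> {}" by blast
qed

lemma cross_car: assumes "h \<in> hss" "k \<in> hss" "cross h k" shows "car h \<inter> car k \<noteq> {}"
  using conv_meets_car[OF conv_car[OF assms(1)] assms(2)] cross_car_meets[OF assms] by blast

text \<open>
  Moving across a hyperplane that crosses \<open>t\<close> does not leave the carrier side of \<open>t\<close>.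
\<close>

lemma cross_step:
  assumes "t \<in> hss" "x \<in> car t" "adj x w" "cross (hs w x) t" shows "w \<in> car t"
  using conv_step[OF conv_car[OF assms(1)] assms(2,3)]
    cross_car_meets(1)[OF assms(1) hs_halfspace[OF adj_sym[OF assms(3)]] cross_sym[OF assms(4)]] by blast

text \<open>
  Choose \<open>x\<close> in \<open>Y\<close> nearest to some point of \<open>k\<close>. The first edge towards \<open>k\<close> separates \<open>x\<close> from
  \<open>k\<close>. If its far side contained a point of \<open>Y\<close>, convexity would put the next vertex into \<open>Y\<close>, and
  it is nearer.
\<close>

lemma convex_sep:
  assumes "conv Y" "Y \<noteq> {}" "conv k" "k \<noteq> {}" "Y \<inter> k = {}"
  obtains x w where "x \<in> Y" "adj x w" "k \<subseteq> hs w x" "Y \<inter> hs w x = {}"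
proof -
  obtain c where c: "c \<in> k" using assms by blast
  have cV: "c \<in> V" using c assms conv_sub by blast
  obtain x where x: "x \<in> Y" "\<And>y. y \<in> Y \<Longrightarrow> d x c \<le> d y c"
    using ex_has_least_nat[of "\<lambda>x. x \<in> Y" _ "\<lambda>x. d x c"] assms(2) by blast
  have "x \<in> V - k" using x assms conv_sub by blast
  then obtain w where w: "adj x w" "k \<subseteq> hs w x" using gate_step[OF assms(3,4)] by blast
  have "Y \<inter> hs w x = {}"
  proof (rule ccontr)
    assume "Y \<inter> hs w x \<noteq> {}"
    then have "w \<in> Y" using conv_step assms(1) x w by blast
    moreover have "d w c < d x c" using w c unfolding hs_def by blast
    ultimately show False using x(2) by fastforce
  qed
  then show ?thesis using that x w by blast
qed

lemma cube_parallel: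
  assumes "bij_betw \<phi> (Pow {..<n::nat}) c"
    "\<And>L U. L \<subseteq> U \<Longrightarrow> U \<subseteq> {..<n} \<Longrightarrow> \<phi> ` {A. L \<subseteq> A \<and> A \<subseteq> U} \<in> X"
    "A \<subseteq> {..<n}" "i < n" "i \<notin> A"
  shows "hs (\<phi> A) (\<phi> (insert i A)) = hs (\<phi> {}) (\<phi> {i})"
proof -
  have "finite A" using assms(3) finite_subset by blast
  then show ?thesis using assms(3,5)
  proof (induction A rule: finite_induct)
    case (insert j A)
    have "sq (\<phi> A) (\<phi> (insert i A)) (\<phi> (insert i (insert j A))) (\<phi> (insert j A))"
      by (rule cube_chart_sq[OF assms(1,2)]) (use insert assms(4) in auto)
    then show ?case using sq_hs insert by auto
  qed simp
qed

lemma cube_edge_sides: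
  assumes ch: "bij_betw \<phi> (Pow {..<n::nat}) c"
    "\<And>L U. L \<subseteq> U \<Longrightarrow> U \<subseteq> {..<n} \<Longrightarrow> \<phi> ` {A. L \<subseteq> A \<and> A \<subseteq> U} \<in> X"
    and e: "\<And>A B. A \<subseteq> {..<n} \<Longrightarrow> B \<subseteq> {..<n} \<Longrightarrow> adj (\<phi> A) (\<phi> B) \<Longrightarrow> \<exists>i<n. i \<notin> A \<and> B = insert i A \<or> i \<notin> B \<and> A = insert i B"
    and "adj x y" "x \<in> c" "y \<in> c"
  shows "\<exists>i<n. bd (hs x y) = bd (hs (\<phi> {}) (\<phi> {i}))"
proof -
  have "x \<in> \<phi> ` Pow {..<n}" "y \<in> \<phi> ` Pow {..<n}" using ch(1) assms(5,6) by (simp_all add: bij_betw_def)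
  then obtain A B where AB: "x = \<phi> A" "A \<subseteq> {..<n}" "y = \<phi> B" "B \<subseteq> {..<n}" by blast
  obtain i where i: "i < n" "i \<notin> A \<and> B = insert i A \<or> i \<notin> B \<and> A = insert i B"
    using e[OF AB(2,4)] assms(4) AB by blast
  then consider "i \<notin> A" "B = insert i A" | "i \<notin> B" "A = insert i B" by blast
  then show ?thesis
  proof cases
    case 1
    then have "hs x y = hs (\<phi> {}) (\<phi> {i})" using cube_parallel[OF ch AB(2) i(1)] AB by simp
    then show ?thesis using i by metis
  next
    case 2
    then have "hs y x = hs (\<phi> {}) (\<phi> {i})" using cube_parallel[OF ch AB(4) i(1)] AB by simp
    moreover have "bd (hs x y) = bd (hs y x)" using hs_compl[OF assms(4)] bd_compl[OF hs_sub] by metis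
    ultimately show ?thesis using i by metis
  qed
qed

lemma sq_cross: assumes "sq a b c e" shows "cross (hs a b) (hs a e)"
proof -
  have adjs: "adj a b" "adj a e" "adj e c" "adj b c" using assms adj_sym unfolding sq_def by blast+
  have 1: "hs a b = hs e c" using sq_hs[OF assms] .
  have 2: "hs a e = hs b c" using sq_hs[OF sq_flip[OF assms]] .
  have m: "a \<in> hs a b" "b \<notin> hs a b" "e \<in> hs a b" "c \<notin> hs a b" "a \<in> hs a e" "e \<notin> hs a e" "b \<in> hs a e" "c \<notin> hs a e"
    using hs_ends[OF adjs(1)] hs_ends[OF adjs(2)] hs_ends[OF adjs(3)] hs_ends[OF adjs(4)] 1 2 by auto
  moreover have "c \<in> V" using adj_verts adjs by blast
  ultimately show ?thesis unfolding cross_def by blast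
qed

lemma bounding_hyp_compl: "h \<in> hss \<Longrightarrow> bounding_hyp X (V - h) = bounding_hyp X h"
  using bounding_hyp_eq halfspace_compl bd_compl halfspace_sub by metis

text \<open>
  Two edges of a cube that are not parallel are parallel to adjacent edges of a square, and a
  square has a vertex in each of the four quarters. Conversely, if the halfspaces cross, the
  convex carrier side of \<open>h\<close> contains an edge dual to the hyperplane of \<open>k\<close>, and this edge is part
  of a square dual to both.
\<close>

lemma hyps_meet_iff:
  assumes "h \<in> hss" "k \<in> hss"
  shows "hyps_meet X (bounding_hyp X h) (bounding_hyp X k) \<longleftrightarrow> h = k \<or> h = V - k \<or> cross h k"
proof
  assume "hyps_meet X (bounding_hyp X h) (bounding_hyp X k)"
  then obtain c e f where c: "c \<in> X" "e \<in> bd h" "e \<subseteq> c" "f \<in> bd k" "f \<subseteq> c"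
    unfolding hyps_meet_def bounding_hyp_eq[OF assms(1)] bounding_hyp_eq[OF assms(2)] by blast
  obtain x y where xy: "e = {x, y}" "adj x y" "x \<in> h" "y \<notin> h" using c(2) unfolding bd_def by blast
  obtain p q where pq: "f = {p, q}" "adj p q" "p \<in> k" "q \<notin> k" using c(4) unfolding bd_def by blast
  have hk: "h = hs x y" "k = hs p q" using hs_eqI assms xy pq by blast+
  have xc: "x \<in> c" "y \<in> c" "p \<in> c" "q \<in> c" using c xy pq by auto
  obtain n \<phi> where ch: "bij_betw \<phi> (Pow {..<n::nat}) c" "\<phi> {} = x"
    and face: "\<And>L U. L \<subseteq> U \<Longrightarrow> U \<subseteq> {..<n} \<Longrightarrow> \<phi> ` {A. L \<subseteq> A \<and> A \<subseteq> U} \<in> X"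
    and e: "\<And>A B. A \<subseteq> {..<n} \<Longrightarrow> B \<subseteq> {..<n} \<Longrightarrow> adj (\<phi> A) (\<phi> B) \<Longrightarrow> \<exists>i<n. i \<notin> A \<and> B = insert i A \<or> i \<notin> B \<and> A = insert i B"
    by (rule cube_chart[OF c(1) xc(1)]) (rule that; assumption)
  obtain i where i: "i < n" "bd h = bd (hs (\<phi> {}) (\<phi> {i}))"
    using cube_edge_sides[OF ch(1) face e xy(2) xc(1,2)] hk by blast
  obtain j where j: "j < n" "bd k = bd (hs (\<phi> {}) (\<phi> {j}))"
    using cube_edge_sides[OF ch(1) face e pq(2) xc(3,4)] hk by blast
  show "h = k \<or> h = V - k \<or> cross h k"
  proof (cases "i = j")
    case True
    then have "bd h = bd k" using i j by simp
    then show ?thesis using bd_eq_iff[OF assms] by blast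
  next
    case False
    have "sq (\<phi> {}) (\<phi> {i}) (\<phi> {i, j}) (\<phi> {j})" using cube_chart_sq[OF ch(1) face, of "{}" i j] i j False by auto
    from sq_cross[OF this] have cr: "cross (hs (\<phi> {}) (\<phi> {i})) (hs (\<phi> {}) (\<phi> {j}))" .
    have a: "adj (\<phi> {}) (\<phi> {i})" "adj (\<phi> {}) (\<phi> {j})"
      using cube_chart_adj[OF ch(1) face, of "{}"] i j by auto
    let ?h = "hs (\<phi> {}) (\<phi> {i})" and ?k = "hs (\<phi> {}) (\<phi> {j})"
    have "h = ?h \<or> h = V - ?h" "k = ?k \<or> k = V - ?k"
      using i j bd_eq_iff assms hs_halfspace a by auto
    then show ?thesis using cr cross_compl cross_sym hs_sub by (metis Diff_subset)
  qed
next
  assume "h = k \<or> h = V - k \<or> cross h k"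
  moreover have "hyps_meet X (bounding_hyp X k) (bounding_hyp X k)"
  proof -
    obtain a b where ab: "adj a b" "k = hs a b" using halfspace_iff assms by blast
    then have "{a, b} \<in> bd k" using hs_ends[OF ab(1)] unfolding bd_def by blast
    moreover have "{a, b} \<in> X" using ab unfolding adj_def cc_edges_def by auto
    ultimately show ?thesis unfolding hyps_meet_def bounding_hyp_eq[OF assms(2)] by blast
  qed
  moreover have "hyps_meet X (bounding_hyp X h) (bounding_hyp X k)" if cr: "cross h k"
  proof -
    obtain x y where xy: "x \<in> car h" "y \<in> car h" "x \<in> k" "y \<notin> k" using cross_car_meets[OF assms cr] by blast
    obtain u w where uw: "u \<in> car h" "w \<in> car h" "adj u w" "u \<in> k" "w \<notin> k"
      by (rule conv_edge[OF conv_car[OF assms(1)] xy])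
    obtain u' where u': "adj u u'" "u' \<notin> h" "u \<in> h" using uw car_iff assms by blast
    obtain w' where w': "adj w w'" "w' \<notin> h" "w \<in> h" using uw car_iff assms by blast
    have V: "u \<in> V" "u' \<in> V" "w \<in> V" "w' \<in> V" using adj_verts u' w' by auto
    have hh: "h = hs u u'" "h = hs w w'" using hs_eqI assms u' w' by blast+
    have duw: "d u w = 1" "d w u = 1" using d_adj uw adj_sym by auto
    have 1: "d w' u = Suc (d w u)" using hs_mem[OF w'(1) V(1)] u' hh by blast
    have 3: "d w u' = Suc (d w' u')" using hs_not_mem[OF w'(1) V(2)] u' hh by blast
    have 5: "d u' w = Suc (d u w)" using hs_mem[OF u'(1) V(3)] w' hh by blast
    have ne: "w \<noteq> u'" using u' w' by auto
    have ww: "d w w' = 1" using d_adj w' by blast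
    have "d u w' = Suc (d w w')" "d u w' = Suc (d u' w')"
      using 1 3 5 duw ww d_sym[of u w'] d_sym[of u' w'] d_sym[of w u'] by linarith+
    from quadrangle[OF uw(3) u'(1) ne V(4) this] obtain z where z: "sq u w z u'" by blast
    have s: "{u, w, z, u'} \<in> X" using z unfolding sq_def squares_def by blast
    have "{u, u'} \<in> bd h" "{u, w} \<in> bd k" using u' uw unfolding bd_def by blast+
    with s show ?thesis unfolding hyps_meet_def bounding_hyp_eq[OF assms(1)] bounding_hyp_eq[OF assms(2)]
      by (intro bexI[of _ "{u, w, z, u'}"] conjI bexI[of _ "{u, u'}"] bexI[of _ "{u, w}"]) auto
  qed
  ultimately show "hyps_meet X (bounding_hyp X h) (bounding_hyp X k)"
    using bounding_hyp_compl[OF assms(2)] by metis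
qed

end

section \<open>Automorphisms\<close>

context cat0_complex begin

abbreviation aut :: "('v \<Rightarrow> 'v) \<Rightarrow> bool" where "aut \<equiv> cc_automorphism X"

lemma aut_bij: "aut g \<Longrightarrow> bij_betw g V V" unfolding cc_automorphism_def by blast

lemma aut_inj: "aut g \<Longrightarrow> inj_on g V" using aut_bij bij_betw_def by blast

lemma aut_V: "aut g \<Longrightarrow> x \<in> V \<Longrightarrow> g x \<in> V" using aut_bij bij_betwE by blast

lemma aut_adj: assumes "aut g" "adj a b" shows "adj (g a) (g b)"
proof -
  have ab: "{a, b} \<in> X" "a \<in> V" "b \<in> V" "a \<noteq> b"
    using assms(2) adj_verts adj_neq unfolding adj_def cc_edges_def by auto
  then have "g ` {a, b} \<in> X" using assms(1) unfolding cc_automorphism_def by (metis empty_subsetI insert_subset)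
  moreover have "g a \<noteq> g b" using aut_inj[OF assms(1)] ab by (meson inj_onD)
  ultimately show ?thesis unfolding adj_def cc_edges_def by auto
qed

lemma aut_inverse: assumes "aut g" obtains f where "aut f" "\<And>x. x \<in> V \<Longrightarrow> f (g x) = x" "\<And>x. x \<in> V \<Longrightarrow> g (f x) = x"
proof -
  let ?f = "inv_into V g"
  note b = aut_bij[OF assms]
  have 1: "?f (g x) = x" if "x \<in> V" for x using that aut_inj[OF assms] by simp
  have 2: "g (?f x) = x" if "x \<in> V" for x using that b by (metis bij_betw_def f_inv_into_f)
  have b': "bij_betw ?f V V" using bij_betw_inv_into[OF b] .
  have "c \<in> X \<longleftrightarrow> ?f ` c \<in> X" if c: "c \<subseteq> V" for c
  proof -
    have "g ` ?f ` c = c" using 2 c by (force simp: image_image)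
    moreover have "?f ` c \<subseteq> V" using b' c by (auto simp: bij_betw_def)
    ultimately show ?thesis using assms unfolding cc_automorphism_def by metis
  qed
  then have "aut ?f" using b' unfolding cc_automorphism_def by blast
  then show ?thesis using that 1 2 by blast
qed

lemma aut_comp: assumes "aut g" "aut f" shows "aut (g \<circ> f)"
proof -
  have "c \<in> X \<longleftrightarrow> (g \<circ> f) ` c \<in> X" if "c \<subseteq> V" for c
  proof -
    have "f ` c \<subseteq> V" using aut_V[OF assms(2)] that by blast
    then have "f ` c \<in> X \<longleftrightarrow> g ` f ` c \<in> X" using assms(1) unfolding cc_automorphism_def by blast
    moreover have "c \<in> X \<longleftrightarrow> f ` c \<in> X" using assms(2) that unfolding cc_automorphism_def by blast
    ultimately show ?thesis by (simp add: image_comp)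
  qed
  then show ?thesis using bij_betw_trans[OF aut_bij[OF assms(2)] aut_bij[OF assms(1)]]
    unfolding cc_automorphism_def by blast
qed

lemma aut_d_le: assumes "aut g" "x \<in> V" "y \<in> V" shows "d (g x) (g y) \<le> d x y"
  using assms(2)
proof (induction "d x y" arbitrary: x)
  case 0
  then have "x = y" using d_eq_0 assms by metis
  then show ?case using d_refl aut_V assms by simp
next
  case (Suc n)
  have "x \<noteq> y" using Suc d_refl by auto
  then obtain u where u: "adj x u" "d x y = Suc (d u y)" using d_closer[OF Suc(3) assms(3)] by blast
  have uV: "u \<in> V" using u adj_verts by blast
  have "d (g u) (g y) \<le> d u y" using Suc(1)[of u] Suc(2) u uV by simp
  then show ?case using d_step[OF aut_adj[OF assms(1) u(1)] aut_V[OF assms(1,3)]] u by linarith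
qed

lemma aut_d: assumes "aut g" "x \<in> V" "y \<in> V" shows "d (g x) (g y) = d x y"
proof -
  obtain f where f: "aut f" "\<And>x. x \<in> V \<Longrightarrow> f (g x) = x" using aut_inverse[OF assms(1)] by metis
  have "d (f (g x)) (f (g y)) \<le> d (g x) (g y)" using aut_d_le[OF f(1)] aut_V assms by blast
  then show ?thesis using aut_d_le[OF assms] f assms by simp
qed

lemma aut_hs: assumes "aut g" "adj a b" shows "g ` hs a b = hs (g a) (g b)"
proof -
  obtain f where f: "aut f" "\<And>x. x \<in> V \<Longrightarrow> f (g x) = x" "\<And>x. x \<in> V \<Longrightarrow> g (f x) = x" using aut_inverse[OF assms(1)] by metis
  have ab: "a \<in> V" "b \<in> V" using adj_verts assms by auto
  show ?thesis
  proof (intro equalityI subsetI)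
    fix y assume "y \<in> g ` hs a b"
    then show "y \<in> hs (g a) (g b)" using aut_d[OF assms(1)] ab aut_V[OF assms(1)] unfolding hs_def by auto
  next
    fix y assume y: "y \<in> hs (g a) (g b)"
    then have yV: "y \<in> V" using hs_sub by blast
    then have fy: "f y \<in> V" "g (f y) = y" using aut_V[OF f(1)] f(3) by auto
    then have "f y \<in> hs a b" using aut_d[OF assms(1) ab(1) fy(1)] aut_d[OF assms(1) ab(2) fy(1)] y unfolding hs_def by auto
    then show "y \<in> g ` hs a b" using fy by (metis image_eqI)
  qed
qed

lemma aut_halfspace: "aut g \<Longrightarrow> h \<in> hss \<Longrightarrow> g ` h \<in> hss"
  using aut_hs aut_adj halfspace_iff by metis

lemma aut_compl: "aut g \<Longrightarrow> h \<subseteq> V \<Longrightarrow> g ` (V - h) = V - g ` h"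
  using inj_on_image_set_diff[OF aut_inj, of g V h] aut_bij[of g] by (auto simp: bij_betw_def)

lemma aut_sub_iff: assumes "aut g" "h \<subseteq> V" "k \<subseteq> V" shows "g ` h \<subseteq> g ` k \<longleftrightarrow> h \<subseteq> k"
  using inj_on_image_subset_iff[OF aut_inj[OF assms(1)] assms(2,3)] .

lemma aut_car: assumes "aut g" "h \<in> hss" "y \<in> car h" shows "g y \<in> car (g ` h)"
proof -
  obtain w where w: "y \<in> h" "adj y w" "w \<notin> h" using assms car_iff by blast
  have "g w \<notin> g ` h" using aut_inj[OF assms(1)] w adj_verts halfspace_sub[OF assms(2)]
    by (metis inj_on_image_mem_iff)
  then show ?thesis using car_iff[OF aut_halfspace[OF assms(1,2)]] aut_adj[OF assms(1) w(2)] w(1) by blast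
qed

section \<open>Ultrafilters and the Roller boundary\<close>

abbreviation uf :: "'v set set set" where "uf \<equiv> ultrafilters X"
abbreviation bdry :: "'v set set set" where "bdry \<equiv> roller_boundary X"

lemma uf_iff: "\<alpha> \<in> uf \<longleftrightarrow> \<alpha> \<subseteq> hss \<and> (\<forall>h\<in>hss. (h \<in> \<alpha>) \<noteq> (V - h \<in> \<alpha>)) \<and> (\<forall>h\<in>\<alpha>. \<forall>k\<in>hss. h \<subseteq> k \<longrightarrow> k \<in> \<alpha>)"
  unfolding ultrafilters_def opp_eq mem_Collect_eq by (rule refl)

lemma uf_halfspace: assumes "\<alpha> \<in> uf" "h \<in> \<alpha>" shows "h \<in> hss"
  by (rule subsetD[OF conjunct1[OF assms(1)[unfolded uf_iff]] assms(2)])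

lemma uf_compl: assumes "\<alpha> \<in> uf" "h \<in> hss" shows "V - h \<in> \<alpha> \<longleftrightarrow> h \<notin> \<alpha>"
  using bspec[OF conjunct1[OF conjunct2[OF assms(1)[unfolded uf_iff]]] assms(2)] by simp

lemma uf_up: assumes "\<alpha> \<in> uf" "h \<in> \<alpha>" "k \<in> hss" "h \<subseteq> k" shows "k \<in> \<alpha>"
  using bspec[OF bspec[OF conjunct2[OF conjunct2[OF assms(1)[unfolded uf_iff]]] assms(2)] assms(3)] assms(4) by simp

lemma uf_meet: assumes "\<alpha> \<in> uf" "h \<in> \<alpha>" "k \<in> \<alpha>" shows "h \<inter> k \<noteq> {}"
proof
  assume "h \<inter> k = {}"
  have hk: "h \<in> hss" "k \<in> hss" using assms uf_halfspace by auto
  then have "h \<subseteq> V - k" using \<open>h \<inter> k = {}\<close> halfspace_sub by blast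
  then have "V - k \<in> \<alpha>" using uf_up[OF assms(1,2)] halfspace_compl hk by blast
  then show False using uf_compl[OF assms(1) hk(2)] assms by blast
qed

lemma bdry_uf: "\<alpha> \<in> bdry \<Longrightarrow> \<alpha> \<in> uf" unfolding roller_boundary_def by simp

lemma bdry_chain:
  assumes "\<alpha> \<in> bdry" obtains c :: "nat \<Rightarrow> 'v set" where "\<And>n. c n \<in> \<alpha>" "\<And>n. c (Suc n) \<subset> c n"
proof -
  have "\<exists>c :: nat \<Rightarrow> 'v set. \<forall>n. c n \<in> \<alpha> \<and> c (Suc n) \<subset> c n" using assms unfolding roller_boundary_def by simp
  then obtain c :: "nat \<Rightarrow> 'v set" where "\<forall>n. c n \<in> \<alpha> \<and> c (Suc n) \<subset> c n" ..
  then show ?thesis using that[of c] by simp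
qed

lemma bdryI:
  fixes c :: "nat \<Rightarrow> 'v set"
  assumes "\<alpha> \<in> uf" "\<And>n. c n \<in> \<alpha>" "\<And>n. c (Suc n) \<subset> c n" shows "\<alpha> \<in> bdry"
proof -
  have "\<forall>n. c n \<in> \<alpha> \<and> c (Suc n) \<subset> c n" using assms(2,3) by simp
  then show ?thesis using assms(1) unfolding roller_boundary_def by (intro CollectI conjI exI[of _ c])
qed

text \<open>
  Pairwise intersection is the form in which consistency is available for limits and unions.
\<close>

lemma ufI:
  assumes "\<alpha> \<subseteq> hss" "\<And>h. h \<in> hss \<Longrightarrow> h \<in> \<alpha> \<or> V - h \<in> \<alpha>"
    "\<And>h k. h \<in> \<alpha> \<Longrightarrow> k \<in> \<alpha> \<Longrightarrow> h \<inter> k \<noteq> {}"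
  shows "\<alpha> \<in> uf"
  unfolding uf_iff
proof (intro conjI ballI impI)
  fix h assume h: "h \<in> hss"
  show "(h \<in> \<alpha>) \<noteq> (V - h \<in> \<alpha>)" using assms(2)[OF h] assms(3)[of h "V - h"] by blast
next
  fix h k assume hk: "h \<in> \<alpha>" "k \<in> hss" "h \<subseteq> k"
  then show "k \<in> \<alpha>" using assms(2)[of k] assms(3)[of h "V - k"] by blast
qed (rule assms(1))

lemma vertex_uf_mem: "v \<in> V \<Longrightarrow> vertex_uf X v \<in> uf"
  unfolding vertex_uf_def by (rule ufI) (auto dest: halfspace_compl)

definition minimal_in :: "'v set set \<Rightarrow> 'v set \<Rightarrow> bool" where "minimal_in \<alpha> t \<longleftrightarrow> t \<in> \<alpha> \<and> (\<forall>h\<in>\<alpha>. \<not> h \<subset> t)"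

lemma car_ne: "h \<in> hss \<Longrightarrow> car h \<noteq> {}"
  using halfspace_iff hs_ends car_iff by (metis empty_iff)

lemma car_sub: "h \<in> hss \<Longrightarrow> car h \<subseteq> h" using car_iff by blast

lemma car_disjoint: assumes "t \<in> hss" "h \<in> hss" "h \<subset> t" shows "car t \<inter> h = {}"
proof (rule ccontr)
  assume "car t \<inter> h \<noteq> {}"
  then obtain x w where "x \<in> h" "x \<in> t" "adj x w" "w \<notin> t" using car_iff assms by blast
  then have "h = hs x w" "t = hs x w" using hs_eqI assms by blast+
  then show False using assms by blast
qed

lemma minimal_car_meets: assumes "\<alpha> \<in> uf" "minimal_in \<alpha> t" "s \<in> \<alpha>" shows "car t \<inter> s \<noteq> {}"
proof -
  have t: "t \<in> \<alpha>" "t \<in> hss" "s \<in> hss" using assms uf_halfspace unfolding minimal_in_def by auto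
  have m: "s \<inter> t \<noteq> {}" using uf_meet assms t by blast
  show ?thesis
  proof (cases "s - t = {}")
    case True
    then have "s = t" using assms(2,3) unfolding minimal_in_def by blast
    then show ?thesis using car_ne[OF t(2)] car_sub[OF t(2)] by blast
  next
    case False
    then show ?thesis using conv_meets_car[OF conv_halfspace[OF t(3)] t(2) m] by blast
  qed
qed

text \<open>
  If the carrier sides were disjoint, a hyperplane would separate them, and the side of it that
  belongs to \<open>\<alpha>\<close> would be disjoint from one of the two carrier sides.
\<close>

lemma minimal_car_car: assumes "\<alpha> \<in> uf" "minimal_in \<alpha> t" "minimal_in \<alpha> t'" shows "car t \<inter> car t' \<noteq> {}"
proof
  assume e: "car t \<inter> car t' = {}"
  have t: "t \<in> hss" "t' \<in> hss" using assms uf_halfspace unfolding minimal_in_def by auto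
  obtain x w where xw: "x \<in> car t" "adj x w" "car t' \<subseteq> hs w x" "car t \<inter> hs w x = {}"
    by (rule convex_sep[OF conv_car[OF t(1)] car_ne[OF t(1)] conv_car[OF t(2)] car_ne[OF t(2)] e])
  have m: "hs w x \<in> hss" using hs_halfspace adj_sym xw by blast
  show False
  proof (cases "hs w x \<in> \<alpha>")
    case True then show False using minimal_car_meets[OF assms(1,2)] xw by blast
  next
    case False
    then have "V - hs w x \<in> \<alpha>" using uf_compl[OF assms(1) m] by blast
    then show False using minimal_car_meets[OF assms(1,3)] xw by blast
  qed
qed

lemma V_ne: "V \<noteq> {}" using conn unfolding connected_cc_def by blast

text \<open>
  Pairwise intersections come from consistency of \<open>\<alpha>\<close> and from minimality of the members of \<open>T\<close>.
\<close>

lemma uf_helly: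
  assumes "\<alpha> \<in> uf" "finite T" "finite S" "\<And>t. t \<in> T \<Longrightarrow> minimal_in \<alpha> t" "S \<subseteq> \<alpha>"
  shows "\<exists>y\<in>V. (\<forall>t\<in>T. y \<in> car t) \<and> (\<forall>s\<in>S. y \<in> s)"
proof -
  have T: "t \<in> hss" if "t \<in> T" for t using assms(1,4) that uf_halfspace unfolding minimal_in_def by blast
  have S: "s \<in> hss" if "s \<in> S" for s using assms(1,5) that uf_halfspace by blast
  have "V \<inter> \<Inter>(car ` T \<union> S) \<noteq> {}"
  proof (rule helly)
    show "finite (car ` T \<union> S)" using assms by simp
    show "conv C" if "C \<in> car ` T \<union> S" for C using that conv_car T conv_halfspace S by blast
    show "C \<inter> D \<noteq> {}" if "C \<in> car ` T \<union> S" "D \<in> car ` T \<union> S" for C D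
    proof -
      have 1: "car t \<inter> s \<noteq> {}" if "t \<in> T" "s \<in> S" for t s using minimal_car_meets assms that by blast
      have 2: "car t \<inter> car t' \<noteq> {}" if "t \<in> T" "t' \<in> T" for t t' using minimal_car_car assms that by blast
      have 3: "s \<inter> s' \<noteq> {}" if "s \<in> S" "s' \<in> S" for s s' using uf_meet assms that by blast
      show ?thesis using that
      proof (elim UnE imageE)
        fix t t' assume "t \<in> T" "t' \<in> T" "C = car t" "D = car t'" then show ?thesis using 2 by blast
      next
        fix t assume "t \<in> T" "C = car t" "D \<in> S" then show ?thesis using 1 by blast
      next
        fix t assume "t \<in> T" "D = car t" "C \<in> S" then show ?thesis using 1 by blast
      next
        assume "C \<in> S" "D \<in> S" then show ?thesis using 3 by blast
      qed
    qed
    show "V \<inter> D \<noteq> {}" if "D \<in> car ` T \<union> S" for D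
    proof -
      have "D \<noteq> {} \<and> D \<subseteq> V" using that T S car_ne halfspace_ne conv_sub[OF conv_car] halfspace_sub by blast
      then show ?thesis by blast
    qed
  qed (use conv_V V_ne in auto)
  then show ?thesis by blast
qed

lemma chain_strict: assumes "\<And>n. c (Suc n) \<subset> c n" "i < j" shows "(c :: nat \<Rightarrow> 'v set) j \<subset> c i"
  using assms(2)
proof (induction j)
  case (Suc j) then show ?case using assms(1)[of j] by (cases "i = j") (auto dest: psubset_trans)
qed simp

text \<open>
  Infinitely many members of the chain would separate \<open>v\<close> from a vertex outside the chain.
\<close>

lemma chain_leaves:
  assumes "\<And>n. c n \<in> hss" "\<And>n. c (Suc n) \<subset> c n" "v \<in> V" shows "\<exists>n. v \<notin> c n"
proof (rule ccontr)
  assume "\<not> ?thesis"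
  then have v: "\<And>n. v \<in> c n" by blast
  obtain u where u: "u \<in> c 0" "u \<notin> c 1" using assms(2)[of 0] by auto
  have uV: "u \<in> V" using u assms(1) halfspace_sub by blast
  have inj: "inj c"
  proof (rule injI)
    fix i j assume "c i = c j"
    then show "i = j" using chain_strict[of c, OF assms(2)] by (metis linorder_neqE_nat psubsetE)
  qed
  have "c (Suc n) \<in> {h \<in> hss. v \<in> h \<and> u \<notin> h}" for n
  proof -
    have "c (Suc n) \<subseteq> c 1" using chain_strict[of c 1 "Suc n", OF assms(2)] by (cases n) auto
    then show ?thesis using u v assms(1) by blast
  qed
  then have "range (\<lambda>n. c (Suc n)) \<subseteq> {h \<in> hss. v \<in> h \<and> u \<notin> h}" by blast
  moreover have "infinite (range (\<lambda>n. c (Suc n)))"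
    using inj by (intro range_inj_infinite) (auto simp: inj_def)
  ultimately show False using sep_finite[OF assms(3) uV] finite_subset by blast
qed

lemma aut_uf: assumes "aut g" "\<alpha> \<in> uf" shows "image g ` \<alpha> \<in> uf"
proof (rule ufI)
  obtain f where f: "aut f" "\<And>x. x \<in> V \<Longrightarrow> f (g x) = x" "\<And>x. x \<in> V \<Longrightarrow> g (f x) = x" using aut_inverse[OF assms(1)] by metis
  show "image g ` \<alpha> \<subseteq> hss" using aut_halfspace assms uf_halfspace by blast
  have fg: "g ` f ` k = k" if "k \<subseteq> V" for k
    using that f(3) by (force simp: image_image)
  show "h \<in> image g ` \<alpha> \<or> V - h \<in> image g ` \<alpha>" if h: "h \<in> hss" for h
  proof -
    have 1: "f ` h \<in> \<alpha> \<or> V - f ` h \<in> \<alpha>" using uf_compl[OF assms(2) aut_halfspace[OF f(1) h]] by blast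
    have 2: "V - f ` h = f ` (V - h)" using aut_compl[OF f(1) halfspace_sub[OF h]] by simp
    have "h = g ` f ` h" "V - h = g ` f ` (V - h)" using fg[OF halfspace_sub[OF h]] fg[of "V - h"] by auto
    then show ?thesis using 1 2 by (metis image_eqI)
  qed
  show "h \<inter> k \<noteq> {}" if "h \<in> image g ` \<alpha>" "k \<in> image g ` \<alpha>" for h k
    using that uf_meet[OF assms(2)] by blast
qed

lemma aut_psub: assumes "aut g" "h \<subset> k" "k \<subseteq> V" shows "g ` h \<subset> g ` k"
  using aut_sub_iff[OF assms(1), of k h] assms by blast

lemma aut_bdry: assumes "aut g" "\<alpha> \<in> bdry" shows "image g ` \<alpha> \<in> bdry"
proof -
  obtain c :: "nat \<Rightarrow> 'v set" where c: "\<And>n. c n \<in> \<alpha>" "\<And>n. c (Suc n) \<subset> c n"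
    by (rule bdry_chain[OF assms(2)]) (rule that; assumption)
  have a: "\<alpha> \<in> uf" using assms bdry_uf by blast
  have "g ` c (Suc n) \<subset> g ` c n" for n
    by (rule aut_psub[OF assms(1) c(2) halfspace_sub[OF uf_halfspace[OF a c(1)]]])
  moreover have "g ` c n \<in> image g ` \<alpha>" for n using c(1) by blast
  ultimately show ?thesis by (rule bdryI[OF aut_uf[OF assms(1) a], where c = "\<lambda>n. g ` c n", rotated])
qed

text \<open>
  The basic open set of \<open>S\<close> meets the Roller boundary.
\<close>

definition meets :: "'v set set \<Rightarrow> bool" where "meets S \<longleftrightarrow> (\<exists>\<alpha>\<in>bdry. S \<subseteq> \<alpha>)"

lemma meets_mono: "meets S \<Longrightarrow> S' \<subseteq> S \<Longrightarrow> meets S'" unfolding meets_def by blast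

lemma aut_meets: "aut g \<Longrightarrow> meets S \<Longrightarrow> meets (image g ` S)"
  unfolding meets_def by (blast intro: aut_bdry)

lemma adj_chain: assumes "\<And>n. adj (v n) (v (Suc n))" shows "d (v i) (v (i + k)) \<le> k"
proof (induction k)
  case 0 then show ?case using d_refl adj_verts[OF assms[of i]] by simp
next
  case (Suc k)
  have "v i \<in> V" using adj_verts[OF assms[of i]] by blast
  then have "d (v i) (v (Suc (i + k))) \<le> Suc k"
    using Suc d_step[OF assms[of "i + k"], of "v i"] d_sym[of "v i" "v (i+k)"] d_sym[of "v i" "v (Suc (i+k))"] by linarith
  then show ?case by simp
qed

end

section \<open>Boundary points from local finiteness\<close>

locale cat0_cocompact = cat0_complex X for X :: "'v set set" +
  assumes lf: "locally_finite_cc X" and coco: "cocompact_cc X"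
begin

lemma nbr_finite: "v \<in> V \<Longrightarrow> finite (neighbours X v)" using lf unfolding locally_finite_cc_def by blast

lemma vertex_cube: assumes "v \<in> V" shows "{v} \<in> X"
proof -
  obtain c where c: "c \<in> X" "v \<in> c" using assms unfolding verts_def by blast
  obtain n \<phi> where "\<phi> {} = v"
    and face: "\<And>L U. L \<subseteq> U \<Longrightarrow> U \<subseteq> {..<n::nat} \<Longrightarrow> \<phi> ` {A. L \<subseteq> A \<and> A \<subseteq> U} \<in> X"
    by (rule cube_chart[OF c]) (rule that; assumption)
  then show ?thesis using face[of "{}" "{}"] by simp
qed

lemma orbit_reps: obtains K where "finite K" "K \<subseteq> V" "\<And>v. v \<in> V \<Longrightarrow> \<exists>g. aut g \<and> g v \<in> K"
proof -
  obtain K where K: "finite K" "K \<subseteq> X" "\<forall>c\<in>X. \<exists>g k. aut g \<and> k \<in> K \<and> c = g ` k"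
    using coco unfolding cocompact_cc_def by (elim exE conjE) (rule that; assumption)
  let ?K = "{u. {u} \<in> K}"
  have "finite ((\<lambda>u. {u}) ` ?K)" by (rule finite_subset[OF _ K(1)]) blast
  then have "finite ?K" by (rule finite_imageD) (auto simp: inj_on_def)
  moreover have "?K \<subseteq> V" using K(2) unfolding verts_def by blast
  moreover have "\<exists>g. aut g \<and> g v \<in> ?K" if v: "v \<in> V" for v
  proof -
    have "\<exists>g k. aut g \<and> k \<in> K \<and> {v} = g ` k" using K(3) vertex_cube[OF v] by (rule bspec)
    then obtain g k where g: "aut g" "k \<in> K" "{v} = g ` k" by (elim exE conjE)
    have kV: "k \<subseteq> V" using g(2) K(2) unfolding verts_def by blast
    obtain f where f: "aut f" "\<And>x. x \<in> V \<Longrightarrow> f (g x) = x" using aut_inverse[OF g(1)] by metis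
    have "f ` g ` k = k" using f(2) kV by (force simp: image_image)
    then have "k = {f v}" unfolding g(3)[symmetric] by simp
    then show ?thesis using f(1) g(2) by blast
  qed
  ultimately show ?thesis using that by blast
qed

lemma valence_bound: obtains N where "\<And>v. v \<in> V \<Longrightarrow> card (neighbours X v) \<le> N"
proof -
  obtain K where K: "finite K" "K \<subseteq> V" "\<And>v. v \<in> V \<Longrightarrow> \<exists>g. aut g \<and> g v \<in> K" using orbit_reps by blast
  have "card (neighbours X v) \<le> (\<Sum>u\<in>K. card (neighbours X u))" if v: "v \<in> V" for v
  proof -
    obtain g where g: "aut g" "g v \<in> K" using K v by blast
    have "card (neighbours X v) \<le> card (neighbours X (g v))"
    proof (rule card_inj_on_le[of g])
      show "inj_on g (neighbours X v)"
        by (rule inj_on_subset[OF aut_inj[OF g(1)]]) (auto simp: in_neighbours dest: adj_verts)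
      show "g ` neighbours X v \<subseteq> neighbours X (g v)" by (auto simp: in_neighbours intro: aut_adj[OF g(1)])
      show "finite (neighbours X (g v))" by (rule nbr_finite[OF aut_V[OF g(1) v]])
    qed
    also have "\<dots> \<le> (\<Sum>u\<in>K. card (neighbours X u))" using member_le_sum[OF g(2), of "\<lambda>u. card (neighbours X u)"] K(1) by simp
    finally show ?thesis .
  qed
  then show ?thesis using that by blast
qed

lemma car_hs_nbr: "h \<in> hss \<Longrightarrow> y \<in> car h \<Longrightarrow> h \<in> hs y ` neighbours X y"
  using car_iff hs_eqI in_neighbours by blast

text \<open>
  Without an infinite descending chain every member of \<open>\<alpha>\<close> contains a minimal one. Any finite
  number of minimal members have a common carrier vertex, so there are at most as many of them as
  the largest valence. A common carrier vertex of all of them lies in every member of \<open>\<alpha>\<close>.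
\<close>

lemma uf_vertex: assumes "\<alpha> \<in> uf" "\<alpha> \<notin> bdry" obtains v where "v \<in> V" "\<alpha> = vertex_uf X v"
proof -
  have below: "\<exists>t. minimal_in \<alpha> t \<and> t \<subseteq> h" if h: "h \<in> \<alpha>" for h
  proof (rule ccontr)
    assume no: "\<not> ?thesis"
    have "\<exists>c. \<forall>n. (c n \<in> \<alpha> \<and> c n \<subseteq> h) \<and> c (Suc n) \<subset> c n"
    proof (rule dependent_nat_choice)
      show "\<exists>x. x \<in> \<alpha> \<and> x \<subseteq> h" using h by blast
    next
      fix x and n :: nat assume x: "x \<in> \<alpha> \<and> x \<subseteq> h"
      then have "\<not> minimal_in \<alpha> x" using no by blast
      then obtain y where "y \<in> \<alpha>" "y \<subset> x" using x unfolding minimal_in_def by auto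
      then show "\<exists>y. (y \<in> \<alpha> \<and> y \<subseteq> h) \<and> y \<subset> x" using x by (intro exI[of _ y]) auto
    qed
    then obtain c where c: "\<forall>n. (c n \<in> \<alpha> \<and> c n \<subseteq> h) \<and> c (Suc n) \<subset> c n" ..
    have "\<alpha> \<in> bdry" by (rule bdryI[of \<alpha> c, OF assms(1)]) (use c in auto)
    then show False using assms(2) by simp
  qed
  let ?T = "{t. minimal_in \<alpha> t}"
  obtain N where N: "\<And>v. v \<in> V \<Longrightarrow> card (neighbours X v) \<le> N" using valence_bound by blast
  have fin: "finite ?T"
  proof (rule ccontr)
    assume "infinite ?T"
    then obtain T where T: "T \<subseteq> ?T" "finite T" "card T = Suc N" using infinite_arbitrarily_large by blast
    have "\<exists>y\<in>V. (\<forall>t\<in>T. y \<in> car t) \<and> (\<forall>s\<in>{}. y \<in> s)"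
      by (rule uf_helly[OF assms(1) T(2)]) (use T(1) in auto)
    then obtain y where y: "y \<in> V" "\<And>t. t \<in> T \<Longrightarrow> y \<in> car t" by auto
    have "T \<subseteq> hs y ` neighbours X y"
    proof
      fix t assume t: "t \<in> T"
      then have "t \<in> hss" using T(1) uf_halfspace[OF assms(1)] unfolding minimal_in_def by auto
      then show "t \<in> hs y ` neighbours X y" using car_hs_nbr y(2)[OF t] by simp
    qed
    then have "card T \<le> card (neighbours X y)"
      by (meson card_image_le card_mono finite_imageI le_trans nbr_finite[OF y(1)])
    then show False using N[OF y(1)] T by simp
  qed
  have "\<exists>y\<in>V. (\<forall>t\<in>?T. y \<in> car t) \<and> (\<forall>s\<in>{}. y \<in> s)"
    by (rule uf_helly[OF assms(1) fin]) auto
  then obtain v where v: "v \<in> V" "\<And>t. minimal_in \<alpha> t \<Longrightarrow> v \<in> car t" by auto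
  have vh: "v \<in> h" if "h \<in> \<alpha>" for h
  proof -
    obtain t where "minimal_in \<alpha> t" "t \<subseteq> h" using below \<open>h \<in> \<alpha>\<close> by blast
    moreover from this have "t \<in> hss" using uf_halfspace[OF assms(1)] unfolding minimal_in_def by auto
    ultimately show ?thesis using v(2)[of t] car_sub[of t] by blast
  qed
  have "\<alpha> = vertex_uf X v" unfolding vertex_uf_def
  proof (intro equalityI subsetI)
    fix h assume h: "h \<in> {h \<in> hss. v \<in> h}"
    then have "V - h \<notin> \<alpha>" using vh[of "V - h"] by auto
    then show "h \<in> \<alpha>" using uf_compl[OF assms(1), of h] h by simp
  qed (use vh uf_halfspace[OF assms(1)] in auto)
  then show ?thesis using that v by blast
qed

text \<open>
  A geodesic sequence never returns to a halfspace that contains its start and that it has left,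
  so it decides every halfspace eventually. If the limit were a vertex \<open>x\<close>, the halfspaces entered
  by the sequence would all separate \<open>x\<close> from \<open>v 0\<close>, which bounds their number.
\<close>

lemma ray_limit:
  assumes vV: "\<And>i. v i \<in> V" and geo: "\<And>i j. i \<le> j \<Longrightarrow> d (v 0) (v j) = d (v 0) (v i) + d (v i) (v j)"
    and unb: "\<And>n. \<exists>i. n < d (v 0) (v (i::nat))"
  shows "{h \<in> hss. \<exists>N. \<forall>i\<ge>N. v i \<in> h} \<in> bdry"
proof -
  let ?\<alpha> = "{h \<in> hss. \<exists>N. \<forall>i\<ge>N. v i \<in> h}"
  have stay: "v b \<notin> h" if "h \<in> hss" "v 0 \<in> h" "v a \<notin> h" "a \<le> b" for h a b
    using conv_between[OF conv_halfspace[OF that(1)] that(2) _ vV[of a] geo[OF that(4)]] that(3) by auto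
  have ev: "h \<in> ?\<alpha> \<or> V - h \<in> ?\<alpha>" if h: "h \<in> hss" for h
  proof -
    have *: "h \<in> ?\<alpha> \<or> V - h \<in> ?\<alpha>" if h: "h \<in> hss" "v 0 \<in> h" for h
    proof (cases "\<exists>a. v a \<notin> h")
      case True
      then obtain a where "v a \<notin> h" by blast
      then have "\<forall>i\<ge>a. v i \<in> V - h" using stay h vV by blast
      then show ?thesis using halfspace_compl h by blast
    qed (use h in blast)
    show ?thesis
    proof (cases "v 0 \<in> h")
      case False
      then have "v 0 \<in> V - h" using vV by blast
      from *[OF halfspace_compl[OF h] this] show ?thesis using halfspace_dcompl[OF h] by auto
    qed (use * h in blast)
  qed
  have meet: "h \<inter> k \<noteq> {}" if hk: "h \<in> ?\<alpha>" "k \<in> ?\<alpha>" for h k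
  proof -
    obtain N M where "\<forall>i\<ge>N. v i \<in> h" "\<forall>i\<ge>M. v i \<in> k" using hk by blast
    then have "v (max N M) \<in> h \<inter> k" by simp
    then show ?thesis by blast
  qed
  have uf: "?\<alpha> \<in> uf" by (rule ufI) (use ev meet in blast)+
  show ?thesis
  proof (rule ccontr)
    assume "?\<alpha> \<notin> bdry"
    then obtain x where x: "x \<in> V" "?\<alpha> = vertex_uf X x" using uf_vertex[OF uf] by blast
    obtain i where i: "d (v 0) x < d (v 0) (v i)" using unb by blast
    have "{h \<in> hss. v i \<in> h \<and> v 0 \<notin> h} \<subseteq> {h \<in> hss. x \<in> h \<and> v 0 \<notin> h}"
    proof
      fix h assume h: "h \<in> {h \<in> hss. v i \<in> h \<and> v 0 \<notin> h}"
      then have "v 0 \<in> V - h" "v i \<notin> V - h" using vV by auto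
      then have "\<forall>j\<ge>i. v j \<notin> V - h" using stay[OF halfspace_compl] h by blast
      then have "h \<in> ?\<alpha>" using h vV by blast
      then show "h \<in> {h \<in> hss. x \<in> h \<and> v 0 \<notin> h}" using h unfolding x(2) vertex_uf_def by blast
    qed
    then have "card {h \<in> hss. v i \<in> h \<and> v 0 \<notin> h} \<le> card {h \<in> hss. x \<in> h \<and> v 0 \<notin> h}"
      by (rule card_mono[rotated]) (use sep_finite[OF x(1) vV[of 0]] in blast)
    then show False using i sep_card[OF vV vV] sep_card[OF x(1) vV[of 0]] d_sym[of "v 0"] by simp
  qed
qed

text \<open>
  Koenig's lemma: \<open>F x\<close> collects the points of \<open>C\<close> beyond \<open>x\<close>, and by local finiteness one of the
  neighbours of \<open>x\<close> again has infinitely many points beyond it.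
\<close>

lemma infinite_convex_ray:
  assumes "conv C" "infinite C"
  obtains v :: "nat \<Rightarrow> 'v" where "\<And>i. v i \<in> C" "\<And>i. adj (v i) (v (Suc i))" "\<And>i. d (v 0) (v i) = i"
proof -
  obtain o' where o: "o' \<in> C" using assms by fastforce
  have oV: "o' \<in> V" using o conv_sub assms by blast
  define F where "F x = {y \<in> C. d o' y = d o' x + d x y}" for x
  have "\<exists>v. \<forall>n. (v n \<in> C \<and> infinite (F (v n)) \<and> d o' (v n) = n) \<and> adj (v n) (v (Suc n))"
  proof (rule dependent_nat_choice)
    have "F o' = C" unfolding F_def using d_refl oV by auto
    then show "\<exists>x. x \<in> C \<and> infinite (F x) \<and> d o' x = 0" using o assms d_refl oV by auto
  next
    fix x n assume x: "x \<in> C \<and> infinite (F x) \<and> d o' x = n"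
    have xV: "x \<in> V" using x conv_sub assms by blast
    let ?W = "{w \<in> neighbours X x. w \<in> C \<and> d o' w = Suc n}"
    have sub: "F x - {x} \<subseteq> (\<Union>w\<in>?W. F w)"
    proof
      fix y assume y: "y \<in> F x - {x}"
      then have yC: "y \<in> C" "d o' y = n + d x y" "x \<noteq> y" unfolding F_def using x by auto
      have yV: "y \<in> V" using yC conv_sub assms by blast
      obtain w where w: "adj x w" "d x y = Suc (d w y)" using d_closer[OF xV yV yC(3)] by blast
      have wV: "w \<in> V" using w adj_verts by blast
      have wC: "w \<in> C" using w x yC assms unfolding conv_def by blast
      have "d o' y \<le> d o' w + d w y" using d_triangle oV wV yV by blast
      then have dw: "d o' w = Suc n" using d_step[OF w(1) oV] x yC w d_sym[of x o'] d_sym[of w o'] by linarith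
      then have "y \<in> F w" unfolding F_def using yC w by auto
      then show "y \<in> (\<Union>w\<in>?W. F w)" using w wC dw in_neighbours by blast
    qed
    have "infinite (\<Union>w\<in>?W. F w)" using sub x by (meson finite_subset infinite_remove)
    moreover have "finite ?W" using nbr_finite[OF xV] by simp
    ultimately obtain w where "w \<in> ?W" "infinite (F w)" by blast
    then show "\<exists>y. (y \<in> C \<and> infinite (F y) \<and> d o' y = Suc n) \<and> adj x y" using in_neighbours by blast
  qed
  then obtain v where v: "\<And>n. v n \<in> C" "\<And>n. d o' (v n) = n" "\<And>n. adj (v n) (v (Suc n))" by blast
  have "v 0 = o'" using v(2)[of 0] d_eq_0[OF oV, of "v 0"] v(1)[of 0] conv_sub assms by blast
  then show ?thesis using that v by blast
qed

lemma ray_geodesic: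
  assumes "\<And>i. adj (v i) (v (Suc i))" "\<And>i. d (v 0) (v i) = i" "i \<le> j"
  shows "d (v 0) (v j) = d (v 0) (v i) + d (v i) (v j)"
proof -
  have "d (v i) (v j) \<le> j - i" using adj_chain[of v i "j - i"] assms by simp
  moreover have "d (v 0) (v j) \<le> d (v 0) (v i) + d (v i) (v j)" by (rule d_triangle) (use assms(1) adj_verts in blast)+
  ultimately show ?thesis using assms(2)[of i] assms(2)[of j] assms(3) by linarith
qed

lemma adj_ray_limit:
  assumes "\<And>i. adj (v i) (v (Suc i))" "\<And>i. d (v 0) (v i) = i"
  shows "{h \<in> hss. \<exists>N. \<forall>i\<ge>N. v i \<in> h} \<in> bdry"
proof (rule ray_limit)
  show "v i \<in> V" for i using assms(1) adj_verts by blast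
  show "d (v 0) (v j) = d (v 0) (v i) + d (v i) (v j)" if "i \<le> j" for i j
    using ray_geodesic[of v, OF assms that] .
  show "\<exists>i. n < d (v 0) (v i)" for n using assms(2) by (metis lessI)
qed

lemma infinite_convex_meets:
  assumes "conv C" "infinite C" "S \<subseteq> hss" "\<And>s. s \<in> S \<Longrightarrow> C \<subseteq> s" shows "meets S"
proof -
  obtain v :: "nat \<Rightarrow> 'v" where v: "\<And>i. v i \<in> C" "\<And>i. adj (v i) (v (Suc i))" "\<And>i. d (v 0) (v i) = i"
    using infinite_convex_ray[OF assms(1,2)] by blast
  have "S \<subseteq> {h \<in> hss. \<exists>N. \<forall>i\<ge>N. v i \<in> h}" using v(1) assms(3,4) by blast
  then show ?thesis unfolding meets_def using adj_ray_limit[of v, OF v(2,3)] by blast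
qed

end

section \<open>Hyperplanes inside basic open sets\<close>

context cat0_complex begin

text \<open>
  The hyperplane bounding \<open>k\<close> lies in \<open>h\<close> and differs from the one bounding \<open>h\<close>: one of its two
  sides is strictly contained in \<open>h\<close>.
\<close>

definition inside :: "'v set \<Rightarrow> 'v set \<Rightarrow> bool" where "inside k h \<longleftrightarrow> k \<subset> h \<or> V - k \<subset> h"

lemma inside_iff: assumes "k \<in> hss" "h \<in> hss" shows "inside k h \<longleftrightarrow> (\<forall>e\<in>bd k. e \<subseteq> h)"
proof
  assume i: "inside k h"
  show "\<forall>e\<in>bd k. e \<subseteq> h"
  proof
    fix e assume "e \<in> bd k"
    then obtain x y where xy: "e = {x, y}" "adj x y" "x \<in> k" "y \<notin> k" unfolding bd_def by blast
    have k: "k = hs x y" using hs_eqI[OF assms(1) xy(2-4)] .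
    have k': "V - k = hs y x" unfolding k by (rule hs_compl[OF xy(2)])
    have V: "x \<in> V" "y \<in> V" using adj_verts[OF xy(2)] by auto
    have ne: "h \<noteq> k" "h \<noteq> V - k" using i halfspace_ne[OF assms(1)] halfspace_ne_compl[OF assms(1)] halfspace_sub[OF assms(1)]
      unfolding inside_def by blast+
    have "x \<in> h \<longleftrightarrow> y \<in> h"
      using hs_eqI[OF assms(2) xy(2)] hs_eqI[OF assms(2) adj_sym[OF xy(2)]] ne k k' by blast
    moreover have "x \<in> h \<or> y \<in> h" using i xy(3,4) V unfolding inside_def by blast
    ultimately show "e \<subseteq> h" using xy(1) by blast
  qed
next
  assume e: "\<forall>e\<in>bd k. e \<subseteq> h"
  have ne: "h \<noteq> k" "h \<noteq> V - k"
  proof -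
    obtain a b where ab: "adj a b" "k = hs a b" using halfspace_iff assms(1) by blast
    have "{a, b} \<in> bd k" using ab hs_ends[OF ab(1)] unfolding bd_def by blast
    then have "a \<in> h" "b \<in> h" using e by auto
    then show "h \<noteq> k" "h \<noteq> V - k" using ab hs_ends[OF ab(1)] by auto
  qed
  show "inside k h"
  proof (rule ccontr)
    assume "\<not> inside k h"
    then have "\<not> k \<subseteq> h" "\<not> V - k \<subseteq> h" using ne unfolding inside_def by auto
    then have 1: "(V - h) \<inter> k \<noteq> {}" "(V - h) - k \<noteq> {}" using halfspace_sub[OF assms(1)] by auto
    obtain x where x: "x \<in> car k" "x \<notin> h"
      using conv_meets_car[OF conv_halfspace[OF halfspace_compl[OF assms(2)]] assms(1) 1] by auto
    then obtain w where w: "x \<in> k" "adj x w" "w \<notin> k" using car_iff[OF assms(1)] by auto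
    then have "{x, w} \<in> bd k" unfolding bd_def by blast
    then show False using e x by auto
  qed
qed

lemma inside_compl: "k \<in> hss \<Longrightarrow> inside (V - k) h \<longleftrightarrow> inside k h"
  unfolding inside_def using halfspace_dcompl by auto

lemma hyp_in_iff: assumes "adj a b" "h \<in> hss"
  shows "hyp_in_halfspace X (dual_hyp X {a, b}) h \<longleftrightarrow> inside (hs a b) h"
proof -
  have k: "hs a b \<in> hss" using hs_halfspace assms by blast
  have "bd (hs a b) \<noteq> bd h" if "inside (hs a b) h"
  proof
    assume "bd (hs a b) = bd h"
    then have "\<forall>e\<in>bd h. e \<subseteq> h" using that inside_iff[OF k assms(2)] by simp
    then have "inside h h" using inside_iff[OF assms(2,2)] by simp
    then show False unfolding inside_def using halfspace_ne_compl[OF assms(2)] by blast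
  qed
  then show ?thesis unfolding hyp_in_halfspace_def dual_eq[OF assms(1)] bounding_hyp_eq[OF assms(2)]
    using inside_iff[OF k assms(2)] by blast
qed

text \<open>
  The condition on open sets, tested on the basic open sets that meet the boundary.
\<close>

definition hyp_dense :: bool where
  "hyp_dense \<longleftrightarrow> (\<forall>S. finite S \<and> S \<subseteq> hss \<and> meets S \<longrightarrow> (\<exists>k\<in>hss. \<forall>h\<in>S. inside k h))"

lemma openin_basic: "finite H \<Longrightarrow> H \<subseteq> hss \<Longrightarrow> openin (uf_topology X) (uf_basic X H)"
  unfolding uf_topology_def by (rule topology_generated_by_Basis) blast

lemma open_nhd:
  assumes "openin (uf_topology X) U" "\<alpha> \<in> U"
  shows "\<exists>H. finite H \<and> H \<subseteq> \<alpha> \<and> uf_basic X H \<subseteq> U \<and> \<alpha> \<in> uf"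
proof -
  let ?B = "insert uf {uf_basic X H | H. finite H \<and> H \<subseteq> hss}"
  have "generate_topology_on ?B U" using assms(1) unfolding uf_topology_def openin_topology_generated_by_iff .
  then show ?thesis using assms(2)
  proof (induction rule: generate_topology_on.induct)
    case (Int a b)
    then obtain H H' where "finite H" "H \<subseteq> \<alpha>" "uf_basic X H \<subseteq> a" "finite H'" "H' \<subseteq> \<alpha>" "uf_basic X H' \<subseteq> b" "\<alpha> \<in> uf" by auto
    then show ?case unfolding uf_basic_def by (intro exI[of _ "H \<union> H'"]) auto
  next
    case (UN K)
    from UN.prems obtain k where k: "k \<in> K" "\<alpha> \<in> k" by blast
    from UN.IH[OF k] obtain H where "finite H" "H \<subseteq> \<alpha>" "uf_basic X H \<subseteq> k" "\<alpha> \<in> uf" by (elim exE conjE)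
    then show ?case using k(1) by (intro exI[of _ H]) auto
  next
    case (Basis s)
    then consider "s = uf" | H where "s = uf_basic X H" "finite H" "H \<subseteq> hss" by blast
    then show ?case
    proof cases
      case 1 then show ?thesis using Basis by (intro exI[of _ "{}"]) (auto simp: uf_basic_def)
    next
      case 2 then show ?thesis using Basis by (intro exI[of _ H]) (auto simp: uf_basic_def)
    qed
  qed simp
qed

lemma uf_topspace: "topspace (uf_topology X) = uf"
  unfolding uf_topology_def topology_generated_by_topspace by (auto simp: uf_basic_def)

lemma bd_in_V: "e \<in> bd k \<Longrightarrow> v \<in> e \<Longrightarrow> v \<in> V"
  unfolding bd_def using adj_verts by blast

lemma hyp_dense_iff_open:
  "hyp_dense \<longleftrightarrow> (\<forall>U. openin (uf_topology X) U \<and> U \<inter> bdry \<noteq> {} \<longrightarrow>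
     (\<exists>H\<in>hyperplanes X. uf_set_contains_hyp X U H))"
proof
  assume hd: "hyp_dense"
  show "\<forall>U. openin (uf_topology X) U \<and> U \<inter> bdry \<noteq> {} \<longrightarrow> (\<exists>H\<in>hyperplanes X. uf_set_contains_hyp X U H)"
  proof (intro allI impI)
    fix U assume U: "openin (uf_topology X) U \<and> U \<inter> bdry \<noteq> {}"
    then obtain \<alpha> where a: "\<alpha> \<in> U" "\<alpha> \<in> bdry" by blast
    obtain H where H: "finite H" "H \<subseteq> \<alpha>" "uf_basic X H \<subseteq> U" using open_nhd[OF _ a(1)] U by auto
    have Hh: "H \<subseteq> hss" using H(2) uf_halfspace[OF bdry_uf[OF a(2)]] by auto
    have "meets H" unfolding meets_def using a H by blast
    then obtain k where k: "k \<in> hss" "\<forall>h\<in>H. inside k h" using hd H(1) Hh unfolding hyp_dense_def by blast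
    obtain x y where xy: "adj x y" "k = hs x y" using halfspace_iff k(1) by blast
    have "uf_set_contains_hyp X U (dual_hyp X {x, y})" unfolding uf_set_contains_hyp_def dual_eq[OF xy(1)]
    proof (intro ballI)
      fix e v assume e: "e \<in> bd (hs x y)" "v \<in> e"
      have "v \<in> h" if "h \<in> H" for h using k(2) inside_iff[OF k(1)] Hh that e xy(2) by blast
      then have "vertex_uf X v \<in> uf_basic X H" unfolding uf_basic_def using vertex_uf_mem[OF bd_in_V[OF e]] Hh
        by (auto simp: vertex_uf_def)
      then show "vertex_uf X v \<in> U" using H by blast
    qed
    then show "\<exists>H\<in>hyperplanes X. uf_set_contains_hyp X U H" using dual_hyperplane[OF xy(1)] by blast
  qed
next
  assume op: "\<forall>U. openin (uf_topology X) U \<and> U \<inter> bdry \<noteq> {} \<longrightarrow> (\<exists>H\<in>hyperplanes X. uf_set_contains_hyp X U H)"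
  show hyp_dense unfolding hyp_dense_def
  proof (intro allI impI)
    fix S assume S: "finite S \<and> S \<subseteq> hss \<and> meets S"
    then have "uf_basic X S \<inter> bdry \<noteq> {}" unfolding meets_def uf_basic_def using bdry_uf by auto
    moreover have "openin (uf_topology X) (uf_basic X S)" using openin_basic S by simp
    ultimately have "\<exists>H\<in>hyperplanes X. uf_set_contains_hyp X (uf_basic X S) H"
      using op[rule_format, of "uf_basic X S"] by simp
    then obtain H where H: "H \<in> hyperplanes X" "uf_set_contains_hyp X (uf_basic X S) H" by (elim bexE)
    obtain x y where xy: "adj x y" "H = dual_hyp X {x, y}" by (rule hyperplane_cases[OF H(1)])
    have k: "hs x y \<in> hss" using hs_halfspace xy by blast
    have "inside (hs x y) h" if h: "h \<in> S" for h
    proof -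
      have "h \<in> hss" using h S by blast
      moreover have "e \<subseteq> h" if "e \<in> bd (hs x y)" for e
      proof
        fix v assume "v \<in> e"
        then have "vertex_uf X v \<in> uf_basic X S" using H(2) that unfolding xy(2) dual_eq[OF xy(1)] uf_set_contains_hyp_def by blast
        then show "v \<in> h" using h unfolding uf_basic_def vertex_uf_def by auto
      qed
      ultimately show ?thesis using inside_iff[OF k] by blast
    qed
    then show "\<exists>k\<in>hss. \<forall>h\<in>S. inside k h" using k by blast
  qed
qed

lemma sep_union_finite:
  assumes "finite S" "\<And>s. s \<in> S \<Longrightarrow> p s \<in> V" "v \<in> V"
  shows "finite (\<Union>s\<in>S. {h \<in> hss. p s \<in> h \<and> v \<notin> h})"
  using assms sep_finite by (intro finite_UN_I) auto

lemma pick_outside: assumes "S \<subseteq> hss" obtains p where "\<And>s. s \<in> S \<Longrightarrow> p s \<in> V - s"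
proof -
  have "\<forall>s\<in>S. \<exists>x. x \<in> V - s" using halfspace_ne_compl assms by blast
  then obtain p where "\<forall>s\<in>S. p s \<in> V - s" by (rule bchoice[THEN exE])
  then show ?thesis using that by blast
qed

text \<open>
  The vertex \<open>v\<close> is chosen in all members of \<open>S\<close> such that as few members of \<open>\<alpha>\<close> as possible lie
  beyond \<open>v\<close> and contain the complement of some \<open>s \<in> S\<close>. If a vertex \<open>x\<close> outside \<open>s\<close> were allowed
  by the cage at \<open>v\<close>, the hyperplane of the first edge from \<open>v\<close> towards the complement of \<open>s\<close>
  would have its far side in \<open>\<alpha>\<close>, and crossing it would lower this number.
\<close>

lemma cage_neighbourhood:
  assumes "\<alpha> \<in> uf" "finite S" "S \<subseteq> \<alpha>"
  shows "\<exists>v\<in>V. \<forall>x\<in>V. (\<forall>k\<in>\<alpha>. v \<in> car k \<longrightarrow> x \<in> k) \<longrightarrow> (\<forall>s\<in>S. x \<in> s)"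
proof -
  have Sh: "S \<subseteq> hss" using assms(3) uf_halfspace[OF assms(1)] by blast
  \<comment> \<open>\<open>M v\<close> is finite: its members separate \<open>v\<close> from one of the finitely many points \<open>p s\<close>\<close>
  define M where "M v = {k \<in> \<alpha>. v \<notin> k \<and> (\<exists>s\<in>S. V - s \<subseteq> k)}" for v
  obtain p where p: "\<And>s. s \<in> S \<Longrightarrow> p s \<in> V - s" by (rule pick_outside[OF Sh]) (rule that; assumption)
  have fin: "finite (M v)" if "v \<in> V" for v
  proof (rule finite_subset[OF _ sep_union_finite[of S p v]])
    show "M v \<subseteq> (\<Union>s\<in>S. {h \<in> hss. p s \<in> h \<and> v \<notin> h})"
    proof
      fix k assume "k \<in> M v"
      then obtain s where k: "k \<in> \<alpha>" "v \<notin> k" "s \<in> S" "V - s \<subseteq> k" unfolding M_def by blast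
      have "p s \<in> k" using p[OF k(3)] k(4) by blast
      then show "k \<in> (\<Union>s\<in>S. {h \<in> hss. p s \<in> h \<and> v \<notin> h})" using k uf_halfspace[OF assms(1) k(1)] by blast
    qed
  qed (use assms p that in auto)
  have "\<exists>y\<in>V. (\<forall>t\<in>{}. y \<in> car t) \<and> (\<forall>s\<in>S. y \<in> s)" by (rule uf_helly[OF assms(1)]) (use assms in auto)
  then obtain y where y: "y \<in> V \<and> (\<forall>s\<in>S. y \<in> s)" by blast
  obtain v where v: "v \<in> V" "\<forall>s\<in>S. v \<in> s" and
    min: "\<And>w. w \<in> V \<and> (\<forall>s\<in>S. w \<in> s) \<Longrightarrow> card (M v) \<le> card (M w)"
    using ex_has_least_nat[of "\<lambda>v. v \<in> V \<and> (\<forall>s\<in>S. v \<in> s)" y "\<lambda>v. card (M v)"] y by auto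
  have "x \<in> s" if x: "x \<in> V" "\<forall>k\<in>\<alpha>. v \<in> car k \<longrightarrow> x \<in> k" and s: "s \<in> S" for x s
  proof (rule ccontr)
    assume xs: "x \<notin> s"
    have sh: "V - s \<in> hss" using s Sh halfspace_compl by blast
    have "v \<in> V - (V - s)" using v s by blast
    then obtain w where w: "adj v w" "V - s \<subseteq> hs w v"
      using gate_step[OF conv_halfspace[OF sh] halfspace_ne[OF sh]] by blast
    let ?m = "hs w v"
    have m: "?m \<in> hss" "hs v w \<in> hss" "V - ?m = hs v w" "w \<in> V"
      using hs_halfspace w adj_sym[OF w(1)] hs_compl adj_verts by auto
    have ma: "?m \<in> \<alpha>"
    proof (rule ccontr)
      assume "?m \<notin> \<alpha>"
      then have "hs v w \<in> \<alpha>" using uf_compl[OF assms(1) m(1)] m(3) by simp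
      moreover have "v \<in> car (hs v w)" using car_iff[OF m(2)] hs_ends[OF w(1)] w(1) by blast
      ultimately have "x \<in> hs v w" using x by blast
      then show False using w(2) xs x(1) m(3) by blast
    qed
    have mna: "hs v w \<notin> \<alpha>" using uf_compl[OF assms(1) m(1)] ma m(3) by simp
    have ws: "w \<in> s'" if s': "s' \<in> S" for s'
    proof (rule ccontr)
      assume "w \<notin> s'"
      then have "s' = hs v w" using hs_eqI[of s' v w] s' Sh v w by blast
      then show False using mna s' assms by blast
    qed
    have "M w \<subset> M v"
    proof
      show "M w \<subseteq> M v"
      proof
        fix k assume k: "k \<in> M w"
        have "v \<notin> k"
        proof
          assume "v \<in> k"
          then have "k = hs v w" using hs_eqI[of k v w] k uf_halfspace[OF assms(1)] w unfolding M_def by blast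
          then show False using k mna unfolding M_def by blast
        qed
        then show "k \<in> M v" using k unfolding M_def by blast
      qed
      have "?m \<in> M v" "?m \<notin> M w" unfolding M_def using ma hs_ends[OF adj_sym[OF w(1)]] w(2) s by auto
      then show "M w \<noteq> M v" by blast
    qed
    then have "card (M w) < card (M v)" using psubset_card_mono fin[OF v(1)] by blast
    then show False using min[of w] m(4) ws by auto
  qed
  then show ?thesis using v(1) by blast
qed

end

context cat0_cocompact begin

lemma cage_finite: assumes "K \<subseteq> hss" "\<And>k. k \<in> K \<Longrightarrow> v \<in> car k" "v \<in> V" shows "finite K"
proof (rule finite_subset)
  show "K \<subseteq> hs v ` neighbours X v" using car_hs_nbr assms by blast
  show "finite (hs v ` neighbours X v)" using nbr_finite assms by simp
qed

text \<open>
  Local finiteness makes cages finite, which gives one direction; the other is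
  \<open>cage_neighbourhood\<close>.
\<close>

lemma caged_iff_hyp_dense: "caged_hyperplanes X \<longleftrightarrow> hyp_dense"
proof
  assume hd: hyp_dense
  show "caged_hyperplanes X" unfolding caged_hyperplanes_def is_cage_def
  proof (intro ballI allI impI)
    fix \<alpha> K assume a: "\<alpha> \<in> bdry" and K: "K \<subseteq> \<alpha> \<and> (\<exists>v\<in>V. \<forall>k\<in>K. v \<in> car k)"
    have Kh: "K \<subseteq> hss" using K uf_halfspace[OF bdry_uf[OF a]] by blast
    obtain v where "v \<in> V" "\<forall>k\<in>K. v \<in> car k" using K by blast
    then have "finite K" using cage_finite[OF Kh, of v] by blast
    moreover have "meets K" unfolding meets_def using a K by blast
    ultimately obtain k where k: "k \<in> hss" "\<forall>h\<in>K. inside k h" using hd Kh unfolding hyp_dense_def by blast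
    obtain x y where xy: "adj x y" "k = hs x y" using halfspace_iff k(1) by blast
    have "\<forall>h\<in>K. hyp_in_halfspace X (dual_hyp X {x, y}) h" using hyp_in_iff[OF xy(1)] k xy(2) Kh by blast
    then show "\<exists>H\<in>hyperplanes X. \<forall>k\<in>K. hyp_in_halfspace X H k" using dual_hyperplane[OF xy(1)] by blast
  qed
next
  assume cg: "caged_hyperplanes X"
  show hyp_dense unfolding hyp_dense_def
  proof (intro allI impI)
    fix S assume S: "finite S \<and> S \<subseteq> hss \<and> meets S"
    then obtain \<alpha> where a: "\<alpha> \<in> bdry" "S \<subseteq> \<alpha>" unfolding meets_def by blast
    note au = bdry_uf[OF a(1)]
    obtain v where v: "v \<in> V" "\<And>x. x \<in> V \<Longrightarrow> \<forall>k\<in>\<alpha>. v \<in> car k \<longrightarrow> x \<in> k \<Longrightarrow> \<forall>s\<in>S. x \<in> s"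
      using cage_neighbourhood[OF au _ a(2)] S by blast
    let ?K = "{k \<in> \<alpha>. v \<in> car k}"
    have "is_cage X \<alpha> ?K" unfolding is_cage_def using v(1) by blast
    then obtain H where H: "H \<in> hyperplanes X" "\<forall>k\<in>?K. hyp_in_halfspace X H k" using cg a(1) unfolding caged_hyperplanes_def by blast
    obtain x y where xy: "adj x y" "H = dual_hyp X {x, y}" by (rule hyperplane_cases[OF H(1)])
    have k: "hs x y \<in> hss" using hs_halfspace xy by blast
    have "inside (hs x y) s" if s: "s \<in> S" for s
    proof -
      have "e \<subseteq> s" if e: "e \<in> bd (hs x y)" for e
      proof
        fix u assume u: "u \<in> e"
        have "\<forall>k\<in>\<alpha>. v \<in> car k \<longrightarrow> u \<in> k"
        proof (intro ballI impI)
          fix h assume h: "h \<in> \<alpha>" "v \<in> car h"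
          have hh: "h \<in> hss" using uf_halfspace[OF au h(1)] .
          have "inside (hs x y) h" using H(2) h hyp_in_iff[OF xy(1) hh] xy(2) by blast
          then show "u \<in> h" using inside_iff[OF k hh] e u by blast
        qed
        then show "u \<in> s" using v(2)[OF bd_in_V[OF e u]] s by blast
      qed
      then show ?thesis using inside_iff[OF k] s S by blast
    qed
    then show "\<exists>k\<in>hss. \<forall>h\<in>S. inside k h" using k by blast
  qed
qed

section \<open>Density of non-terminating ultrafilters\<close>

text \<open>
  No halfspace is minimal in all boundary points of a basic open set that meets the boundary.
\<close>

definition deepening :: bool where
  "deepening \<longleftrightarrow> (\<forall>S t. finite S \<and> S \<subseteq> hss \<and> meets S \<and> t \<in> S \<longrightarrow> (\<exists>k\<in>hss. k \<subset> t \<and> meets (insert k S)))"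

text \<open>
  The non-terminating ultrafilters are dense in the boundary.
\<close>

definition nonterm_dense :: bool where
  "nonterm_dense \<longleftrightarrow> (\<forall>S. finite S \<and> S \<subseteq> hss \<and> meets S \<longrightarrow> (\<exists>\<beta>\<in>bdry. non_terminating \<beta> \<and> S \<subseteq> \<beta>))"

lemma halfspace_infinite: assumes "essential_cc X" "h \<in> hss" shows "infinite h"
proof
  assume fin: "finite h"
  obtain a b where ab: "adj a b" "h = hs a b" using halfspace_iff assms(2) by blast
  have e: "{a, b} \<in> bounding_hyp X h" unfolding bounding_hyp_eq[OF assms(2)] bd_def using ab hs_ends[OF ab(1)] by blast
  define n where "n = Suc (Max ((\<lambda>v. d v a) ` h))"
  have "\<exists>v\<in>h. \<forall>e\<in>bounding_hyp X h. \<forall>u\<in>e. n \<le> d v u" using assms unfolding essential_cc_def by blast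
  then obtain v where v: "v \<in> h" "n \<le> d v a" using e by blast
  have "d v a \<le> Max ((\<lambda>v. d v a) ` h)" using v(1) fin by simp
  then show False using v(2) unfolding n_def by simp
qed

text \<open>
  Apply density to \<open>S\<close> together with the finite set \<open>Z\<close> of all members of \<open>\<alpha>\<close> separating the
  complements of \<open>t\<close> and of another member of \<open>S\<close>. If different sides of the resulting hyperplane
  lay in \<open>t\<close> and in \<open>s\<close>, it would bound a member of \<open>Z\<close>, but it lies strictly inside all of them.
\<close>

lemma hyp_dense_halfspace:
  assumes "hyp_dense" "finite S" "S \<subseteq> hss" "meets S" "t \<in> S"
  obtains k where "k \<in> hss" "\<And>s. s \<in> S \<Longrightarrow> k \<subset> s"
proof -
  obtain \<alpha> where a: "\<alpha> \<in> bdry" "S \<subseteq> \<alpha>" using assms(4) unfolding meets_def by blast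
  note au = bdry_uf[OF a(1)]
  define Z where "Z = {k \<in> \<alpha>. \<exists>s\<in>S. (V - t \<subseteq> k \<and> V - s \<subseteq> V - k) \<or> (V - s \<subseteq> k \<and> V - t \<subseteq> V - k)}"
  obtain p where p: "\<And>s. s \<in> S \<Longrightarrow> p s \<in> V - s" by (rule pick_outside[OF assms(3)]) (rule that; assumption)
  have pV: "p s \<in> V" if "s \<in> S" for s using p[OF that] by simp
  have "Z \<subseteq> (\<Union>s\<in>S. {h \<in> hss. p s \<in> h \<and> p t \<notin> h}) \<union> (\<Union>s\<in>S. {h \<in> hss. p t \<in> h \<and> p s \<notin> h})"
  proof
    fix k assume "k \<in> Z"
    then obtain s where s: "k \<in> \<alpha>" "s \<in> S" "(V - t \<subseteq> k \<and> V - s \<subseteq> V - k) \<or> (V - s \<subseteq> k \<and> V - t \<subseteq> V - k)"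
      unfolding Z_def by blast
    have "(p t \<in> k \<and> p s \<notin> k) \<or> (p s \<in> k \<and> p t \<notin> k)" using s(3) p[OF s(2)] p[OF assms(5)] by blast
    then show "k \<in> (\<Union>s\<in>S. {h \<in> hss. p s \<in> h \<and> p t \<notin> h}) \<union> (\<Union>s\<in>S. {h \<in> hss. p t \<in> h \<and> p s \<notin> h})"
      using s(2) uf_halfspace[OF au s(1)] by blast
  qed
  moreover have "finite (\<Union>s\<in>S. {h \<in> hss. p s \<in> h \<and> p t \<notin> h})"
    using sep_finite[OF pV pV[OF assms(5)]] assms(2) by blast
  moreover have "finite (\<Union>s\<in>S. {h \<in> hss. p t \<in> h \<and> p s \<notin> h})"
    using sep_finite[OF pV[OF assms(5)] pV] assms(2) by blast
  ultimately have finZ: "finite Z" using finite_subset by blast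
  have Zh: "Z \<subseteq> hss" unfolding Z_def using uf_halfspace[OF au] by blast
  have "meets (S \<union> Z)" unfolding meets_def Z_def using a by blast
  then obtain k0 where k0: "k0 \<in> hss" "\<forall>h\<in>S \<union> Z. inside k0 h"
    using assms(1-3) finZ Zh unfolding hyp_dense_def by (metis Un_least finite_Un)
  obtain k where k: "k \<in> hss" "\<And>h. h \<in> S \<union> Z \<Longrightarrow> inside k h" "k \<subset> t"
  proof (cases "k0 \<subset> t")
    case True then show ?thesis using that[of k0] k0 by simp
  next
    case False
    have "inside k0 t" using k0(2) assms(5) by simp
    then have 1: "V - k0 \<subset> t" using False unfolding inside_def by simp
    have "inside (V - k0) h" if "h \<in> S \<union> Z" for h using k0(2) that inside_compl[OF k0(1)] by simp
    then show ?thesis using that[OF halfspace_compl[OF k0(1)] _ 1] by simp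
  qed
  have kV: "k \<subseteq> V" using halfspace_sub k(1) by blast
  have "k \<subset> s" if s: "s \<in> S" for s
  proof (rule ccontr)
    assume "\<not> k \<subset> s"
    then have c: "V - k \<subset> s" using k(2)[of s] s unfolding inside_def by blast
    have 1: "V - s \<subseteq> k" "V - t \<subseteq> V - k" using c k(3) by blast+
    show False
    proof (cases "k \<in> \<alpha>")
      case True
      then have "k \<in> Z" unfolding Z_def using s 1 by blast
      then have "inside k k" using k(2) by blast
      then show False unfolding inside_def using halfspace_ne_compl[OF k(1)] by blast
    next
      case False
      then have "V - k \<in> \<alpha>" using uf_compl[OF au k(1)] by blast
      then have "V - k \<in> Z" unfolding Z_def using s 1 kV by blast
      then have "inside k (V - k)" using k(2) by blast
      then show False unfolding inside_def using halfspace_ne[OF k(1)] by blast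
    qed
  qed
  then show ?thesis using that k(1) by blast
qed

lemma hyp_dense_deepening: assumes "essential_cc X" "hyp_dense" shows "deepening"
  unfolding deepening_def
proof (intro allI impI)
  fix S t assume S: "finite S \<and> S \<subseteq> hss \<and> meets S \<and> t \<in> S"
  obtain k where k: "k \<in> hss" "\<And>s. s \<in> S \<Longrightarrow> k \<subset> s"
    by (rule hyp_dense_halfspace[OF assms(2), of S t]) (use S in auto)
  have "meets (insert k S)"
    by (rule infinite_convex_meets[OF conv_halfspace[OF k(1)] halfspace_infinite[OF assms(1) k(1)]]) (use k S in auto)
  then show "\<exists>k\<in>hss. k \<subset> t \<and> meets (insert k S)" using k S by blast
qed

lemma halfspaces_countable: "countable hss"
proof -
  obtain a where a: "a \<in> V" using V_ne by blast
  have fin: "finite {y \<in> V. d a y = n}" for n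
  proof (induction n)
    case 0
    have "{y \<in> V. d a y = 0} \<subseteq> {a}" using d_eq_0[OF a] by auto
    then show ?case using finite_subset by blast
  next
    case (Suc n)
    have "{y \<in> V. d a y = Suc n} \<subseteq> (\<Union>y\<in>{y \<in> V. d a y = n}. neighbours X y)"
    proof
      fix y assume y: "y \<in> {y \<in> V. d a y = Suc n}"
      then have "y \<noteq> a" using d_refl[OF a] by auto
      then obtain w where w: "adj y w" "d y a = Suc (d w a)" using d_closer[of y a] y a by blast
      have "d a w = n" using w(2) y d_sym[of y a] d_sym[of w a] by simp
      then show "y \<in> (\<Union>y\<in>{y \<in> V. d a y = n}. neighbours X y)"
        using adj_verts[OF w(1)] adj_sym[OF w(1)] by (auto simp: in_neighbours)
    qed
    moreover have "finite (\<Union>y\<in>{y \<in> V. d a y = n}. neighbours X y)" using Suc nbr_finite by auto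
    ultimately show ?case by (rule finite_subset)
  qed
  have "V = (\<Union>n. {y \<in> V. d a y = n})" by blast
  moreover have "countable (\<Union>n. {y \<in> V. d a y = n})" using fin by (intro countable_UN) (auto intro: countable_finite)
  ultimately have "countable V" by simp
  then have "countable ((\<lambda>(a, b). hs a b) ` (V \<times> V))" by (intro countable_image countable_SIGMA) auto
  moreover have "hss \<subseteq> (\<lambda>(a, b). hs a b) ` (V \<times> V)" using halfspace_iff adj_verts by force
  ultimately show ?thesis by (rule countable_subset[rotated])
qed

lemma nonterm_bdry: assumes "\<beta> \<in> uf" "non_terminating \<beta>" "h \<in> \<beta>" shows "\<beta> \<in> bdry"
proof -
  have "\<exists>c. \<forall>n. c n \<in> \<beta> \<and> c (Suc n) \<subset> c n"
  proof (rule dependent_nat_choice)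
    show "\<exists>x. x \<in> \<beta>" using assms(3) by blast
  next
    fix x and n :: nat assume "x \<in> \<beta>"
    then show "\<exists>y. y \<in> \<beta> \<and> y \<subset> x" using assms(2) unfolding non_terminating_def by blast
  qed
  then obtain c where c: "\<forall>n. c n \<in> \<beta> \<and> c (Suc n) \<subset> c n" ..
  show ?thesis by (rule bdryI[of \<beta> c, OF assms(1)]) (use c in auto)
qed

text \<open>
  Halfspaces are decided one after another along an enumeration. A halfspace that can be added is
  added together with a smaller one, so that it is not minimal in the result.
\<close>

lemma deepening_dense: assumes "deepening" shows "nonterm_dense"
  unfolding nonterm_dense_def
proof (intro allI impI)
  fix S assume S: "finite S \<and> S \<subseteq> hss \<and> meets S"
  obtain \<alpha>0 where "\<alpha>0 \<in> bdry" using S unfolding meets_def by blast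
  then obtain c :: "nat \<Rightarrow> 'v set" where "\<And>n. c n \<in> \<alpha>0" by (rule bdry_chain) (rule that; assumption)
  then have ne: "hss \<noteq> {}" using uf_halfspace[OF bdry_uf[OF \<open>\<alpha>0 \<in> bdry\<close>]] by blast
  define e where "e = from_nat_into hss"
  have er: "range e = hss" unfolding e_def using range_from_nat_into[OF ne halfspaces_countable] .
  have eh: "e n \<in> hss" for n using er by blast
  \<comment> \<open>If \<open>h\<close> cannot be added to \<open>T\<close>, its complement lies in every boundary point of the open set of \<open>T\<close>.\<close>
  define nxt where "nxt T h = (if meets (insert h T)
    then insert (SOME k. k \<in> hss \<and> k \<subset> h \<and> meets (insert k (insert h T))) (insert h T) else insert (V - h) T)" for T h
  define stage where "stage = rec_nat S (\<lambda>n T. nxt T (e n))"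
  have sq0: "stage 0 = S" and sqS: "stage (Suc n) = nxt (stage n) (e n)" for n unfolding stage_def by simp_all
  have nxt: "finite (nxt T h) \<and> nxt T h \<subseteq> hss \<and> meets (nxt T h) \<and> T \<subseteq> nxt T h \<and>
      (h \<in> nxt T h \<or> V - h \<in> nxt T h) \<and> (meets (insert h T) \<longrightarrow> (\<exists>k\<in>nxt T h. k \<subset> h))"
    if T: "finite T" "T \<subseteq> hss" "meets T" and h: "h \<in> hss" for T h
  proof (cases "meets (insert h T)")
    case True
    let ?k = "SOME k. k \<in> hss \<and> k \<subset> h \<and> meets (insert k (insert h T))"
    have "\<exists>k. k \<in> hss \<and> k \<subset> h \<and> meets (insert k (insert h T))"
      using assms[unfolded deepening_def, rule_format, of "insert h T" h] T h True by blast
    then have k: "?k \<in> hss \<and> ?k \<subset> h \<and> meets (insert ?k (insert h T))" by (rule someI_ex)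
    have "nxt T h = insert ?k (insert h T)" unfolding nxt_def using True by simp
    then show ?thesis using k T h by auto
  next
    case False
    then have n: "nxt T h = insert (V - h) T" unfolding nxt_def by simp
    obtain \<alpha> where a: "\<alpha> \<in> bdry" "T \<subseteq> \<alpha>" using T unfolding meets_def by blast
    then have "h \<notin> \<alpha>" using False unfolding meets_def by blast
    then have "V - h \<in> \<alpha>" using uf_compl[OF bdry_uf[OF a(1)] h] by blast
    then have "meets (insert (V - h) T)" unfolding meets_def using a by blast
    then show ?thesis using n T h halfspace_compl False by auto
  qed
  have inv: "finite (stage n) \<and> stage n \<subseteq> hss \<and> meets (stage n)" for n
  proof (induction n)
    case (Suc n) then show ?case unfolding sqS using nxt[of "stage n" "e n"] eh by blast
  qed (use S sq0 in simp)
  have inv1: "finite (stage n)" and inv2: "stage n \<subseteq> hss" and inv3: "meets (stage n)" for n using inv[of n] by auto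
  have en: "\<exists>n. h = e n" if "h \<in> hss" for h using that unfolding er[symmetric] by (elim rangeE) (rule exI)
  have N: "stage n \<subseteq> stage (Suc n)" "e n \<in> stage (Suc n) \<or> V - e n \<in> stage (Suc n)"
    "meets (insert (e n) (stage n)) \<Longrightarrow> \<exists>k\<in>stage (Suc n). k \<subset> e n" for n
    unfolding sqS using nxt[of "stage n" "e n"] inv[of n] eh by blast+
  have mono: "stage m \<subseteq> stage n" if "m \<le> n" for m n using lift_Suc_mono_le[of stage, OF N(1) that] .
  let ?\<beta> = "\<Union>n. stage n"
  have uf: "?\<beta> \<in> uf"
  proof (rule ufI)
    show "?\<beta> \<subseteq> hss" by (rule UN_least) (rule inv2)
    show "h \<in> ?\<beta> \<or> V - h \<in> ?\<beta>" if h: "h \<in> hss" for h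
    proof -
      obtain n where "h = e n" using en[OF h] by (elim exE)
      then show ?thesis using N(2)[of n] by (metis UN_I UNIV_I)
    qed
    show "h \<inter> k \<noteq> {}" if hk: "h \<in> ?\<beta>" "k \<in> ?\<beta>" for h k
    proof -
      obtain i j where "h \<in> stage i" "k \<in> stage j" using hk by blast
      then have 1: "h \<in> stage (max i j)" "k \<in> stage (max i j)" using mono by (meson max.cobounded1 max.cobounded2 subsetD)+
      obtain \<alpha> where a: "\<alpha> \<in> bdry" "stage (max i j) \<subseteq> \<alpha>" using inv3[of "max i j"] unfolding meets_def by (elim bexE)
      have "h \<in> \<alpha>" "k \<in> \<alpha>" using 1 a(2) by auto
      then show ?thesis using uf_meet[OF bdry_uf[OF a(1)]] by blast
    qed
  qed
  have nt: "non_terminating ?\<beta>" unfolding non_terminating_def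
  proof
    fix h assume h: "h \<in> ?\<beta>"
    then obtain j where j: "h \<in> stage j" by blast
    obtain n where n: "h = e n" using en[OF subsetD[OF inv2 j]] by (elim exE)
    have "insert h (stage n) \<subseteq> stage (max j n)" using j mono[of j "max j n"] mono[of n "max j n"] by auto
    then have "meets (insert (e n) (stage n))" using meets_mono[OF inv3] n by simp
    from N(3)[OF this] obtain k where "k \<in> stage (Suc n)" "k \<subset> e n" by (elim bexE)
    then show "\<exists>k\<in>?\<beta>. k \<subset> h" unfolding n by (intro bexI[of _ k] UN_I[of "Suc n"]) auto
  qed
  have "?\<beta> \<in> bdry"
  proof -
    have "e 0 \<in> ?\<beta> \<or> V - e 0 \<in> ?\<beta>" using N(2)[of 0] by (metis UN_I UNIV_I)
    then show ?thesis using nonterm_bdry[OF uf nt] by (elim disjE)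
  qed
  moreover have "S \<subseteq> ?\<beta>" using sq0 by (metis UN_upper UNIV_I)
  ultimately show "\<exists>\<beta>\<in>bdry. non_terminating \<beta> \<and> S \<subseteq> \<beta>" using nt by (intro bexI[of _ ?\<beta>] conjI)
qed

text \<open>
  The boundary is closed: the halfspaces with \<open>v\<close> in their carrier side define a basic
  neighbourhood of the vertex \<open>v\<close>, and each of its points has \<open>v\<close> in all its members, so it has no
  infinite descending chain.
\<close>

lemma B_sub_bdry: "B_boundary X \<subseteq> bdry"
proof
  fix \<alpha> assume "\<alpha> \<in> B_boundary X"
  then have a: "\<alpha> \<in> uf" and cl: "\<And>T. \<alpha> \<in> T \<Longrightarrow> openin (uf_topology X) T \<Longrightarrow> \<exists>y\<in>{\<alpha> \<in> bdry. non_terminating \<alpha>}. y \<in> T"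
    unfolding B_boundary_def in_closure_of uf_topspace by auto
  show "\<alpha> \<in> bdry"
  proof (rule ccontr)
    assume "\<alpha> \<notin> bdry"
    then obtain v where v: "v \<in> V" "\<alpha> = vertex_uf X v" using uf_vertex[OF a] by blast
    let ?H = "{h \<in> hss. v \<in> car h}"
    have finH: "finite ?H" by (rule cage_finite[OF _ _ v(1)]) auto
    have "?H \<subseteq> \<alpha>" unfolding v(2) vertex_uf_def using car_sub by blast
    then have "\<alpha> \<in> uf_basic X ?H" unfolding uf_basic_def using a by simp
    then obtain \<beta> where b: "\<beta> \<in> bdry" "\<beta> \<in> uf_basic X ?H" using cl openin_basic[OF finH] by blast
    note bu = bdry_uf[OF b(1)]
    have vh: "v \<in> h" if h: "h \<in> \<beta>" for h
    proof (rule ccontr)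
      assume "v \<notin> h"
      have hh: "h \<in> hss" using uf_halfspace[OF bu h] .
      obtain w where w: "adj v w" "h \<subseteq> hs w v"
        using gate_step[OF conv_halfspace[OF hh] halfspace_ne[OF hh], of v] v(1) \<open>v \<notin> h\<close> by blast
      have m: "hs v w \<in> hss" using hs_halfspace w by blast
      have "v \<in> car (hs v w)" using car_iff[OF m] hs_ends[OF w(1)] w(1) by blast
      then have "hs v w \<in> \<beta>" using b(2) m unfolding uf_basic_def by blast
      moreover have "h \<inter> hs v w = {}" using w(2) hs_compl[OF w(1)] by blast
      ultimately show False using uf_meet[OF bu h] by blast
    qed
    obtain c :: "nat \<Rightarrow> 'v set" where c: "\<And>n. c n \<in> \<beta>" "\<And>n. c (Suc n) \<subset> c n"
      by (rule bdry_chain[OF b(1)]) (rule that; assumption)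
    show False using chain_leaves[of c v, OF uf_halfspace[OF bu c(1)] c(2) v(1)] vh c(1) by blast
  qed
qed

lemma bdry_eq_B_iff: "bdry = B_boundary X \<longleftrightarrow> nonterm_dense"
proof
  assume e: "bdry = B_boundary X"
  show nonterm_dense unfolding nonterm_dense_def
  proof (intro allI impI)
    fix S assume S: "finite S \<and> S \<subseteq> hss \<and> meets S"
    then obtain \<alpha> where a: "\<alpha> \<in> bdry" "S \<subseteq> \<alpha>" unfolding meets_def by blast
    then have "\<alpha> \<in> B_boundary X" using e by simp
    then have cl: "\<And>T. \<alpha> \<in> T \<Longrightarrow> openin (uf_topology X) T \<Longrightarrow> \<exists>y\<in>{\<alpha> \<in> bdry. non_terminating \<alpha>}. y \<in> T"
      unfolding B_boundary_def in_closure_of by auto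
    have "\<alpha> \<in> uf_basic X S" unfolding uf_basic_def using a bdry_uf by blast
    then obtain \<beta> where "\<beta> \<in> bdry" "non_terminating \<beta>" "\<beta> \<in> uf_basic X S" using cl openin_basic S by blast
    then show "\<exists>\<beta>\<in>bdry. non_terminating \<beta> \<and> S \<subseteq> \<beta>" unfolding uf_basic_def by blast
  qed
next
  assume nd: nonterm_dense
  have "\<alpha> \<in> B_boundary X" if a: "\<alpha> \<in> bdry" for \<alpha>
    unfolding B_boundary_def in_closure_of uf_topspace
  proof (intro conjI allI impI)
    show "\<alpha> \<in> uf" using bdry_uf a .
    fix T assume T: "\<alpha> \<in> T \<and> openin (uf_topology X) T"
    obtain H where H: "finite H" "H \<subseteq> \<alpha>" "uf_basic X H \<subseteq> T"
      using open_nhd[OF conjunct2[OF T] conjunct1[OF T]] by (elim exE conjE)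
    have "H \<subseteq> hss" using H(2) uf_halfspace[OF bdry_uf[OF a]] by blast
    moreover have "meets H" unfolding meets_def using a H(2) by blast
    ultimately obtain \<beta> where b: "\<beta> \<in> bdry" "non_terminating \<beta>" "H \<subseteq> \<beta>"
      using nd[unfolded nonterm_dense_def, rule_format, of H] H(1) by auto
    then have "\<beta> \<in> T" using H(3) bdry_uf[OF b(1)] unfolding uf_basic_def by blast
    then show "\<exists>y. y \<in> {\<alpha> \<in> bdry. non_terminating \<alpha>} \<and> y \<in> T" using b by blast
  qed
  then show "bdry = B_boundary X" using B_sub_bdry by blast
qed

end

section \<open>Tight cages\<close>

context cat0_cocompact begin

lemma core_mem: "v \<in> core X S T \<longleftrightarrow> v \<in> V \<and> (\<forall>t\<in>T. v \<in> car t) \<and> (\<forall>s\<in>S. v \<in> s)"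
  unfolding core_def by simp

lemma conv_core: assumes "S \<subseteq> hss" "T \<subseteq> hss" shows "conv (core X S T)"
  unfolding conv_def
proof (intro conjI ballI allI impI)
  show "core X S T \<subseteq> V" unfolding core_def by blast
next
  fix p c q assume p: "p \<in> core X S T" and c: "c \<in> core X S T" and q: "adj p q \<and> d p c = Suc (d q c)"
  have "q \<in> V" using q adj_verts by blast
  moreover have "q \<in> car t" if t: "t \<in> T" for t
  proof -
    have "conv (car t)" using conv_car t assms by blast
    moreover have "p \<in> car t" "c \<in> car t" using p c t unfolding core_mem by auto
    ultimately show ?thesis using q unfolding conv_def by blast
  qed
  moreover have "q \<in> s" if s: "s \<in> S" for s
  proof -
    have "conv s" using conv_halfspace s assms by blast
    moreover have "p \<in> s" "c \<in> s" using p c s unfolding core_mem by auto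
    ultimately show ?thesis using q unfolding conv_def by blast
  qed
  ultimately show "q \<in> core X S T" unfolding core_mem by blast
qed

lemma unbounded_infinite: assumes "unbounded_cc X Y" shows "infinite Y"
proof
  assume fin: "finite Y"
  let ?D = "(\<lambda>(v, w). d v w) ` (Y \<times> Y)"
  obtain v w where vw: "v \<in> Y" "w \<in> Y" "Max ?D < d v w" using assms unfolding unbounded_cc_def by blast
  have "d v w \<le> Max ?D" by (rule Max_ge) (use fin vw in auto)
  then show False using vw by simp
qed

lemma not_inside_self: assumes "h \<in> hss" shows "\<not> inside h h" "\<not> inside (V - h) h"
  using halfspace_ne_compl[OF assms] halfspace_ne[OF assms] halfspace_sub[OF assms] unfolding inside_def by blast+

lemma inside_not_cross: "inside k h \<Longrightarrow> \<not> cross k h" unfolding inside_def cross_def by blast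

lemma bounding_eq_iff: "h \<in> hss \<Longrightarrow> k \<in> hss \<Longrightarrow> bounding_hyp X h = bounding_hyp X k \<longleftrightarrow> h = k \<or> h = V - k"
  using bounding_hyp_eq bd_eq_iff by simp

lemma dual_hyp_eq_far: assumes "adj x u" shows "dual_hyp X {x, u} = bounding_hyp X (hs u x)"
  using dual_hyp_eq[OF adj_sym[OF assms]] by (simp add: insert_commute)

text \<open>
  The hyperplane \<open>k\<close> obtained from density cannot cut the core, because then it would be dual to
  an edge of the core. Hence \<open>convex_sep\<close> separates it from the core by a hyperplane \<open>?m\<close> dual to
  an edge \<open>{x, u}\<close> leaving the core. The alternatives in the definition of a tight cage force \<open>?m\<close>
  to cross all of \<open>T\<close>, and then \<open>u\<close> is in the core as well.
\<close>

lemma tight_cage_not_hyp_dense: assumes "tight_cage X S T" shows "\<not> hyp_dense"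
proof
  assume hd: hyp_dense
  let ?Y = "core X S T"
  have fin: "finite S" "finite T" and sub: "S \<subseteq> hss" "T \<subseteq> hss" and card: "2 \<le> card T"
    and unb: "unbounded_cc X ?Y"
    and iv: "\<And>e. e \<in> cc_edges X \<Longrightarrow> e \<inter> ?Y \<noteq> {} \<Longrightarrow> dual_hyp X e \<in> bounding_hyp X ` (S \<union> T) \<or>
        (\<forall>t\<in>T. hyps_meet X (dual_hyp X e) (bounding_hyp X t))"
    using assms unfolding tight_cage_def by auto
  have cY: "conv ?Y" using conv_core[OF sub] .
  have iY: "infinite ?Y" using unbounded_infinite[OF unb] .
  have YH: "?Y \<subseteq> h" if "h \<in> S \<union> T" for h using that car_sub sub unfolding core_def by blast
  have "meets (S \<union> T)" by (rule infinite_convex_meets[OF cY iY]) (use sub YH in auto)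
  then obtain k0 where k0: "k0 \<in> hss" "\<And>h. h \<in> S \<union> T \<Longrightarrow> inside k0 h"
    using hd fin sub unfolding hyp_dense_def by (metis Un_least finite_Un)
  obtain t0 where t0: "t0 \<in> T" using card by fastforce
  have hh: "h \<in> hss" if "h \<in> S \<union> T" for h using that sub by blast
  have side: "?Y \<inter> k0 = {} \<or> ?Y - k0 = {}"
  proof (rule ccontr)
    assume "\<not> ?thesis"
    then obtain p q where pq: "p \<in> ?Y" "q \<in> ?Y" "p \<in> k0" "q \<notin> k0" by blast
    obtain u w where uw: "u \<in> ?Y" "w \<in> ?Y" "adj u w" "u \<in> k0" "w \<notin> k0" by (rule conv_edge[OF cY pq])
    have k: "k0 = hs u w" using hs_eqI[OF k0(1) uw(3-5)] .
    have e: "dual_hyp X {u, w} = bounding_hyp X k0" unfolding k by (rule dual_hyp_eq[OF uw(3)])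
    have "{u, w} \<in> cc_edges X" "{u, w} \<inter> ?Y \<noteq> {}" using uw by (auto simp: adj_def)
    from iv[OF this] show False
    proof
      assume "dual_hyp X {u, w} \<in> bounding_hyp X ` (S \<union> T)"
      then obtain h where h: "h \<in> S \<union> T" "bounding_hyp X k0 = bounding_hyp X h" using e by auto
      then have "k0 = h \<or> k0 = V - h" using bounding_eq_iff[OF k0(1) hh] by simp
      then show False using k0(2)[OF h(1)] not_inside_self[OF hh[OF h(1)]] by auto
    next
      assume "\<forall>t\<in>T. hyps_meet X (dual_hyp X {u, w}) (bounding_hyp X t)"
      then have "hyps_meet X (bounding_hyp X k0) (bounding_hyp X t0)" using t0 e by simp
      then have "k0 = t0 \<or> k0 = V - t0 \<or> cross k0 t0" using hyps_meet_iff[OF k0(1) hh] t0 by simp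
      then show False using k0(2)[of t0] t0 not_inside_self[OF hh[of t0]] inside_not_cross by auto
    qed
  qed
  obtain k where k: "k \<in> hss" "\<And>h. h \<in> S \<union> T \<Longrightarrow> inside k h" "?Y \<inter> k = {}"
  proof (cases "?Y \<inter> k0 = {}")
    case True then show ?thesis using that[of k0] k0 by simp
  next
    case False
    then have 1: "?Y \<inter> (V - k0) = {}" using side by blast
    have 2: "inside (V - k0) h" if "h \<in> S \<union> T" for h using k0(2)[OF that] inside_compl[OF k0(1)] by simp
    show ?thesis by (rule that[OF halfspace_compl[OF k0(1)] 2 1])
  qed
  have Yne: "?Y \<noteq> {}" using iY by auto
  obtain x u where xu: "x \<in> ?Y" "adj x u" "k \<subseteq> hs u x" "?Y \<inter> hs u x = {}"
    by (rule convex_sep[OF cY Yne conv_halfspace[OF k(1)] halfspace_ne[OF k(1)] k(3)])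
  let ?m = "hs u x"
  have m: "?m \<in> hss" using hs_halfspace adj_sym[OF xu(2)] by blast
  have E: "?m \<noteq> h \<and> ?m \<noteq> V - h" if h: "h \<in> S \<union> T" for h
  proof
    show "?m \<noteq> h" using xu(1,4) YH[OF h] by blast
    show "?m \<noteq> V - h"
    proof
      assume "?m = V - h"
      then have "k \<subseteq> V - h" using xu(3) by simp
      then show False using k(2)[OF h] halfspace_ne[OF k(1)] halfspace_sub[OF hh[OF h]] unfolding inside_def by blast
    qed
  qed
  have "{x, u} \<in> cc_edges X" "{x, u} \<inter> ?Y \<noteq> {}" using xu by (auto simp: adj_def)
  note iv1 = iv[OF this, unfolded dual_hyp_eq_far[OF xu(2)]]
  have "bounding_hyp X ?m \<notin> bounding_hyp X ` (S \<union> T)"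
  proof
    assume "bounding_hyp X ?m \<in> bounding_hyp X ` (S \<union> T)"
    then obtain h where h: "bounding_hyp X ?m = bounding_hyp X h" "h \<in> S \<union> T" by (elim imageE)
    then show False using bounding_eq_iff[OF m hh[OF h(2)]] E[OF h(2)] by simp
  qed
  with iv1 have mt: "\<forall>t\<in>T. hyps_meet X (bounding_hyp X ?m) (bounding_hyp X t)" by simp
  have cr: "cross ?m t" if t: "t \<in> T" for t
  proof -
    have t': "t \<in> S \<union> T" using t by simp
    show ?thesis using mt t hyps_meet_iff[OF m hh[OF t']] E[OF t'] by simp
  qed
  have "u \<in> ?Y" unfolding core_mem
  proof (intro conjI ballI)
    show "u \<in> V" using adj_verts xu(2) by blast
    show "u \<in> car t" if t: "t \<in> T" for t
      using cross_step[OF hh[of t] _ xu(2) cr[OF t]] t xu(1) unfolding core_mem by blast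
    show "u \<in> s" if s: "s \<in> S" for s
    proof (rule ccontr)
      assume "u \<notin> s"
      moreover have "x \<in> s" using xu(1) s unfolding core_mem by blast
      ultimately have "s = hs x u" using hs_eqI[OF hh xu(2), of s] s by simp
      then have "?m = V - s" using hs_compl[OF xu(2)] by simp
      then show False using E[of s] s by blast
    qed
  qed
  then show False using xu(4) hs_ends(1)[OF adj_sym[OF xu(2)]] by blast
qed

lemma hyps_meet_sym: "hyps_meet X H K \<Longrightarrow> hyps_meet X K H" unfolding hyps_meet_def by blast

lemma straight_edge:
  assumes "straight_links X" "adj b a"
  obtains c where "adj b c" "\<not> hyps_meet X (bounding_hyp X (hs b a)) (bounding_hyp X (hs c b))"
proof -
  have "{b, a} \<in> cc_edges X" "b \<in> V" using assms(2) adj_verts by (auto simp: adj_def)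
  then obtain f where f: "f \<in> cc_edges X" "b \<in> f" "\<not> hyps_meet X (dual_hyp X {b, a}) (dual_hyp X f)"
    using assms(1) unfolding straight_links_def by blast
  obtain p q where "f = {p, q}" "adj p q" using edge_obtain[OF f(1)] by blast
  then obtain c where c: "f = {b, c}" "adj b c" using f(2) adj_sym by (metis insertE insert_commute singletonD)
  then show ?thesis using that[OF c(2)] f(3) dual_hyp_eq[OF assms(2)] dual_hyp_eq_far[OF c(2)] by simp
qed

text \<open>
  The hyperplanes of the two edges at \<open>b\<close> are disjoint, so their far sides are nested.
\<close>

lemma straight_step:
  assumes "straight_links X" "adj a b"
  obtains c where "adj b c" "hs c b \<subset> hs b a"
proof -
  obtain c where c: "adj b c" "\<not> hyps_meet X (bounding_hyp X (hs b a)) (bounding_hyp X (hs c b))"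
    using straight_edge[OF assms(1) adj_sym[OF assms(2)]] by blast
  let ?m = "hs b a" and ?n = "hs c b"
  have mn: "?m \<in> hss" "?n \<in> hss" using hs_halfspace adj_sym assms(2) c(1) by auto
  have ne: "?m \<noteq> ?n" "?m \<noteq> V - ?n" "\<not> cross ?m ?n" using c(2) hyps_meet_iff[OF mn] by auto
  have V: "a \<in> V" "b \<in> V" "c \<in> V" using adj_verts assms(2) c(1) by auto
  have e: "b \<in> ?m" "a \<notin> ?m" "c \<in> ?n" "b \<notin> ?n" using hs_ends adj_sym assms(2) c(1) by auto
  have "a \<notin> ?n"
  proof
    assume "a \<in> ?n"
    then have "?n = hs a b" using hs_eqI[OF mn(2) assms(2)] e by blast
    then show False using ne(2) hs_compl[OF assms(2)] by simp
  qed
  moreover have "c \<in> ?m"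
  proof (rule ccontr)
    assume "c \<notin> ?m"
    then have "?m = hs b c" using hs_eqI[OF mn(1) c(1)] e by blast
    then show False using ne(2) hs_compl[OF adj_sym[OF c(1)]] by simp
  qed
  ultimately have "?n \<subset> ?m" using ne(3) e V unfolding cross_def by blast
  then show ?thesis using that c(1) by blast
qed

text \<open>
  Straight continuations cross strictly nested halfspaces, which makes the path a geodesic and
  confines it to the first of them.
\<close>

lemma straight_ray:
  assumes "straight_links X" "adj x u"
  obtains v :: "nat \<Rightarrow> 'v" where "v 0 = x" "v 1 = u" "\<And>i. adj (v i) (v (Suc i))" "\<And>i. d (v 0) (v i) = i"
    "\<And>i. hs (v (Suc i)) (v i) \<subseteq> hs u x"
proof -
  have "\<exists>e. \<forall>n. (adj (fst (e n)) (snd (e n)) \<and> (n = 0 \<longrightarrow> e n = (x, u))) \<and>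
      (fst (e (Suc n)) = snd (e n) \<and> hs (snd (e (Suc n))) (fst (e (Suc n))) \<subset> hs (snd (e n)) (fst (e n)))"
  proof (rule dependent_nat_choice)
    show "\<exists>e. adj (fst e) (snd e) \<and> ((0::nat) = 0 \<longrightarrow> e = (x, u))" using assms(2) by (intro exI[of _ "(x, u)"]) simp
  next
    fix e and n :: nat assume e: "adj (fst e) (snd e) \<and> (n = 0 \<longrightarrow> e = (x, u))"
    obtain c where "adj (snd e) c" "hs c (snd e) \<subset> hs (snd e) (fst e)" using straight_step[OF assms(1)] e by blast
    then show "\<exists>e'. (adj (fst e') (snd e') \<and> (Suc n = 0 \<longrightarrow> e' = (x, u))) \<and>
      (fst e' = snd e \<and> hs (snd e') (fst e') \<subset> hs (snd e) (fst e))" by (intro exI[of _ "(snd e, c)"]) simp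
  qed
  then obtain e where e: "\<forall>n. (adj (fst (e n)) (snd (e n)) \<and> (n = 0 \<longrightarrow> e n = (x, u))) \<and>
      (fst (e (Suc n)) = snd (e n) \<and> hs (snd (e (Suc n))) (fst (e (Suc n))) \<subset> hs (snd (e n)) (fst (e n)))" ..
  define v where "v n = fst (e n)" for n
  have v: "v (Suc n) = snd (e n)" for n using e unfolding v_def by simp
  define M where "M n = hs (v (Suc n)) (v n)" for n
  have adj: "adj (v n) (v (Suc n))" for n using e unfolding v v_def by simp
  have Ms: "M (Suc n) \<subset> M n" for n using e unfolding M_def v[of "Suc n"] v[of n] v_def by (metis)
  have v0: "v 0 = x" "v 1 = u" using e v[of 0] unfolding v_def by auto
  have Mh: "M n \<in> hss" for n unfolding M_def using hs_halfspace adj_sym[OF adj] by blast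
  have chain: "j < i \<Longrightarrow> M i \<subset> M j" for i j using chain_strict[of M j i, OF Ms] .
  have Vv: "v i \<in> V" for i using adj adj_verts by blast
  have "i \<le> d (v 0) (v i)" for i
  proof -
    have sub: "M ` {..<i} \<subseteq> {h \<in> hss. v i \<in> h \<and> v 0 \<notin> h}"
    proof
      fix h assume "h \<in> M ` {..<i}"
      then obtain j where j: "h = M j" "j < i" by blast
      have si: "Suc (i - 1) = i" using j(2) by simp
      have "v i \<in> M (i - 1)" unfolding M_def using hs_ends(1)[OF adj_sym[OF adj[of "i - 1"]]] unfolding si .
      moreover have "M (i - 1) \<subseteq> M j"
      proof (cases "j = i - 1")
        case False
        then have "j < i - 1" using j(2) by linarith
        then show ?thesis using chain[of j "i - 1"] by blast
      qed simp
      moreover have "v 0 \<notin> M 0" unfolding M_def using hs_ends(2)[OF adj_sym[OF adj]] by simp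
      moreover have "M j \<subseteq> M 0" using chain[of 0 j] by (cases "j = 0") auto
      ultimately show "h \<in> {h \<in> hss. v i \<in> h \<and> v 0 \<notin> h}" using j Mh by blast
    qed
    have "inj_on M {..<i}" using chain by (intro inj_onI) (metis linorder_neqE_nat psubsetE)
    then have "i = card (M ` {..<i})" by (simp add: card_image)
    also have "\<dots> \<le> card {h \<in> hss. v i \<in> h \<and> v 0 \<notin> h}" by (rule card_mono[OF _ sub]) (use sep_finite[OF Vv Vv] in blast)
    also have "\<dots> = d (v i) (v 0)" by (rule sep_card[OF Vv Vv])
    finally show ?thesis using d_sym by metis
  qed
  moreover have "d (v 0) (v i) \<le> i" for i using adj_chain[of v 0 i] adj by simp
  ultimately have geo: "d (v 0) (v i) = i" for i using le_antisym by blast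
  have "M i \<subseteq> hs u x" for i
  proof -
    have "M i \<subseteq> M 0" using chain[of 0 i] by (cases "i = 0") auto
    then show ?thesis unfolding M_def using v0 by simp
  qed
  then show ?thesis using that[of v] v0 adj geo unfolding M_def by blast
qed

text \<open>
  The members of \<open>H\<close> below which no boundary point of the basic open set of \<open>H\<close> descends.
\<close>

definition forced_min :: "'v set set \<Rightarrow> 'v set set" where
  "forced_min H = {t \<in> H. \<forall>\<beta>\<in>bdry. H \<subseteq> \<beta> \<longrightarrow> minimal_in \<beta> t}"

text \<open>
  If \<open>s\<close> and \<open>h\<close> have disjoint complements, these are the halfspaces between the two hyperplanes,
  including both ends.
\<close>

definition btw :: "'v set \<Rightarrow> 'v set \<Rightarrow> 'v set set" where
  "btw s h = {m \<in> hss. V - s \<subseteq> m \<and> m \<subseteq> h}"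

lemma btw_finite: assumes "s \<in> hss" "h \<in> hss" shows "finite (btw s h)"
proof -
  obtain p q where pq: "p \<in> V - s" "q \<in> V - h" using halfspace_ne_compl assms by blast
  have "btw s h \<subseteq> {m \<in> hss. p \<in> m \<and> q \<notin> m}" unfolding btw_def using pq by blast
  then show ?thesis using sep_finite[of p q] pq finite_subset by blast
qed

lemma forced_min_sub: "forced_min H \<subseteq> H" unfolding forced_min_def by blast

lemma forced_min_mono: assumes "\<And>\<beta>. \<beta> \<in> bdry \<Longrightarrow> H' \<subseteq> \<beta> \<Longrightarrow> H \<subseteq> \<beta>" "t \<in> forced_min H" "t \<in> H'" shows "t \<in> forced_min H'"
  using assms unfolding forced_min_def by blast

definition locally_terminal :: "'v set set \<Rightarrow> bool" where
  "locally_terminal H \<longleftrightarrow> finite H \<and> H \<subseteq> hss \<and> meets H \<and> forced_min H \<noteq> {}"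

lemma not_deepening_locally_terminal: assumes "\<not> deepening" shows "\<exists>H. locally_terminal H"
proof -
  obtain S t where S: "finite S" "S \<subseteq> hss" "meets S" "t \<in> S" "\<And>k. k \<in> hss \<Longrightarrow> k \<subset> t \<Longrightarrow> \<not> meets (insert k S)"
    using assms unfolding deepening_def by blast
  have "t \<in> forced_min S" unfolding forced_min_def
  proof (intro CollectI conjI ballI impI)
    fix \<beta> assume b: "\<beta> \<in> bdry" "S \<subseteq> \<beta>"
    show "minimal_in \<beta> t" unfolding minimal_in_def
    proof (intro conjI ballI notI)
      fix h assume h: "h \<in> \<beta>" "h \<subset> t"
      have "meets (insert h S)" unfolding meets_def using b h by blast
      then show False using S(5) h uf_halfspace[OF bdry_uf[OF b(1)]] by blast
    qed (use S b in blast)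
  qed (rule S(4))
  then show ?thesis using S unfolding locally_terminal_def by blast
qed

text \<open>
  Minimise lexicographically the size of \<open>H\<close>, the number of members that are not forced to be
  minimal, and the total distance between hyperplanes, counted by \<open>btw\<close>. Suppose that \<open>s\<close>, not
  forced to be minimal, does not cross \<open>h\<close>. If one contains the other, the larger one is implied
  and can be dropped. If their complements are disjoint, replacing \<open>s\<close> by a halfspace \<open>n\<close> strictly
  below it in a suitable boundary point moves it closer to \<open>h\<close>.
\<close>

lemma locally_terminal_minimal:
  assumes "locally_terminal H0"
  obtains H where "locally_terminal H" "\<And>s h. s \<in> H - forced_min H \<Longrightarrow> h \<in> H \<Longrightarrow> h \<noteq> s \<Longrightarrow> cross s h"
proof -
  define \<mu> where "\<mu> H = (\<Sum>(s, h)\<in>H \<times> H. card (btw s h))" for H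
  let ?r = "inv_image (less_than <*lex*> less_than <*lex*> less_than) (\<lambda>H. (card H, card (H - forced_min H), \<mu> H))"
  have wf: "wf ?r" by (intro wf_inv_image wf_lex_prod wf_less_than)
  obtain H where H: "locally_terminal H" and min: "\<And>H'. (H', H) \<in> ?r \<Longrightarrow> \<not> locally_terminal H'"
    using wfE_min[OF wf, of H0 "{H. locally_terminal H}"] assms by auto
  have fin: "finite H" and Hh: "H \<subseteq> hss" and mH: "meets H" and TH: "forced_min H \<noteq> {}" using H unfolding locally_terminal_def by auto
  have "cross s h" if s: "s \<in> H - forced_min H" and h: "h \<in> H" "h \<noteq> s" for s h
  proof (rule ccontr)
    assume nc: "\<not> cross s h"
    have sh: "s \<in> hss" "h \<in> hss" "s \<in> H" using s h Hh by auto
    obtain \<beta> where b: "\<beta> \<in> bdry" "H \<subseteq> \<beta>" "\<not> minimal_in \<beta> s" using s unfolding forced_min_def by blast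
    note bu = bdry_uf[OF b(1)]
    obtain n where n: "n \<in> \<beta>" "n \<subset> s" using b sh(3) unfolding minimal_in_def by blast
    have nh: "n \<in> hss" using uf_halfspace[OF bu n(1)] .
    have drop: False if x: "x \<in> H" "y \<in> H" "y \<subset> x" and Tx: "x \<notin> forced_min H" for x y
    proof -
      let ?H = "H - {x}"
      have up: "H \<subseteq> \<gamma>" if g: "\<gamma> \<in> bdry" "?H \<subseteq> \<gamma>" for \<gamma>
      proof -
        have "y \<in> \<gamma>" using g x by blast
        then have "x \<in> \<gamma>" using uf_up[OF bdry_uf[OF g(1)]] x Hh by blast
        then show ?thesis using g by blast
      qed
      have "forced_min H \<subseteq> forced_min ?H" using forced_min_mono[OF up] forced_min_sub[of H] Tx by blast
      then have "locally_terminal ?H" unfolding locally_terminal_def using fin Hh meets_mono[OF mH] TH by blast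
      moreover have "card ?H < card H" using fin x(1) by (rule card_Diff1_less)
      ultimately show False using min[of ?H] by simp
    qed
    show False using not_cross[OF nc halfspace_sub[OF sh(1)] halfspace_sub[OF sh(2)]]
    proof cases
      case 1 then show False using uf_meet[OF bu] b(2) sh(3) h(1) by blast
    next
      case 2
      then have sub: "s \<subset> h" using h(2) by blast
      have "h \<notin> forced_min H"
      proof
        assume "h \<in> forced_min H"
        then have "minimal_in \<beta> h" using b unfolding forced_min_def by blast
        then show False using sub b(2) sh(3) unfolding minimal_in_def by blast
      qed
      then show False using drop[OF h(1) sh(3) sub] by blast
    next
      case 3
      then have "h \<subset> s" using h(2) by blast
      then show False using drop[OF sh(3) h(1)] s by blast
    next
      case 4
      let ?H = "insert n (H - {s})"
      have up: "H \<subseteq> \<gamma>" if g: "\<gamma> \<in> bdry" "?H \<subseteq> \<gamma>" for \<gamma>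
      proof -
        have "s \<in> \<gamma>" using uf_up[OF bdry_uf[OF g(1)], of n s] g n sh by blast
        then show ?thesis using g by blast
      qed
      have Tsub: "forced_min H \<subseteq> forced_min ?H" using forced_min_mono[OF up] forced_min_sub[of H] s by blast
      have "meets ?H" unfolding meets_def using b n by blast
      then have ok: "locally_terminal ?H" unfolding locally_terminal_def using fin Hh nh Tsub TH by blast
      have c1: "card ?H \<le> card H"
      proof -
        have "card ?H \<le> Suc (card (H - {s}))" by (rule card_insert_le_m1) (use fin in auto)
        then show ?thesis using card_Suc_Diff1[OF fin sh(3)] by simp
      qed
      have c1': "card ?H = card H" using c1 min[of ?H] ok by fastforce
      have nH: "n \<notin> H - {s}"
      proof
        assume "n \<in> H - {s}"
        then have "?H = H - {s}" by blast
        then show False using c1' card_Diff1_less[OF fin sh(3)] by simp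
      qed
      have c2: "card (?H - forced_min ?H) \<le> card (H - forced_min H)"
      proof -
        have "?H - forced_min ?H \<subseteq> insert n (H - forced_min H - {s})" using Tsub by blast
        then have "card (?H - forced_min ?H) \<le> card (insert n (H - forced_min H - {s}))" by (rule card_mono[rotated]) (use fin in auto)
        also have "\<dots> \<le> Suc (card (H - forced_min H - {s}))" by (rule card_insert_le_m1) (use fin in auto)
        also have "\<dots> = card (H - forced_min H)" by (rule card_Suc_Diff1) (use fin s in auto)
        finally show ?thesis .
      qed
      then have c2': "card (?H - forced_min ?H) = card (H - forced_min H)" using c1' min[of ?H] ok by fastforce
      \<comment> \<open>\<open>r\<close> undoes the replacement of \<open>s\<close> by \<open>n\<close>; it compares the two sums term by term\<close>
      define r where "r x = (if x = n then s else x)" for x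
      have ri: "inj_on r ?H" unfolding r_def inj_on_def using nH by auto
      have rim: "r ` ?H = H" unfolding r_def using nH sh(3) by auto
      have rx: "x \<subseteq> r x" for x unfolding r_def using n by auto
      have bsub: "btw x y \<subseteq> btw (r x) (r y)" for x y unfolding btw_def using rx[of x] rx[of y] by blast
      have bfin: "finite (btw (r x) (r y))" if "x \<in> ?H" "y \<in> ?H" for x y
        using btw_finite[of "r x" "r y"] that rim Hh by blast
      \<comment> \<open>the term for \<open>(s, h)\<close> drops, because \<open>V - s\<close> contains the complement of \<open>s\<close> but not that of \<open>n\<close>\<close>
      have "V - s \<in> btw s h" unfolding btw_def using 4 halfspace_compl sh by blast
      moreover have "V - s \<notin> btw n h" unfolding btw_def using n(2) halfspace_sub[OF sh(1)] by blast
      moreover have "r n = s" "r h = h" unfolding r_def using nH h by auto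
      ultimately have strict: "btw n h \<subset> btw (r n) (r h)" using bsub[of n h] by auto
      have "\<mu> ?H < (\<Sum>(x, y)\<in>?H \<times> ?H. card (btw (r x) (r y)))"
        unfolding \<mu>_def
      proof (rule sum_strict_mono_ex1)
        show "finite (?H \<times> ?H)" using fin by simp
        show "\<forall>z\<in>?H \<times> ?H. (case z of (s, h) \<Rightarrow> card (btw s h)) \<le> (case z of (x, y) \<Rightarrow> card (btw (r x) (r y)))"
        proof
          fix z assume "z \<in> ?H \<times> ?H"
          then obtain x y where z: "z = (x, y)" "x \<in> ?H" "y \<in> ?H" by (elim SigmaE)
          show "(case z of (s, h) \<Rightarrow> card (btw s h)) \<le> (case z of (x, y) \<Rightarrow> card (btw (r x) (r y)))"
            unfolding z(1) using card_mono[OF bfin[OF z(2,3)] bsub] by simp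
        qed
        have "card (btw n h) < card (btw (r n) (r h))"
          by (rule psubset_card_mono[OF bfin strict]) (use h in auto)
        then show "\<exists>z\<in>?H \<times> ?H. (case z of (s, h) \<Rightarrow> card (btw s h)) < (case z of (x, y) \<Rightarrow> card (btw (r x) (r y)))"
          using h by (intro bexI[of _ "(n, h)"]) auto
      qed
      also have "\<dots> = \<mu> H"
      proof -
        have "bij_betw (map_prod r r) (?H \<times> ?H) (H \<times> H)"
          using bij_betw_map_prod[of r ?H H r ?H H] ri rim unfolding bij_betw_def by blast
        from sum.reindex_bij_betw[OF this, of "\<lambda>(x, y). card (btw x y)"]
        show ?thesis unfolding \<mu>_def by (simp add: case_prod_unfold)
      qed
      finally show False using min[of ?H] ok c1' c2' by simp
    qed
  qed
  then show ?thesis using that H by blast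
qed

text \<open>
  Finitely many members of a descending chain of \<open>\<alpha>\<close> may be added to \<open>S\<close>, so the core contains
  points arbitrarily deep in the chain.
\<close>

lemma minimal_core_unbounded:
  assumes "\<alpha> \<in> bdry" "finite S" "finite T" "S \<subseteq> \<alpha>" "\<And>t. t \<in> T \<Longrightarrow> minimal_in \<alpha> t"
  shows "unbounded_cc X (core X S T)"
  unfolding unbounded_cc_def
proof
  fix n
  note au = bdry_uf[OF assms(1)]
  have "\<exists>y\<in>V. (\<forall>t\<in>T. y \<in> car t) \<and> (\<forall>s\<in>S. y \<in> s)" by (rule uf_helly[OF au assms(3,2,5,4)])
  then obtain y where y: "y \<in> core X S T" "y \<in> V" unfolding core_mem by blast
  obtain c :: "nat \<Rightarrow> 'v set" where c: "\<And>n. c n \<in> \<alpha>" "\<And>n. c (Suc n) \<subset> c n"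
    by (rule bdry_chain[OF assms(1)]) (rule that; assumption)
  have ch: "c n \<in> hss" for n using uf_halfspace[OF au c(1)] .
  obtain i where i: "y \<notin> c i" using chain_leaves[of c y, OF ch c(2) y(2)] by blast
  have st: "j < k \<Longrightarrow> c k \<subset> c j" for j k using chain_strict[of c j k, OF c(2)] .
  let ?A = "c ` {i..i+n}"
  have "\<exists>z\<in>V. (\<forall>t\<in>T. z \<in> car t) \<and> (\<forall>s\<in>S \<union> ?A. z \<in> s)" by (rule uf_helly[OF au assms(3)]) (use assms c in auto)
  then obtain z where z0: "z \<in> V" "\<forall>t\<in>T. z \<in> car t" "\<forall>s\<in>S \<union> ?A. z \<in> s" by (elim bexE conjE)
  have z: "z \<in> core X S T" "z \<in> V" "\<And>a. a \<in> ?A \<Longrightarrow> z \<in> a" using z0 unfolding core_mem by simp_all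
  have sub: "?A \<subseteq> {h \<in> hss. z \<in> h \<and> y \<notin> h}"
  proof
    fix a assume a: "a \<in> ?A"
    then obtain j where j: "a = c j" "i \<le> j" by auto
    have "c j \<subseteq> c i" using st[of i j] j(2) by (cases "i = j") auto
    then show "a \<in> {h \<in> hss. z \<in> h \<and> y \<notin> h}" using i j(1) ch z(3)[OF a] by blast
  qed
  have "inj_on c {i..i+n}" using st by (intro inj_onI) (metis linorder_neqE_nat psubsetE)
  then have "Suc n = card ?A" by (simp add: card_image)
  also have "\<dots> \<le> card {h \<in> hss. z \<in> h \<and> y \<notin> h}" by (rule card_mono[OF _ sub]) (use sep_finite[OF z(2) y(2)] in blast)
  also have "\<dots> = d z y" by (rule sep_card[OF z(2) y(2)])
  finally have "n < d z y" by simp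
  then show "\<exists>v\<in>core X S T. \<exists>w\<in>core X S T. n < d v w" using z(1) y(1) by blast
qed

text \<open>
  Take \<open>H\<close> as in \<open>locally_terminal_minimal\<close>, and \<open>T\<close> the forced minimal members. Suppose that an
  edge \<open>{x, u}\<close> at the core is dual to a hyperplane not bounding any member of \<open>H\<close> and disjoint
  from that of some \<open>t \<in> T\<close>. Then its far side \<open>?m\<close> lies in \<open>t\<close>. A straight ray through the edge
  never leaves a member of \<open>H\<close>, so its limit contains \<open>H\<close> and also \<open>?m\<close>, contradicting minimality
  of \<open>t\<close>. Straight links also provide the second member of \<open>T\<close>.
\<close>

lemma straight_tight_cage:
  assumes "straight_links X" "\<not> deepening"
  shows "\<exists>S T. tight_cage X S T"
proof -
  obtain H0 where "locally_terminal H0" using not_deepening_locally_terminal[OF assms(2)] by blast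
  then obtain H where H: "locally_terminal H" and cr: "\<And>s h. s \<in> H - forced_min H \<Longrightarrow> h \<in> H \<Longrightarrow> h \<noteq> s \<Longrightarrow> cross s h"
    by (rule locally_terminal_minimal) (rule that; assumption)
  have fin: "finite H" and Hh: "H \<subseteq> hss" and mH: "meets H" and TH: "forced_min H \<noteq> {}" using H unfolding locally_terminal_def by auto
  let ?T = "forced_min H" and ?S = "H - forced_min H"
  let ?Y = "core X ?S ?T"
  have TS: "?T \<subseteq> H" "?S \<union> ?T = H" using forced_min_sub by auto
  obtain \<alpha> where a: "\<alpha> \<in> bdry" "H \<subseteq> \<alpha>" using mH unfolding meets_def by blast
  have finT: "finite ?T" "finite ?S" using fin TS finite_subset by auto
  have unb: "unbounded_cc X ?Y"
    by (rule minimal_core_unbounded[OF a(1) finT(2,1)]) (use a TS in \<open>auto simp: forced_min_def\<close>)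
  have YH: "x \<in> h" if "x \<in> ?Y" "h \<in> H" for x h
    using that car_sub Hh unfolding core_mem by blast
  have ii: "hyps_meet X (bounding_hyp X s) (bounding_hyp X h)" if "s \<in> ?S" "h \<in> ?S \<union> ?T" for s h
    using hyps_meet_iff[of s h] cr[of s h] that Hh TS by blast
  have iv: "bounding_hyp X (hs u x) \<in> bounding_hyp X ` H \<or> (\<forall>t\<in>?T. hyps_meet X (bounding_hyp X (hs u x)) (bounding_hyp X t))"
    if x: "x \<in> ?Y" "adj x u" for x u
  proof (rule ccontr)
    assume no: "\<not> ?thesis"
    let ?m = "hs u x"
    have m: "?m \<in> hss" using hs_halfspace adj_sym[OF x(2)] by blast
    have nb: "?m \<noteq> h \<and> ?m \<noteq> V - h" if "h \<in> H" for h
    proof -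
      have "bounding_hyp X ?m \<noteq> bounding_hyp X h" using no that by blast
      then show ?thesis using bounding_eq_iff[OF m, of h] Hh that by blast
    qed
    obtain t where t: "t \<in> ?T" "\<not> hyps_meet X (bounding_hyp X ?m) (bounding_hyp X t)" using no by blast
    have tH: "t \<in> H" "t \<in> hss" using t TS Hh by auto
    have nc: "\<not> cross ?m t" using t(2) hyps_meet_iff[OF m tH(2)] by blast
    \<comment> \<open>\<open>?m\<close> differs from both sides of every \<open>h\<close> in \<open>H\<close>, so no edge at \<open>x\<close> leaves \<open>h\<close> and enters \<open>?m\<close>\<close>
    have bar: "y \<notin> ?m" if h: "h \<in> H" "x \<in> h" "adj x y" "y \<notin> h" for h y
    proof
      assume "y \<in> ?m"
      moreover have "x \<notin> ?m" using hs_ends(2)[OF adj_sym[OF x(2)]] .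
      ultimately have "?m = hs y x" using hs_eqI[OF m adj_sym[OF h(3)]] by blast
      moreover have "h = hs x y" using hs_eqI[OF _ h(3,2,4)] h(1) Hh by blast
      ultimately have "?m = V - h" using hs_compl[OF h(3)] by simp
      then show False using nb[OF h(1)] by blast
    qed
    have stay: "u \<in> t"
    proof (rule ccontr)
      assume "u \<notin> t"
      then have "u \<notin> ?m" using bar[OF tH(1) YH[OF x(1) tH(1)] x(2)] by blast
      then show False using hs_ends(1)[OF adj_sym[OF x(2)]] by blast
    qed
    have "x \<in> car t" using x(1) t(1) unfolding core_mem by blast
    then obtain y where y: "adj x y" "y \<notin> t" using car_iff[OF tH(2)] by blast
    have "y \<notin> ?m" using bar[OF tH(1) YH[OF x(1) tH(1)] y] .
    moreover have "u \<in> ?m" "x \<notin> ?m" using hs_ends[OF adj_sym[OF x(2)]] by auto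
    ultimately have mt: "?m \<subset> t" using nc stay y YH[OF x(1) tH(1)] adj_verts[OF y(1)] unfolding cross_def by blast
    obtain v :: "nat \<Rightarrow> 'v" where v: "v 0 = x" "v 1 = u" and va: "\<And>i. adj (v i) (v (Suc i))" and vd: "\<And>i. d (v 0) (v i) = i"
      and vm: "\<And>i. hs (v (Suc i)) (v i) \<subseteq> hs u x"
      by (rule straight_ray[OF assms(1) x(2)]) (rule that; assumption)
    let ?\<gamma> = "{h \<in> hss. \<exists>N. \<forall>i\<ge>N. v i \<in> h}"
    have g: "?\<gamma> \<in> bdry" using adj_ray_limit[of v, OF va vd] .
    have vh: "v i \<in> h" if h: "h \<in> H" for h i
    proof (induction i)
      case 0 then show ?case using v(1) YH[OF x(1) h] by simp
    next
      case (Suc i)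
      show ?case
      proof (rule ccontr)
        assume n: "v (Suc i) \<notin> h"
        have "h = hs (v i) (v (Suc i))" using hs_eqI[OF _ va Suc n] h Hh by blast
        then have "V - h = hs (v (Suc i)) (v i)" using hs_compl[OF va] by simp
        then have sub: "V - h \<subseteq> ?m" using vm[of i] by simp
        show False
        proof (cases "h \<in> ?T")
          case True
          then have "x \<in> car h" using x(1) unfolding core_mem by blast
          then obtain y where y: "adj x y" "y \<notin> h" using car_iff[of h] h Hh by blast
          then have "y \<in> ?m" using sub adj_verts by blast
          then show False using bar[OF h YH[OF x(1) h] y] by blast
        next
          case False
          then have "cross h t" using cr[of h t] h tH t(1) by blast
          then show False using sub mt unfolding cross_def by blast
        qed
      qed
    qed
    have "H \<subseteq> ?\<gamma>" using vh Hh by blast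
    then have tm: "minimal_in ?\<gamma> t" using t(1) g unfolding forced_min_def by blast
    have "v i \<in> ?m" if "i \<ge> 1" for i
    proof -
      obtain j where "i = Suc j" using \<open>i \<ge> 1\<close> by (cases i) auto
      then show ?thesis using vm[of j] hs_ends(1)[OF adj_sym[OF va[of j]]] by auto
    qed
    then have "?m \<in> ?\<gamma>" using m by blast
    then show False using tm mt unfolding minimal_in_def by blast
  qed
  have card2: "2 \<le> card ?T"
  proof -
    obtain t where t: "t \<in> ?T" using TH by blast
    have th: "t \<in> hss" using t TS Hh by blast
    have "?Y \<noteq> {}" using unbounded_infinite[OF unb] by auto
    then obtain y where y: "y \<in> ?Y" by blast
    then have "y \<in> car t" using t unfolding core_mem by blast
    then obtain z where z: "y \<in> t" "adj y z" "z \<notin> t" using car_iff[OF th] by blast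
    have tz: "t = hs y z" using hs_eqI[OF th z(2,1,3)] .
    obtain u where u: "adj y u" "\<not> hyps_meet X (bounding_hyp X (hs y z)) (bounding_hyp X (hs u y))"
      using straight_edge[OF assms(1) z(2)] by blast
    have nm: "\<not> hyps_meet X (bounding_hyp X (hs u y)) (bounding_hyp X t)" using u(2) hyps_meet_sym tz by blast
    from iv[OF y u(1)] nm t have "bounding_hyp X (hs u y) \<in> bounding_hyp X ` H" by blast
    then obtain h where h: "h \<in> H" "bounding_hyp X (hs u y) = bounding_hyp X h" by blast
    have "h \<in> ?T" using ii[of h t] h nm t by auto
    moreover have "h \<noteq> t" using nm h(2) hyps_meet_iff[OF th th] by auto
    ultimately have "{h, t} \<subseteq> ?T" "card {h, t} = 2" using t by auto
    then show ?thesis using card_mono[OF finT(1)] by metis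
  qed
  have "tight_cage X ?S ?T" unfolding tight_cage_def
  proof (intro conjI ballI impI)
    fix e assume e: "e \<in> cc_edges X" "e \<inter> ?Y \<noteq> {}"
    obtain p q where pq: "e = {p, q}" "adj p q" using edge_obtain[OF e(1)] by blast
    obtain x u where xu: "e = {x, u}" "x \<in> ?Y" "adj x u"
    proof (cases "p \<in> ?Y")
      case True then show ?thesis using that pq by blast
    next
      case False
      then have "q \<in> ?Y" using e(2) pq by blast
      then show ?thesis using that[of q p] pq adj_sym by (simp add: insert_commute)
    qed
    show "dual_hyp X e \<in> bounding_hyp X ` (?S \<union> ?T) \<or> (\<forall>t\<in>?T. hyps_meet X (dual_hyp X e) (bounding_hyp X t))"
      unfolding xu(1) dual_hyp_eq_far[OF xu(3)] TS(2) using iv[OF xu(2,3)] .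
  qed (use finT Hh TS card2 ii unb in auto)
  then show ?thesis by blast
qed

end

section \<open>Minimal families with no hyperplane inside\<close>

context cat0_cocompact begin

lemma nonterm_chain:
  assumes "non_terminating \<beta>" "h \<in> \<beta>"
  obtains c :: "nat \<Rightarrow> 'v set" where "c 0 = h" "\<And>n. c n \<in> \<beta>" "\<And>n. c (Suc n) \<subset> c n"
proof -
  have "\<exists>c. \<forall>n. (c n \<in> \<beta> \<and> (n = 0 \<longrightarrow> c n = h)) \<and> c (Suc n) \<subset> c n"
  proof (rule dependent_nat_choice)
    show "\<exists>x. x \<in> \<beta> \<and> ((0::nat) = 0 \<longrightarrow> x = h)" using assms(2) by blast
  next
    fix x and n :: nat assume "x \<in> \<beta> \<and> (n = 0 \<longrightarrow> x = h)"
    then obtain y where "y \<in> \<beta>" "y \<subset> x" using assms(1) unfolding non_terminating_def by blast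
    then show "\<exists>y. (y \<in> \<beta> \<and> (Suc n = 0 \<longrightarrow> y = h)) \<and> y \<subset> x" by (intro exI[of _ y]) simp
  qed
  then obtain c where c: "\<forall>n. (c n \<in> \<beta> \<and> (n = 0 \<longrightarrow> c n = h)) \<and> c (Suc n) \<subset> c n" ..
  show ?thesis by (rule that[of c]) (use c in auto)
qed

lemma nonterm_avoid:
  assumes "\<beta> \<in> uf" "non_terminating \<beta>" "h \<in> \<beta>" "finite P" "P \<subseteq> V"
  obtains k where "k \<in> \<beta>" "k \<subset> h" "k \<inter> P = {}"
proof -
  obtain c :: "nat \<Rightarrow> 'v set" where c: "c 0 = h" "\<And>n. c n \<in> \<beta>" "\<And>n. c (Suc n) \<subset> c n"
    by (rule nonterm_chain[OF assms(2,3)]) (rule that; assumption)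
  have ch: "c n \<in> hss" for n using uf_halfspace[OF assms(1) c(2)] .
  have st: "i < j \<Longrightarrow> c j \<subset> c i" for i j using chain_strict[of c i j, OF c(3)] .
  have "\<forall>p\<in>P. \<exists>n. p \<notin> c n" using chain_leaves[of c, OF ch c(3)] assms(5) by blast
  then obtain f where f: "\<forall>p\<in>P. p \<notin> c (f p)" by (rule bchoice[THEN exE])
  let ?N = "Suc (\<Sum>p\<in>P. f p)"
  have "p \<notin> c ?N" if p: "p \<in> P" for p
  proof -
    have "f p \<le> (\<Sum>p\<in>P. f p)" using member_le_sum[OF p, of f] assms(4) by simp
    then have "c ?N \<subset> c (f p)" using st by simp
    then show ?thesis using f p by blast
  qed
  then have "c ?N \<inter> P = {}" by blast
  moreover have "c ?N \<subset> h" using st[of 0 ?N] c(1) by simp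
  ultimately show ?thesis using that c(2) by blast
qed

text \<open>
  A finite set that witnesses the failure of \<open>hyp_dense\<close>.
\<close>

definition bad :: "'v set set \<Rightarrow> bool" where
  "bad H \<longleftrightarrow> finite H \<and> H \<subseteq> hss \<and> meets H \<and> \<not> (\<exists>k\<in>hss. \<forall>h\<in>H. inside k h)"

lemma inside_sub: "inside x h \<Longrightarrow> h \<subseteq> k \<Longrightarrow> inside x k" unfolding inside_def by blast

text \<open>
  Replacing \<open>h\<close> by \<open>k\<close> keeps \<open>H\<close> bad and makes every member above \<open>k\<close> superfluous, so by
  minimality \<open>k\<close> lies below no \<open>r\<close> other than \<open>h\<close>; if \<open>r\<close> lay below \<open>k\<close>, then \<open>h\<close> itself would be
  superfluous.
\<close>

lemma minimal_bad_cross: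
  assumes "bad H" "\<And>H'. bad H' \<Longrightarrow> card H \<le> card H'" "\<beta> \<in> bdry" "H \<subseteq> \<beta>"
    "h \<in> H" "k \<in> \<beta>" "k \<subset> h" "\<And>r. r \<in> H \<Longrightarrow> \<not> V - r \<subseteq> k" "r \<in> H" "r \<noteq> h"
  shows "cross k r"
proof (rule ccontr)
  assume nc: "\<not> cross k r"
  note bu = bdry_uf[OF assms(3)]
  have fin: "finite H" and Hh: "H \<subseteq> hss" and no: "\<And>x. x \<in> hss \<Longrightarrow> \<exists>h\<in>H. \<not> inside x h"
    using assms(1) unfolding bad_def by blast+
  have kh: "k \<in> hss" "r \<in> hss" using uf_halfspace[OF bu] assms by blast+
  show False using not_cross[OF nc halfspace_sub[OF kh(1)] halfspace_sub[OF kh(2)]]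
  proof cases
    case 1 then show False using uf_meet[OF bu assms(6)] assms(4,9) by blast
  next
    case 2
    let ?R = "{s \<in> H. \<not> k \<subseteq> s}"
    have "?R \<subseteq> H - {h} - {r}" using 2 assms(7) by blast
    then have "card ?R \<le> card (H - {h} - {r})" by (rule card_mono[rotated]) (use fin in auto)
    moreover have "card (H - {h} - {r}) < card (H - {h})" by (rule card_Diff1_less) (use fin assms in auto)
    moreover have "card (H - {h}) < card H" by (rule card_Diff1_less) (use fin assms in auto)
    moreover have "card (insert k ?R) \<le> Suc (card ?R)" by (rule card_insert_le_m1) (use fin in auto)
    ultimately have lt: "card (insert k ?R) < card H" by linarith
    have "meets (insert k ?R)" unfolding meets_def using assms(3,4,6) by blast
    moreover have "\<not> (\<exists>x\<in>hss. \<forall>s\<in>insert k ?R. inside x s)"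
    proof
      assume "\<exists>x\<in>hss. \<forall>s\<in>insert k ?R. inside x s"
      then obtain x where x: "x \<in> hss" "inside x k" "\<And>s. s \<in> ?R \<Longrightarrow> inside x s" by blast
      have "inside x s" if "s \<in> H" for s using x(2,3) inside_sub that by blast
      then show False using no[OF x(1)] by blast
    qed
    ultimately have "bad (insert k ?R)" unfolding bad_def using fin Hh kh by auto
    then show False using assms(2) lt by fastforce
  next
    case 3
    have "r \<subseteq> h" using 3 assms(7) by blast
    have "meets (H - {h})" unfolding meets_def using assms(3,4) by blast
    moreover have "\<not> (\<exists>x\<in>hss. \<forall>s\<in>H - {h}. inside x s)"
    proof
      assume "\<exists>x\<in>hss. \<forall>s\<in>H - {h}. inside x s"
      then obtain x where x: "x \<in> hss" "\<And>s. s \<in> H - {h} \<Longrightarrow> inside x s" by blast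
      have "inside x h" using x(2)[of r] assms(9,10) inside_sub \<open>r \<subseteq> h\<close> by blast
      then have "inside x s" if "s \<in> H" for s using x(2) that by blast
      then show False using no[OF x(1)] by blast
    qed
    ultimately have "bad (H - {h})" unfolding bad_def using fin Hh by auto
    moreover have "card (H - {h}) < card H" by (rule card_Diff1_less) (use fin assms in auto)
    ultimately show False using assms(2) by fastforce
  next
    case 4
    then have "V - r \<subseteq> k" using halfspace_sub[OF kh(2)] by blast
    then show False using assms(8,9) by blast
  qed
qed

text \<open>
  Replace each \<open>h\<close> by a member \<open>f h\<close> of \<open>\<beta>\<close> below \<open>h\<close> that is so deep that it crosses all other
  members of \<open>H\<close>. Any nesting between \<open>f h\<close> and \<open>f r\<close> would contradict the crossing of \<open>f h\<close> with
  \<open>r\<close> or of \<open>f r\<close> with \<open>h\<close>.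
\<close>

lemma minimal_bad_pairwise_cross:
  assumes "nonterm_dense" "bad H0"
  obtains H \<beta> where "bad H" "\<And>H'. bad H' \<Longrightarrow> card H \<le> card H'" "\<beta> \<in> bdry" "non_terminating \<beta>" "H \<subseteq> \<beta>"
    "\<And>h h'. h \<in> H \<Longrightarrow> h' \<in> H \<Longrightarrow> h \<noteq> h' \<Longrightarrow> cross h h'"
proof -
  obtain H where H: "bad H" and min: "\<And>H'. bad H' \<Longrightarrow> card H \<le> card H'"
    using ex_has_least_nat[of bad H0 card] assms(2) by auto
  have fin: "finite H" and Hh: "H \<subseteq> hss" and mH: "meets H" and no: "\<And>x. x \<in> hss \<Longrightarrow> \<exists>h\<in>H. \<not> inside x h"
    using H unfolding bad_def by blast+
  obtain \<beta> where b: "\<beta> \<in> bdry" "non_terminating \<beta>" "H \<subseteq> \<beta>"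
    using assms(1)[unfolded nonterm_dense_def, rule_format, of H] fin Hh mH by auto
  note bu = bdry_uf[OF b(1)]
  \<comment> \<open>the points \<open>p s\<close> prevent a deep halfspace from containing the complement of a member of \<open>H\<close>\<close>
  obtain p where p: "\<And>s. s \<in> H \<Longrightarrow> p s \<in> V - s" by (rule pick_outside[OF Hh]) (rule that; assumption)
  have "\<forall>h\<in>H. \<exists>k. k \<in> \<beta> \<and> k \<subset> h \<and> k \<inter> p ` H = {}"
  proof
    fix h assume h: "h \<in> H"
    have "p ` H \<subseteq> V" using p by blast
    then obtain k where "k \<in> \<beta>" "k \<subset> h" "k \<inter> p ` H = {}"
      using nonterm_avoid[OF bu b(2), of h "p ` H"] h b(3) fin by blast
    then show "\<exists>k. k \<in> \<beta> \<and> k \<subset> h \<and> k \<inter> p ` H = {}" by blast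
  qed
  then obtain f where f: "\<forall>h\<in>H. f h \<in> \<beta> \<and> f h \<subset> h \<and> f h \<inter> p ` H = {}" by (rule bchoice[THEN exE])
  have deep: "\<not> V - r \<subseteq> f h" if "h \<in> H" "r \<in> H" for h r using f p[OF that(2)] that by blast
  have cr: "cross (f h) r" if "h \<in> H" "r \<in> H" "r \<noteq> h" for h r
    by (rule minimal_bad_cross[OF H min b(1,3) that(1), of "f h" r]) (use f deep that in auto)
  let ?H = "f ` H"
  have fb: "?H \<subseteq> \<beta>" using f by blast
  have fh: "f h \<in> hss" if "h \<in> H" for h using uf_halfspace[OF bu] f that by blast
  have "meets ?H" unfolding meets_def using b(1) fb by blast
  moreover have "\<not> (\<exists>x\<in>hss. \<forall>s\<in>?H. inside x s)"
  proof
    assume "\<exists>x\<in>hss. \<forall>s\<in>?H. inside x s"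
    then obtain x where x: "x \<in> hss" "\<forall>s\<in>?H. inside x s" by blast
    have "inside x s" if "s \<in> H" for s using x(2) that f inside_sub[of x "f s" s] by blast
    then show False using no[OF x(1)] by blast
  qed
  ultimately have bad: "bad ?H" unfolding bad_def using fin fh by blast
  have min': "card ?H \<le> card H'" if "bad H'" for H' using min[OF that] card_image_le[OF fin, of f] by linarith
  have "cross (f h) (f r)" if hr: "h \<in> H" "r \<in> H" "f h \<noteq> f r" for h r
  proof (rule ccontr)
    assume nc: "\<not> cross (f h) (f r)"
    have ne: "h \<noteq> r" using hr by blast
    have c: "cross (f h) r" "cross (f r) h" using cr hr ne by blast+
    have s: "f h \<subset> h" "f r \<subset> r" "f h \<in> \<beta>" "f r \<in> \<beta>" using f hr by auto
    show False using not_cross[OF nc halfspace_sub[OF fh[OF hr(1)]] halfspace_sub[OF fh[OF hr(2)]]]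
    proof cases
      case 1 then show False using uf_meet[OF bu s(3,4)] by blast
    next
      case 2 then show False using c(1) s(2) unfolding cross_def by blast
    next
      case 3 then show False using c(2) s(1) unfolding cross_def by blast
    next
      case 4 then show False using c(2) s(1) unfolding cross_def by blast
    qed
  qed
  then show ?thesis using that[OF bad min' b(1,2) fb] by blast
qed

text \<open>
  Helly for \<open>C\<close>, \<open>D\<close> and the carrier sides of the members of \<open>R\<close>, which meet pairwise because the
  halfspaces cross.
\<close>

lemma cross_core:
  assumes "finite R" "R \<subseteq> hss" "\<And>r r'. r \<in> R \<Longrightarrow> r' \<in> R \<Longrightarrow> r \<noteq> r' \<Longrightarrow> cross r r'"
    "conv C" "C \<noteq> {}" "\<And>r. r \<in> R \<Longrightarrow> C \<inter> car r \<noteq> {}"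
    "conv D" "C \<inter> D \<noteq> {}" "\<And>r. r \<in> R \<Longrightarrow> D \<inter> car r \<noteq> {}"
  shows "\<exists>y. y \<in> C \<and> y \<in> D \<and> y \<in> core X {} R"
proof -
  have cc: "car r \<inter> car r' \<noteq> {}" if "r \<in> R" "r' \<in> R" for r r'
  proof (cases "r = r'")
    case True then show ?thesis using car_ne that assms(2) by blast
  next
    case False then show ?thesis using cross_car[of r r'] assms(2,3) that by blast
  qed
  have "C \<inter> \<Inter>(insert D (car ` R)) \<noteq> {}"
  proof (rule helly[OF _ _ _ assms(4,5)])
    show "finite (insert D (car ` R))" using assms(1) by simp
    show "conv E" if "E \<in> insert D (car ` R)" for E using that conv_car assms(2,7) by blast
    show "C \<inter> E \<noteq> {}" if "E \<in> insert D (car ` R)" for E using that assms(6,8) by blast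
    show "E \<inter> F \<noteq> {}" if EF: "E \<in> insert D (car ` R)" "F \<in> insert D (car ` R)" for E F
    proof -
      have D: "D \<noteq> {}" using assms(8) by blast
      consider "E = D" "F = D" | r where "E = D" "r \<in> R" "F = car r" | r where "E = car r" "r \<in> R" "F = D"
        | r r' where "r \<in> R" "r' \<in> R" "E = car r" "F = car r'" using EF by blast
      then show ?thesis
      proof cases
        case 1 then show ?thesis using D by simp
      next
        case 2 then show ?thesis using assms(9) by simp
      next
        case 3 then show ?thesis using assms(9)[of r] by (simp add: Int_commute)
      next
        case 4 then show ?thesis using cc by simp
      qed
    qed
  qed
  then obtain y where y: "y \<in> C" "y \<in> D" "\<And>r. r \<in> R \<Longrightarrow> y \<in> car r" by blast
  then have "y \<in> core X {} R" using conv_sub[OF assms(4)] unfolding core_mem by blast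
  then show ?thesis using y by blast
qed

lemma aut_cross: assumes "aut g" "h \<subseteq> V" "k \<subseteq> V" "cross h k" shows "cross (g ` h) (g ` k)"
proof -
  note inj = aut_inj[OF assms(1)]
  have D: "h - k \<subseteq> V" "k - h \<subseteq> V" using assms(2,3) by auto
  have "g ` h \<inter> g ` k = g ` (h \<inter> k)" "g ` h - g ` k = g ` (h - k)" "g ` k - g ` h = g ` (k - h)"
    using inj_on_image_Int[OF inj assms(2,3)] inj_on_image_set_diff[OF inj D(1) assms(3)]
      inj_on_image_set_diff[OF inj D(2) assms(2)] by simp_all
  moreover have "V - (g ` h \<union> g ` k) = g ` (V - (h \<union> k))"
    using aut_compl[OF assms(1), of "h \<union> k"] assms(2,3) by (simp add: image_Un)
  ultimately show ?thesis using assms(4) unfolding cross_def by simp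
qed

lemma aut_inside: assumes "aut g" "x \<in> hss" "h \<in> hss" "inside x h" shows "inside (g ` x) (g ` h)"
proof -
  have c: "V - g ` x = g ` (V - x)" using aut_compl[OF assms(1) halfspace_sub[OF assms(2)]] by simp
  show ?thesis using assms(4) unfolding inside_def c
  proof (elim disjE)
    assume a: "x \<subset> h"
    show "g ` x \<subset> g ` h \<or> g ` (V - x) \<subset> g ` h" by (rule disjI1[OF aut_psub[OF assms(1) a halfspace_sub[OF assms(3)]]])
  next
    assume a: "V - x \<subset> h"
    show "g ` x \<subset> g ` h \<or> g ` (V - x) \<subset> g ` h" by (rule disjI2[OF aut_psub[OF assms(1) a halfspace_sub[OF assms(3)]]])
  qed
qed

lemma aut_pow: "aut f \<Longrightarrow> aut (f ^^ m)"
proof (induction m)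
  case 0
  have "bij_betw id V V" by simp
  then show ?case unfolding cc_automorphism_def by simp
next
  case (Suc m) then show ?case unfolding funpow.simps using aut_comp by blast
qed

text \<open>
  Translate every \<open>w n\<close> into a finite set of orbit representatives. The families \<open>A n i\<close> then
  become subsets of one finite set of halfspaces, so infinitely many \<open>n\<close> give the same picture.
  The index \<open>i\<close> allows several families to be followed separately; singletons follow single
  halfspaces.
\<close>

lemma orbit_pigeonhole:
  fixes w :: "nat \<Rightarrow> 'v" and A :: "nat \<Rightarrow> 'i \<Rightarrow> 'v set set"
  assumes "\<And>n. w n \<in> V" "finite I" "\<And>n i k. i \<in> I \<Longrightarrow> k \<in> A n i \<Longrightarrow> k \<in> hss \<and> w n \<in> car k"
  obtains J where "infinite J"
    "\<And>n m. n \<in> J \<Longrightarrow> m \<in> J \<Longrightarrow> \<exists>g. aut g \<and> g (w n) = w m \<and> (\<forall>i\<in>I. image g ` A n i = A m i)"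
proof -
  obtain K where K: "finite K" "K \<subseteq> V" "\<And>v. v \<in> V \<Longrightarrow> \<exists>g. aut g \<and> g v \<in> K" using orbit_reps by blast
  have "\<forall>n. \<exists>g. aut g \<and> g (w n) \<in> K" using K(3) assms(1) by simp
  then obtain g where g: "\<forall>n. aut (g n) \<and> g n (w n) \<in> K" by (rule choice[THEN exE])
  let ?B = "\<Union>u\<in>K. hs u ` neighbours X u"
  have finB: "finite ?B" using K nbr_finite by auto
  define F where "F n i = image (g n) ` A n i" for n i
  have FB: "F n i \<subseteq> ?B" if i: "i \<in> I" for n i
  proof
    fix h assume "h \<in> F n i"
    then obtain k where k: "k \<in> A n i" "h = g n ` k" unfolding F_def by blast
    have kk: "k \<in> hss" "w n \<in> car k" using assms(3)[OF i k(1)] by auto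
    have "g n (w n) \<in> car h" "h \<in> hss" unfolding k(2) using aut_car aut_halfspace g kk by blast+
    then show "h \<in> ?B" using car_hs_nbr g by blast
  qed
  define \<tau> where "\<tau> n = (g n (w n), restrict (F n) I)" for n
  have "\<tau> n \<in> K \<times> (I \<rightarrow>\<^sub>E Pow ?B)" for n
    unfolding \<tau>_def using g FB[of _ n] by auto
  then have "range \<tau> \<subseteq> K \<times> (I \<rightarrow>\<^sub>E Pow ?B)" by blast
  moreover have "finite (K \<times> (I \<rightarrow>\<^sub>E Pow ?B))"
    using K(1) assms(2) finB by (intro finite_cartesian_product finite_PiE) auto
  ultimately have "finite (range \<tau>)" by (rule finite_subset)
  from pigeonhole_infinite[OF infinite_UNIV_nat this]
  obtain a where a: "infinite {n. \<tau> n = \<tau> a}" by auto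
  show ?thesis
  proof (rule that[OF a])
    fix n m assume "n \<in> {n. \<tau> n = \<tau> a}" "m \<in> {n. \<tau> n = \<tau> a}"
    then have t: "\<tau> n = \<tau> m" by simp
    then have e1: "g n (w n) = g m (w m)" unfolding \<tau>_def by simp
    have "restrict (F n) I = restrict (F m) I" using t unfolding \<tau>_def by simp
    then have e2: "F n i = F m i" if "i \<in> I" for i using that by (metis restrict_apply')
    obtain f where f: "aut f" "\<And>x. x \<in> V \<Longrightarrow> f (g m x) = x" using aut_inverse[of "g m"] g by metis
    have bk: "f ` g m ` h = h" if "h \<subseteq> V" for h using f(2) that by (force simp: image_image)
    have "image (f \<circ> g n) ` A n i = A m i" if i: "i \<in> I" for i
    proof -
      have "image (f \<circ> g n) ` A n i = image f ` F n i" unfolding F_def by (simp add: image_image image_comp)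
      also have "\<dots> = image f ` image (g m) ` A m i" using e2[OF i] unfolding F_def by simp
      also have "\<dots> = (\<lambda>h. f ` g m ` h) ` A m i" by (simp only: image_image)
      also have "\<dots> = (\<lambda>h. h) ` A m i"
        by (rule image_cong[OF refl]) (use bk halfspace_sub assms(3)[OF i] in blast)
      finally show ?thesis by simp
    qed
    moreover have "(f \<circ> g n) (w n) = w m" using e1 f(2) assms(1) by simp
    moreover have "aut (f \<circ> g n)" using aut_comp f(1) g by blast
    ultimately show "\<exists>g. aut g \<and> g (w n) = w m \<and> (\<forall>i\<in>I. image g ` A n i = A m i)" by blast
  qed
qed

lemma ball_bound: "\<exists>M. \<forall>w\<in>V. finite {y \<in> V. d w y \<le> D} \<and> card {y \<in> V. d w y \<le> D} \<le> M"
proof -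
  obtain N where N: "\<And>v. v \<in> V \<Longrightarrow> card (neighbours X v) \<le> N" using valence_bound by blast
  show ?thesis
  proof (induction D)
    case 0
    have "{y \<in> V. d w y \<le> 0} = {w}" if "w \<in> V" for w using d_eq_0[OF that] that by auto
    then show ?case by (intro exI[of _ 1]) simp
  next
    case (Suc D)
    then obtain M where M: "\<forall>w\<in>V. finite {y \<in> V. d w y \<le> D} \<and> card {y \<in> V. d w y \<le> D} \<le> M" ..
    have "finite {y \<in> V. d w y \<le> Suc D} \<and> card {y \<in> V. d w y \<le> Suc D} \<le> M + M * N" if w: "w \<in> V" for w
    proof -
      let ?B = "{y \<in> V. d w y \<le> D}"
      let ?U = "?B \<union> (\<Union>y\<in>?B. neighbours X y)"
      have sub: "{y \<in> V. d w y \<le> Suc D} \<subseteq> ?U"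
      proof
        fix y assume y: "y \<in> {y \<in> V. d w y \<le> Suc D}"
        show "y \<in> ?U"
        proof (cases "y = w")
          case True then show ?thesis using w d_refl by simp
        next
          case False
          then obtain u where u: "adj y u" "d y w = Suc (d u w)" using d_closer[of y w] y w by blast
          then have "u \<in> ?B" using y adj_verts[OF u(1)] d_sym[of y w] d_sym[of u w] by simp
          moreover have "y \<in> neighbours X u" using in_neighbours adj_sym[OF u(1)] by blast
          ultimately show ?thesis by blast
        qed
      qed
      have fB: "finite ?B" "card ?B \<le> M" using M w by auto
      have fU: "finite ?U" using fB nbr_finite by auto
      have "card (\<Union>y\<in>?B. neighbours X y) \<le> (\<Sum>y\<in>?B. card (neighbours X y))" by (rule card_UN_le[OF fB(1)])
      also have "\<dots> \<le> (\<Sum>y\<in>?B. N)" by (rule sum_mono) (use N in auto)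
      also have "\<dots> \<le> M * N" using fB by simp
      finally have "card (\<Union>y\<in>?B. neighbours X y) \<le> M * N" .
      then have "card ?U \<le> M + M * N" using card_Un_le[of ?B "\<Union>y\<in>?B. neighbours X y"] fB by linarith
      then show ?thesis using card_mono[OF fU sub] finite_subset[OF sub fU] by linarith
    qed
    then show ?case by blast
  qed
qed

lemma gate_lipschitz:
  assumes "p \<in> C" "q \<in> C" "\<And>c. c \<in> C \<Longrightarrow> d x c = d x p + d p c" "\<And>c. c \<in> C \<Longrightarrow> d y c = d y q + d q c"
    "x \<in> V" "y \<in> V" "C \<subseteq> V"
  shows "d p q \<le> d x y"
proof -
  have V: "p \<in> V" "q \<in> V" using assms by auto
  have "d x q \<le> d x y + d y q" "d y p \<le> d y x + d x p" using d_triangle assms(5,6) V by blast+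
  then show ?thesis using assms(3)[OF assms(2)] assms(4)[OF assms(1)] d_sym[of x y] d_sym[of p q] by linarith
qed

end

section \<open>Ascending halfspaces next to a minimal family\<close>

text \<open>
  The situation that \<open>nonterm_dense\<close> would produce without \<open>hyp_dense\<close>. The set \<open>R\<close> arises from a
  smallest bad set by removing one member, and \<open>q\<close> from a halfspace below that member by powers of
  an automorphism fixing the members of \<open>R\<close>.
\<close>

locale ascending_bad = cat0_cocompact X for X :: "'v set set" +
  fixes R :: "'v set set" and q :: "nat \<Rightarrow> 'v set"
  assumes dense: "nonterm_dense"
    and finR: "finite R" and neR: "R \<noteq> {}" and Rh: "R \<subseteq> hss"
    and Rcross: "\<And>r r'. r \<in> R \<Longrightarrow> r' \<in> R \<Longrightarrow> r \<noteq> r' \<Longrightarrow> cross r r'"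
    and qh: "\<And>m. q m \<in> hss" and qs: "\<And>m. q m \<subset> q (Suc m)"
    and qR: "\<And>m r. r \<in> R \<Longrightarrow> cross (q m) r"
    and qbad: "\<And>x m. x \<in> hss \<Longrightarrow> inside x (q m) \<Longrightarrow> (\<And>r. r \<in> R \<Longrightarrow> inside x r) \<Longrightarrow> False"
    and smaller: "\<And>H'. bad H' \<Longrightarrow> card R < card H'"
begin

definition Y where "Y = core X {} R"

lemma Y_mem: "y \<in> Y \<longleftrightarrow> y \<in> V \<and> (\<forall>r\<in>R. y \<in> car r)" unfolding Y_def core_mem by simp

lemma Y_conv: "conv Y" unfolding Y_def by (rule conv_core) (use Rh in auto)

lemma Y_V: "Y \<subseteq> V" using conv_sub[OF Y_conv] .

lemma Y_sub: "r \<in> R \<Longrightarrow> Y \<subseteq> r" using car_sub Rh unfolding Y_mem[abs_def] subset_iff Y_mem by blast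

lemma q_mono: "m \<le> n \<Longrightarrow> q m \<subseteq> q n" using lift_Suc_mono_le[of q m n] qs by blast

text \<open>
  The \<open>q m\<close> exhaust \<open>X\<close>, since their complements form a descending chain.
\<close>

lemma q_event: assumes "p \<in> V" shows "\<forall>\<^sub>F m in sequentially. p \<in> q m"
proof -
  have "V - q (Suc n) \<subset> V - q n" for n using qs[of n] halfspace_sub[OF qh] by blast
  then obtain n where n: "p \<notin> V - q n" using chain_leaves[of "\<lambda>n. V - q n", OF halfspace_compl[OF qh] _ assms] by blast
  have "p \<in> q m" if "m \<ge> n" for m using q_mono[OF that] n assms by blast
  then show ?thesis unfolding eventually_sequentially by blast
qed

definition Z where "Z m = Y \<inter> (V - q m)"

lemma Z_conv: "conv (Z m)" unfolding Z_def by (rule conv_Int[OF Y_conv conv_halfspace[OF halfspace_compl[OF qh]]])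

lemma Z_mono: "m \<le> n \<Longrightarrow> Z n \<subseteq> Z m" unfolding Z_def using q_mono by blast

lemma q_compl_car: assumes "r \<in> R" shows "(V - q m) \<inter> car r \<noteq> {}"
proof -
  have r: "r \<in> hss" using assms Rh by blast
  have "car r - q m \<noteq> {}" using cross_car_meets(2)[OF r qh cross_sym[OF qR[OF assms]]] .
  moreover have "car r \<subseteq> V" using conv_sub[OF conv_car[OF r]] .
  ultimately show ?thesis by blast
qed

text \<open>
  The complement of \<open>q m\<close> crosses the pairwise crossing members of \<open>R\<close>, so it meets their core.
\<close>

lemma Z_ne: "Z m \<noteq> {}"
proof -
  have q': "V - q m \<in> hss" using halfspace_compl[OF qh] .
  have "\<exists>y. y \<in> V - q m \<and> y \<in> V - q m \<and> y \<in> core X {} R"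
    by (rule cross_core[OF finR Rh Rcross conv_halfspace[OF q'] halfspace_ne[OF q'] q_compl_car conv_halfspace[OF q'] _ q_compl_car])
       (use halfspace_ne[OF q'] in auto)
  then show ?thesis unfolding Z_def Y_def by blast
qed

text \<open>
  Halfspaces adjacent to the core but disjoint from it, lying below some member of \<open>R\<close> and
  containing a boundary point of the basic open set of \<open>R\<close>.
\<close>

definition branching where
  "branching = {b \<in> hss. (\<exists>y\<in>Y. y \<in> car (V - b)) \<and> (\<exists>r\<in>R. b \<subset> r) \<and> meets (insert b R)}"

lemma branching_D: assumes "b \<in> branching" shows "b \<in> hss" "\<exists>y\<in>Y. y \<in> car (V - b)" "\<exists>r\<in>R. b \<subset> r" "meets (insert b R)"
  using assms unfolding branching_def by auto

lemma branching_disj: assumes "b \<in> branching" shows "Y \<inter> b = {}"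
proof -
  obtain r where r: "r \<in> R" "b \<subset> r" using branching_D[OF assms] by blast
  then have "car r \<inter> b = {}" using car_disjoint[of r b] Rh branching_D(1)[OF assms] by blast
  moreover have "Y \<subseteq> car r" using r(1) by (auto simp: Y_mem)
  ultimately show ?thesis by blast
qed

text \<open>
  For large \<open>m\<close> the halfspace \<open>q m\<close> contains points of both sides of \<open>b\<close>, and it misses part of
  the core, which is disjoint from \<open>b\<close>. If it did not cross \<open>b\<close>, it would therefore contain \<open>b\<close>.
  The members of \<open>R\<close> not above \<open>b\<close>, together with \<open>b\<close>, are too few to be bad, and a hyperplane
  inside all of them is inside \<open>q m\<close> and all of \<open>R\<close>.
\<close>

lemma branching_cross: assumes "b \<in> branching" shows "\<forall>\<^sub>F m in sequentially. cross b (q m)"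
proof -
  note b = branching_D[OF assms]
  obtain p1 where p1: "p1 \<in> b" using halfspace_ne[OF b(1)] by blast
  obtain p2 where p2: "p2 \<in> V - b" using halfspace_ne_compl[OF b(1)] by blast
  have p1V: "p1 \<in> V" using p1 halfspace_sub[OF b(1)] by blast
  have "\<forall>\<^sub>F m in sequentially. p1 \<in> q m \<and> p2 \<in> q m" using q_event[of p1] q_event[of p2] p1V p2 by (simp add: eventually_conj)
  moreover have "cross b (q m)" if p: "p1 \<in> q m \<and> p2 \<in> q m" for m
  proof (rule ccontr)
    assume nc: "\<not> cross b (q m)"
    show False using not_cross[OF nc halfspace_sub[OF b(1)] halfspace_sub[OF qh]]
    proof cases
      case 1 then show False using p p1 by blast
    next
      case 2
      let ?R1 = "{r \<in> R. \<not> b \<subseteq> r}"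
      have "?R1 \<subset> R" using b(3) by blast
      then have "card ?R1 < card R" using psubset_card_mono[OF finR] by blast
      moreover have "card (insert b ?R1) \<le> Suc (card ?R1)" by (rule card_insert_le_m1) (use finR in auto)
      ultimately have nb: "\<not> bad (insert b ?R1)" using smaller[of "insert b ?R1"] by linarith
      have mt: "meets (insert b ?R1)" by (rule meets_mono[OF b(4)]) blast
      have fs: "finite (insert b ?R1)" "insert b ?R1 \<subseteq> hss" using finR Rh b(1) by auto
      have "\<exists>x\<in>hss. \<forall>h\<in>insert b ?R1. inside x h"
      proof (rule ccontr)
        assume "\<not> ?thesis"
        then have "bad (insert b ?R1)" unfolding bad_def by (intro conjI fs mt)
        then show False using nb by contradiction
      qed
      then obtain x where x: "x \<in> hss" "\<forall>h\<in>insert b ?R1. inside x h" by (elim bexE)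
      have xb: "inside x b" using x(2) by simp
      show False
      proof (rule qbad[OF x(1), of m])
        show "inside x (q m)" by (rule inside_sub[OF xb 2])
        show "inside x r" if "r \<in> R" for r using x(2) that inside_sub[OF xb] by blast
      qed
    next
      case 3 then show False using p p2 by blast
    next
      case 4
      obtain z where z: "z \<in> Z m" using Z_ne by blast
      then have "z \<in> Y" "z \<in> V - q m" unfolding Z_def by auto
      moreover from this have "z \<in> b" using 4 by blast
      ultimately show False using branching_disj[OF assms] by blast
    qed
  qed
  ultimately show ?thesis by (rule eventually_mono)
qed

lemma branching_Z: assumes "b \<in> branching" "cross b (q m)" shows "\<exists>z. z \<in> Z m \<and> z \<in> car (V - b)"
proof -
  note b = branching_D[OF assms(1)]
  have b': "V - b \<in> hss" using halfspace_compl[OF b(1)] .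
  have q': "V - q m \<in> hss" using halfspace_compl[OF qh] .
  obtain y where y: "y \<in> Y" "y \<in> car (V - b)" using b(2) by blast
  have "cross (V - b) (q m)" using cross_compl[OF halfspace_sub[OF b(1)] halfspace_sub[OF qh] assms(2)] .
  from cross_car_meets(2)[OF b' qh this] have 1: "(V - q m) \<inter> car (V - b) \<noteq> {}"
    using conv_sub[OF conv_car[OF b']] by blast
  have "\<exists>z. z \<in> V - q m \<and> z \<in> car (V - b) \<and> z \<in> core X {} R"
  proof (rule cross_core[OF finR Rh Rcross conv_halfspace[OF q'] halfspace_ne[OF q'] q_compl_car conv_car[OF b'] 1])
    show "car (V - b) \<inter> car r \<noteq> {}" if "r \<in> R" for r using y that unfolding Y_mem by blast
  qed
  then show ?thesis unfolding Z_def Y_def by blast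
qed

definition cage where "cage \<alpha> w = {k \<in> \<alpha>. w \<in> car k}"

text \<open>
  A non-terminating \<open>\<beta>\<close> containing the cage has a member strictly below some \<open>r \<in> R\<close>, which is
  disjoint from the core. Let \<open>?b\<close> be the far side of the edge separating them. If \<open>?b\<close> were below
  no member of \<open>R\<close>, it would cross all of them, and the other end of the edge would belong to the
  core.
\<close>

lemma branching_exists:
  assumes "w \<in> Y" "\<alpha> \<in> bdry" "\<And>r. r \<in> R \<Longrightarrow> minimal_in \<alpha> r"
  shows "\<exists>b\<in>branching. meets (insert b (cage \<alpha> w))"
proof -
  note au = bdry_uf[OF assms(2)]
  let ?K = "cage \<alpha> w"
  have wV: "w \<in> V" using assms(1) Y_V by blast
  have Kh: "?K \<subseteq> hss" unfolding cage_def using uf_halfspace[OF au] by blast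
  have Kf: "finite ?K" by (rule cage_finite[OF Kh _ wV]) (simp add: cage_def)
  have "meets ?K" unfolding meets_def cage_def using assms(2) by blast
  then obtain \<beta> where be: "\<beta> \<in> bdry" "non_terminating \<beta>" "?K \<subseteq> \<beta>"
    using dense[unfolded nonterm_dense_def, rule_format, of ?K] Kh Kf by auto
  note bu = bdry_uf[OF be(1)]
  have RK: "R \<subseteq> ?K" using assms(1,3) unfolding cage_def Y_mem minimal_in_def by blast
  then have Rb: "R \<subseteq> \<beta>" using be(3) by blast
  obtain r0 where r0: "r0 \<in> R" using neR by blast
  then obtain b' where b': "b' \<in> \<beta>" "b' \<subset> r0" using be(2) Rb unfolding non_terminating_def by blast
  have b'h: "b' \<in> hss" using uf_halfspace[OF bu b'(1)] .
  have r0h: "r0 \<in> hss" using r0 Rh by blast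
  have "car r0 \<inter> b' = {}" using car_disjoint[OF r0h b'h b'(2)] .
  moreover have "Y \<subseteq> car r0" using r0 by (auto simp: Y_mem)
  ultimately have d0: "Y \<inter> b' = {}" by blast
  have Yne: "Y \<noteq> {}" using assms(1) by blast
  obtain x u where xu: "x \<in> Y" "adj x u" "b' \<subseteq> hs u x" "Y \<inter> hs u x = {}"
    by (rule convex_sep[OF Y_conv Yne conv_halfspace[OF b'h] halfspace_ne[OF b'h] d0])
  let ?b = "hs u x"
  have bh: "?b \<in> hss" using hs_halfspace[OF adj_sym[OF xu(2)]] .
  have bb: "?b \<in> \<beta>" using uf_up[OF bu b'(1) bh xu(3)] .
  have "\<exists>r\<in>R. ?b \<subset> r"
  proof (rule ccontr)
    assume no: "\<not> ?thesis"
    have "u \<in> car r" if r: "r \<in> R" for r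
    proof -
      have rh: "r \<in> hss" using r Rh by blast
      have xr: "x \<in> car r" "x \<in> r" using xu(1) r Y_mem subsetD[OF Y_sub[OF r] xu(1)] by auto
      obtain z where z: "adj x z" "z \<notin> r" using xr(1) car_iff[OF rh] by blast
      have xb: "x \<notin> ?b" using hs_ends(2)[OF adj_sym[OF xu(2)]] .
      have rb: "?b \<inter> r \<noteq> {}" using uf_meet[OF bu bb] Rb r by blast
      have "z \<notin> ?b"
      proof
        assume "z \<in> ?b"
        then have "?b = hs z x" using hs_eqI[OF bh adj_sym[OF z(1)]] xb by blast
        moreover have "r = hs x z" using hs_eqI[OF rh z(1) xr(2) z(2)] .
        ultimately have "?b = V - r" using hs_compl[OF z(1)] by simp
        then show False using rb by blast
      qed
      moreover have "z \<in> V" using adj_verts[OF z(1)] by blast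
      moreover have "\<not> ?b \<subseteq> r" using no r xr(2) xb by blast
      ultimately have "cross ?b r" unfolding cross_def using rb z(2) xr(2) xb by blast
      then show ?thesis using cross_step[OF rh xr(1) xu(2)] by blast
    qed
    then have "u \<in> Y" unfolding Y_mem using adj_verts[OF xu(2)] by blast
    then show False using xu(4) hs_ends(1)[OF adj_sym[OF xu(2)]] by blast
  qed
  moreover have "x \<in> car (V - ?b)"
  proof -
    have e: "V - ?b = hs x u" using hs_compl[OF adj_sym[OF xu(2)]] .
    show ?thesis unfolding e using car_iff[OF hs_halfspace[OF xu(2)]] hs_ends[OF xu(2)] xu(2) by blast
  qed
  moreover have "meets (insert ?b R)" "meets (insert ?b ?K)" unfolding meets_def using be Rb bb by blast+
  ultimately show ?thesis unfolding branching_def using bh xu(1) by blast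
qed

text \<open>
  Otherwise there are core points \<open>w D\<close> without a suitable branching halfspace within distance
  \<open>D\<close>. For infinitely many \<open>D\<close> the cages at \<open>w D\<close> are translates of one another by automorphisms
  fixing the members of \<open>R\<close>. These carry one branching halfspace to branching halfspaces at the
  same distance from the other points.
\<close>

lemma branching_uniform:
  "\<exists>D. \<forall>w\<in>Y. \<forall>\<alpha>\<in>bdry. (\<forall>r\<in>R. minimal_in \<alpha> r) \<longrightarrow>
     (\<exists>b\<in>branching. meets (insert b (cage \<alpha> w)) \<and> (\<exists>y\<in>Y. y \<in> car (V - b) \<and> d w y \<le> D))"
proof (rule ccontr)
  assume "\<not> ?thesis"
  then have "\<forall>D. \<exists>w \<alpha>. w \<in> Y \<and> \<alpha> \<in> bdry \<and> (\<forall>r\<in>R. minimal_in \<alpha> r) \<and>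
     (\<forall>b\<in>branching. meets (insert b (cage \<alpha> w)) \<longrightarrow> (\<forall>y\<in>Y. y \<in> car (V - b) \<longrightarrow> \<not> d w y \<le> D))" by blast
  then obtain w \<alpha> where wa: "\<forall>D. w D \<in> Y \<and> \<alpha> D \<in> bdry \<and> (\<forall>r\<in>R. minimal_in (\<alpha> D) r) \<and>
     (\<forall>b\<in>branching. meets (insert b (cage (\<alpha> D) (w D))) \<longrightarrow> (\<forall>y\<in>Y. y \<in> car (V - b) \<longrightarrow> \<not> d (w D) y \<le> D))"
    by (metis (no_types))
  have wY: "w D \<in> Y" and aB: "\<alpha> D \<in> bdry" and at: "\<And>r. r \<in> R \<Longrightarrow> minimal_in (\<alpha> D) r" for D using wa by auto
  have far: False if "b \<in> branching" "meets (insert b (cage (\<alpha> D) (w D)))" "y \<in> Y" "y \<in> car (V - b)" "d (w D) y \<le> D" for b y D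
    using wa that by blast
  \<comment> \<open>the index \<open>None\<close> follows the cage, and each \<open>Some r\<close> follows \<open>r\<close> alone, so that automorphisms fix every \<open>r\<close>\<close>
  define A where "A D i = (case i of None \<Rightarrow> cage (\<alpha> D) (w D) | Some r \<Rightarrow> {r})" for D and i :: "'v set option"
  have "k \<in> hss \<and> w D \<in> car k" if "i \<in> insert None (Some ` R)" "k \<in> A D i" for D i k
  proof (cases i)
    case None
    then show ?thesis using that uf_halfspace[OF bdry_uf[OF aB]] unfolding A_def cage_def by auto
  next
    case (Some r)
    then have "k = r" "r \<in> R" using that unfolding A_def by auto
    then show ?thesis using Rh wY[of D] unfolding Y_mem by blast
  qed
  moreover have "w D \<in> V" for D using wY Y_V by blast
  moreover have "finite (insert None (Some ` R))" using finR by simp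
  ultimately obtain J where J: "infinite J" "\<And>n m. n \<in> J \<Longrightarrow> m \<in> J \<Longrightarrow>
      \<exists>g. aut g \<and> g (w n) = w m \<and> (\<forall>i\<in>insert None (Some ` R). image g ` A n i = A m i)"
    using orbit_pigeonhole[of w "insert None (Some ` R)" A] by metis
  obtain n0 where n0: "n0 \<in> J" using J(1) by (metis finite.emptyI equals0I)
  obtain b0 where b0: "b0 \<in> branching" "meets (insert b0 (cage (\<alpha> n0) (w n0)))" using branching_exists[OF wY aB at] by blast
  note bD = branching_D[OF b0(1)]
  obtain y0 where y0: "y0 \<in> Y" "y0 \<in> car (V - b0)" using bD(2) by blast
  obtain m where m: "m \<in> J" "d (w n0) y0 \<le> m" using J(1) by (metis infinite_nat_iff_unbounded_le)
  obtain g where g: "aut g" "g (w n0) = w m" "\<forall>i\<in>insert None (Some ` R). image g ` A n0 i = A m i"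
    using J(2)[OF n0 m(1)] by blast
  have gc: "image g ` cage (\<alpha> n0) (w n0) = cage (\<alpha> m) (w m)" using g(3) unfolding A_def by auto
  have gr: "g ` r = r" if "r \<in> R" for r
  proof -
    have "image g ` A n0 (Some r) = A m (Some r)" using g(3) that by blast
    then show ?thesis unfolding A_def by simp
  qed
  have gR: "image g ` R = R" using gr by force
  let ?b = "g ` b0"
  have bh: "?b \<in> hss" using aut_halfspace[OF g(1) bD(1)] .
  have cb: "V - ?b = g ` (V - b0)" using aut_compl[OF g(1) halfspace_sub[OF bD(1)]] by simp
  have gy: "g y0 \<in> car (V - ?b)" unfolding cb by (rule aut_car[OF g(1) halfspace_compl[OF bD(1)] y0(2)])
  have gyY: "g y0 \<in> Y" unfolding Y_mem
  proof (intro conjI ballI)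
    show "g y0 \<in> V" using aut_V[OF g(1)] y0(1) Y_V by blast
    show "g y0 \<in> car r" if r: "r \<in> R" for r
    proof -
      have "y0 \<in> car r" "r \<in> hss" using y0(1) r Rh unfolding Y_mem by auto
      then have "g y0 \<in> car (g ` r)" using aut_car[OF g(1)] by blast
      then show ?thesis using gr[OF r] by simp
    qed
  qed
  obtain r where r: "r \<in> R" "b0 \<subset> r" using bD(3) by blast
  have "r \<subseteq> V" using r(1) Rh halfspace_sub by blast
  then have "?b \<subset> r" using aut_psub[OF g(1) r(2)] gr[OF r(1)] by simp
  moreover have "meets (insert ?b R)" using aut_meets[OF g(1) bD(4)] gR by simp
  ultimately have "?b \<in> branching" unfolding branching_def using bh gy gyY r(1) by blast
  moreover have "meets (insert ?b (cage (\<alpha> m) (w m)))" using aut_meets[OF g(1) b0(2)] gc by simp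
  moreover have "d (w m) (g y0) \<le> m"
    using aut_d[OF g(1) subsetD[OF Y_V wY[of n0]] subsetD[OF Y_V y0(1)]] g(2) m(2) by simp
  ultimately show False using far gyY gy by blast
qed

definition near_branching where "near_branching D w = {b \<in> branching. \<exists>y\<in>Y. y \<in> car (V - b) \<and> d w y \<le> D}"

lemma near_branching_bound: "\<exists>M. \<forall>w\<in>V. finite (near_branching D w) \<and> card (near_branching D w) \<le> M"
proof -
  obtain N where N: "\<And>v. v \<in> V \<Longrightarrow> card (neighbours X v) \<le> N" using valence_bound by blast
  obtain M where M: "\<forall>w\<in>V. finite {y \<in> V. d w y \<le> D} \<and> card {y \<in> V. d w y \<le> D} \<le> M" using ball_bound by blast
  have "finite (near_branching D w) \<and> card (near_branching D w) \<le> M * N" if w: "w \<in> V" for w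
  proof -
    let ?B = "{y \<in> V. d w y \<le> D}"
    let ?U = "\<Union>y\<in>?B. (\<lambda>h. V - h) ` hs y ` neighbours X y"
    have sub: "near_branching D w \<subseteq> ?U"
    proof
      fix b assume "b \<in> near_branching D w"
      then obtain y where b: "b \<in> branching" "y \<in> Y" "y \<in> car (V - b)" "d w y \<le> D" unfolding near_branching_def by blast
      have bh: "b \<in> hss" using branching_D(1)[OF b(1)] .
      have "V - b \<in> hs y ` neighbours X y" using car_hs_nbr[OF halfspace_compl[OF bh] b(3)] .
      then have "V - (V - b) \<in> (\<lambda>h. V - h) ` hs y ` neighbours X y" by (rule imageI)
      then show "b \<in> ?U" using halfspace_dcompl[OF bh] b(2,4) Y_V by auto
    qed
    have fB: "finite ?B" "card ?B \<le> M" using M w by auto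
    have fU: "finite ?U" using fB nbr_finite by auto
    have "card ?U \<le> (\<Sum>y\<in>?B. card ((\<lambda>h. V - h) ` hs y ` neighbours X y))" by (rule card_UN_le[OF fB(1)])
    also have "\<dots> \<le> (\<Sum>y\<in>?B. N)"
    proof (rule sum_mono)
      fix y assume y: "y \<in> ?B"
      then have "y \<in> V" by simp
      then have "card ((\<lambda>h. V - h) ` hs y ` neighbours X y) \<le> card (neighbours X y)"
        using card_image_le[of "hs y ` neighbours X y" "\<lambda>h. V - h"] card_image_le[of "neighbours X y" "hs y"] nbr_finite[of y]
        by (meson finite_imageI le_trans)
      then show "card ((\<lambda>h. V - h) ` hs y ` neighbours X y) \<le> N" using N[OF \<open>y \<in> V\<close>] by linarith
    qed
    also have "\<dots> \<le> M * N" using fB by simp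
    finally have "card ?U \<le> M * N" .
    then show ?thesis using card_mono[OF fU sub] finite_subset[OF sub fU] by linarith
  qed
  then show ?thesis by blast
qed

text \<open>
  Take \<open>w0\<close> with the largest number of branching halfspaces nearby. They all cross \<open>q m\<close> for large
  \<open>m\<close>, hence remain adjacent to \<open>Z m\<close>, and passing to gates in \<open>Z m\<close> does not increase distances.
  So the gate \<open>W m\<close> of \<open>w0\<close> is near to all of them, and by maximality to no others. The limit \<open>\<alpha>\<close>
  of the \<open>W m\<close> has every \<open>r \<in> R\<close> as a minimal element, so \<open>branching_uniform\<close> applies at every
  \<open>W m\<close>, always with a branching halfspace from this finite set. One of them, \<open>?b\<close>, occurs
  infinitely often. The edge from such a \<open>W m\<close> towards \<open>?b\<close> gives a member of \<open>\<alpha>\<close> that contains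
  \<open>?b\<close>, but neither \<open>W m\<close> nor \<open>w0\<close>. Only finitely many halfspaces separate \<open>w0\<close> from a point of
  \<open>?b\<close>, so one member of \<open>\<alpha>\<close> misses infinitely many \<open>W m\<close>.
\<close>

lemma no_ascending_bad: False
proof -
  obtain D where D: "\<And>w \<alpha>. w \<in> Y \<Longrightarrow> \<alpha> \<in> bdry \<Longrightarrow> (\<And>r. r \<in> R \<Longrightarrow> minimal_in \<alpha> r) \<Longrightarrow>
     \<exists>b\<in>branching. meets (insert b (cage \<alpha> w)) \<and> (\<exists>y\<in>Y. y \<in> car (V - b) \<and> d w y \<le> D)"
    using branching_uniform by metis
  obtain M where M: "\<forall>w\<in>V. finite (near_branching D w) \<and> card (near_branching D w) \<le> M" using near_branching_bound by blast
  obtain y1 where y1: "y1 \<in> Y" using Z_ne[of 0] unfolding Z_def by blast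
  have "\<forall>w. w \<in> Y \<longrightarrow> card (near_branching D w) < Suc M" using M Y_V by (metis less_Suc_eq_le subsetD)
  then obtain w0 where w0: "w0 \<in> Y" and mx: "\<And>w. w \<in> Y \<Longrightarrow> card (near_branching D w) \<le> card (near_branching D w0)"
    using ex_has_greatest_nat[of "\<lambda>w. w \<in> Y" y1 "\<lambda>w. card (near_branching D w)" "Suc M"] y1 by auto
  have w0V: "w0 \<in> V" using w0 Y_V by blast
  let ?B = "near_branching D w0"
  have fB: "finite ?B" using M w0V by blast
  have "\<forall>b\<in>?B. \<forall>\<^sub>F m in sequentially. cross b (q m)" using branching_cross unfolding near_branching_def by blast
  then have "\<forall>\<^sub>F m in sequentially. \<forall>b\<in>?B. cross b (q m)" by (rule eventually_ball_finite[OF fB])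
  then have "\<forall>\<^sub>F m in sequentially. w0 \<in> q m \<and> (\<forall>b\<in>?B. cross b (q m))" by (rule eventually_conj[OF q_event[OF w0V]])
  then obtain m0 where "\<forall>m\<ge>m0. w0 \<in> q m \<and> (\<forall>b\<in>?B. cross b (q m))" unfolding eventually_sequentially by (elim exE)
  then have m0: "w0 \<in> q m \<and> (\<forall>b\<in>?B. cross b (q m))" if "m \<ge> m0" for m using that by simp
  have "\<forall>m. \<exists>g. g \<in> Z (m0 + m) \<and> (\<forall>c\<in>Z (m0 + m). d w0 c = d w0 g + d g c)"
  proof
    fix m
    obtain g where "g \<in> Z (m0 + m)" "\<And>c. c \<in> Z (m0 + m) \<Longrightarrow> d w0 c = d w0 g + d g c"
      using gate_exists[OF Z_conv Z_ne w0V] by blast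
    then show "\<exists>g. g \<in> Z (m0 + m) \<and> (\<forall>c\<in>Z (m0 + m). d w0 c = d w0 g + d g c)" by blast
  qed
  then obtain W where W: "\<forall>m. W m \<in> Z (m0 + m) \<and> (\<forall>c\<in>Z (m0 + m). d w0 c = d w0 (W m) + d (W m) c)" by (rule choice[THEN exE])
  have WZ: "W m \<in> Z (m0 + m)" and Wg: "\<And>c. c \<in> Z (m0 + m) \<Longrightarrow> d w0 c = d w0 (W m) + d (W m) c" for m using W by auto
  have WY: "W m \<in> Y" and Wq: "W m \<notin> q (m0 + m)" for m using WZ[of m] unfolding Z_def by auto
  have WV: "W m \<in> V" for m using WY Y_V by blast
  \<comment> \<open>the sequence \<open>w0, W 0, W 1, \<dots>\<close> is geodesic, because \<open>W m\<close> is the gate of \<open>w0\<close> in a set containing all later points\<close>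
  define v where "v i = (case i of 0 \<Rightarrow> w0 | Suc m \<Rightarrow> W m)" for i
  have v0: "v 0 = w0" and vS: "v (Suc m) = W m" for m unfolding v_def by simp_all
  have vY: "v i \<in> Y" for i using w0 WY by (cases i) (simp_all add: v0 vS)
  have vV: "v i \<in> V" for i using vY Y_V by blast
  have geo: "d (v 0) (v j) = d (v 0) (v i) + d (v i) (v j)" if "i \<le> j" for i j
  proof (cases i)
    case 0 then show ?thesis using d_refl[OF w0V] v0 by simp
  next
    case (Suc a)
    then obtain b where b: "j = Suc b" "a \<le> b" using \<open>i \<le> j\<close> by (cases j) auto
    have "W b \<in> Z (m0 + a)" using WZ[of b] Z_mono[of "m0 + a" "m0 + b"] b(2) by auto
    then show ?thesis using Wg[of "W b" a] unfolding Suc b(1) v0 vS by simp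
  qed
  have q_strict: "i < j \<Longrightarrow> q i \<subset> q j" for i j using qs q_mono[of "Suc i" j] by (metis Suc_leI psubset_subset_trans)
  \<comment> \<open>the halfspaces \<open>q m0, \<dots>, q (m0 + n)\<close> separate \<open>w0\<close> from \<open>W n\<close>\<close>
  have unb: "\<exists>i. n < d (v 0) (v i)" for n
  proof -
    have sub: "q ` {m0..m0 + n} \<subseteq> {h \<in> hss. w0 \<in> h \<and> W n \<notin> h}"
    proof
      fix h assume "h \<in> q ` {m0..m0 + n}"
      then obtain j where j: "h = q j" "m0 \<le> j" "j \<le> m0 + n" by auto
      then show "h \<in> {h \<in> hss. w0 \<in> h \<and> W n \<notin> h}" using m0[OF j(2)] Wq[of n] q_mono[OF j(3)] qh by blast
    qed
    have "inj_on q {m0..m0 + n}" using q_strict by (intro inj_onI) (metis linorder_neqE_nat psubsetE)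
    then have "Suc n = card (q ` {m0..m0 + n})" by (simp add: card_image)
    also have "\<dots> \<le> card {h \<in> hss. w0 \<in> h \<and> W n \<notin> h}" by (rule card_mono[OF _ sub]) (use sep_finite[OF w0V WV] in blast)
    also have "\<dots> = d w0 (W n)" by (rule sep_card[OF w0V WV])
    finally show ?thesis using v0 vS[of n] by (metis Suc_le_eq)
  qed
  let ?\<alpha> = "{h \<in> hss. \<exists>N. \<forall>i\<ge>N. v i \<in> h}"
  have a: "?\<alpha> \<in> bdry" by (rule ray_limit[OF vV geo unb])
  note au = bdry_uf[OF a]
  have tm: "minimal_in ?\<alpha> r" if r: "r \<in> R" for r unfolding minimal_in_def
  proof (intro conjI ballI notI)
    have rh: "r \<in> hss" using r Rh by blast
    then show "r \<in> ?\<alpha>" using Y_sub[OF r] vY by blast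
    fix h assume h: "h \<in> ?\<alpha>" "h \<subset> r"
    then obtain N where "v N \<in> h" by blast
    moreover have "v N \<in> car r" using vY r unfolding Y_mem by blast
    ultimately show False using car_disjoint[OF rh _ h(2)] h(1) by blast
  qed
  have "\<forall>m. \<exists>b. b \<in> branching \<and> meets (insert b (cage ?\<alpha> (W m))) \<and> (\<exists>y\<in>Y. y \<in> car (V - b) \<and> d (W m) y \<le> D)"
    using D[OF WY a tm] by blast
  then obtain bf where bf: "\<forall>m. bf m \<in> branching \<and> meets (insert (bf m) (cage ?\<alpha> (W m))) \<and> (\<exists>y\<in>Y. y \<in> car (V - bf m) \<and> d (W m) y \<le> D)"
    by (rule choice[THEN exE])
  have nearW: "near_branching D (W m) = ?B" for m
  proof -
    have sub: "?B \<subseteq> near_branching D (W m)"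
    proof
      fix b assume b: "b \<in> ?B"
      then obtain y where y: "b \<in> branching" "y \<in> Y" "y \<in> car (V - b)" "d w0 y \<le> D" unfolding near_branching_def by blast
      have b': "V - b \<in> hss" using halfspace_compl[OF branching_D(1)[OF y(1)]] .
      have yV: "y \<in> V" using y(2) Y_V by blast
      have "cross b (q (m0 + m))" using m0[of "m0 + m"] b by simp
      then obtain z where z: "z \<in> Z (m0 + m)" "z \<in> car (V - b)" using branching_Z[OF y(1)] by blast
      obtain g where g: "g \<in> Z (m0 + m)" "\<And>c. c \<in> Z (m0 + m) \<Longrightarrow> d y c = d y g + d g c"
        using gate_exists[OF Z_conv Z_ne yV] by blast
      have gV: "g \<in> V" using g(1) unfolding Z_def by blast
      have "g \<in> car (V - b)" by (rule conv_between[OF conv_car[OF b'] y(3) z(2) gV g(2)[OF z(1)]])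
      moreover have "g \<in> Y" using g(1) unfolding Z_def by blast
      moreover have "d (W m) g \<le> d w0 y"
        by (rule gate_lipschitz[OF WZ g(1) Wg g(2) w0V yV conv_sub[OF Z_conv]])
      ultimately show "b \<in> near_branching D (W m)" unfolding near_branching_def using y by (auto intro: le_trans)
    qed
    have "finite (near_branching D (W m))" using M WV by blast
    then show ?thesis using card_seteq[OF _ sub] mx[OF WY] by metis
  qed
  have bfB: "bf m \<in> ?B" for m using bf nearW[of m, symmetric] unfolding near_branching_def by blast
  have "finite (range bf)" using bfB finite_subset[OF _ fB] by blast
  from pigeonhole_infinite[OF infinite_UNIV_nat this] obtain a0 where a0: "infinite {m. bf m = bf a0}" by auto
  let ?b = "bf a0"
  have bB: "?b \<in> branching" using bf by blast
  have bh: "?b \<in> hss" using branching_D(1)[OF bB] .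
  obtain p where p: "p \<in> ?b" using halfspace_ne[OF bh] by blast
  have pV: "p \<in> V" using p halfspace_sub[OF bh] by blast
  let ?E = "{h \<in> hss. p \<in> h \<and> w0 \<notin> h}"
  have "\<forall>m\<in>{m. bf m = ?b}. \<exists>e. e \<in> ?E \<and> e \<in> ?\<alpha> \<and> W m \<notin> e"
  proof
    fix m assume "m \<in> {m. bf m = ?b}"
    then have me: "meets (insert ?b (cage ?\<alpha> (W m)))" using bf by (metis (mono_tags, lifting) mem_Collect_eq)
    have Wb: "W m \<in> V - ?b" using branching_disj[OF bB] WY WV by blast
    obtain u where u: "adj (W m) u" "?b \<subseteq> hs u (W m)" by (rule gate_step[OF conv_halfspace[OF bh] halfspace_ne[OF bh] Wb])
    let ?e = "hs u (W m)"
    have eh: "?e \<in> hss" using hs_halfspace[OF adj_sym[OF u(1)]] .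
    have ec: "V - ?e = hs (W m) u" using hs_compl[OF adj_sym[OF u(1)]] .
    have We: "W m \<notin> ?e" using hs_ends(2)[OF adj_sym[OF u(1)]] .
    \<comment> \<open>otherwise the near side, disjoint from \<open>?b\<close>, would be in the cage at \<open>W m\<close>, but a boundary point contains both\<close>
    have ea: "?e \<in> ?\<alpha>"
    proof (rule ccontr)
      assume "?e \<notin> ?\<alpha>"
      then have "hs (W m) u \<in> ?\<alpha>" using uf_compl[OF au eh] ec by simp
      moreover have "W m \<in> car (hs (W m) u)" using car_iff[OF hs_halfspace[OF u(1)]] hs_ends[OF u(1)] u(1) by blast
      ultimately have "hs (W m) u \<in> cage ?\<alpha> (W m)" unfolding cage_def by blast
      moreover obtain \<beta> where b: "\<beta> \<in> bdry" "insert ?b (cage ?\<alpha> (W m)) \<subseteq> \<beta>" using me unfolding meets_def by blast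
      ultimately have "?b \<inter> hs (W m) u \<noteq> {}" using uf_meet[OF bdry_uf[OF b(1)], of ?b "hs (W m) u"] by blast
      then show False using u(2) ec by blast
    qed
    have "w0 \<notin> ?e"
    proof
      assume w0e: "w0 \<in> ?e"
      obtain N where N: "\<forall>i\<ge>N. v i \<in> ?e" using ea by blast
      let ?j = "max N (Suc m)"
      have "v ?j \<in> ?e" using N by simp
      moreover have "v 0 \<in> ?e" using w0e v0 by simp
      ultimately have "v (Suc m) \<in> ?e" using conv_between[OF conv_halfspace[OF eh] _ _ vV geo[of "Suc m" ?j]] by simp
      then show False using We vS by simp
    qed
    then have "?e \<in> ?E" using eh p u(2) by blast
    then show "\<exists>e. e \<in> ?E \<and> e \<in> ?\<alpha> \<and> W m \<notin> e" using ea We by blast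
  qed
  then obtain ef where ef: "\<forall>m\<in>{m. bf m = ?b}. ef m \<in> ?E \<and> ef m \<in> ?\<alpha> \<and> W m \<notin> ef m" by (rule bchoice[THEN exE])
  have "finite ?E" using sep_finite[OF pV w0V] by blast
  then have "finite (ef ` {m. bf m = ?b})" by (rule finite_subset[rotated]) (use ef in blast)
  from pigeonhole_infinite[OF a0 this]
  obtain m1 where m1: "bf m1 = ?b" "infinite {m \<in> {m. bf m = ?b}. ef m = ef m1}" by auto
  have "ef m1 \<in> ?\<alpha>" using ef m1(1) by blast
  then obtain N where N: "\<forall>i\<ge>N. v i \<in> ef m1" by blast
  obtain m where m: "m \<ge> N" "m \<in> {m \<in> {m. bf m = ?b}. ef m = ef m1}" using m1(2) by (metis infinite_nat_iff_unbounded_le)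
  have "W m \<notin> ef m1" using ef m(2) by fastforce
  moreover have "v (Suc m) \<in> ef m1" using N m(1) by simp
  ultimately show False using vS by simp
qed

end

context cat0_cocompact begin

text \<open>
  A smallest bad set \<open>H\<close> and a descending chain below one of its members give, by
  \<open>orbit_pigeonhole\<close>, the automorphism needed for the ascending sequence.
\<close>

lemma nonterm_dense_hyp_dense: assumes "nonterm_dense" shows "hyp_dense"
proof (rule ccontr)
  assume "\<not> hyp_dense"
  then obtain H0 where "bad H0" unfolding hyp_dense_def bad_def by blast
  then obtain H \<beta> where H: "bad H" and min: "\<And>H'. bad H' \<Longrightarrow> card H \<le> card H'"
    and b: "\<beta> \<in> bdry" "non_terminating \<beta>" "H \<subseteq> \<beta>"
    and cr: "\<And>h h'. h \<in> H \<Longrightarrow> h' \<in> H \<Longrightarrow> h \<noteq> h' \<Longrightarrow> cross h h'"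
    by (rule minimal_bad_pairwise_cross[OF assms]) (rule that; assumption)
  have fin: "finite H" and Hh: "H \<subseteq> hss" and no: "\<And>x. x \<in> hss \<Longrightarrow> \<exists>h\<in>H. \<not> inside x h"
    using H unfolding bad_def by blast+
  note bu = bdry_uf[OF b(1)]
  obtain c0 :: "nat \<Rightarrow> 'v set" where c0: "\<And>n. c0 n \<in> \<beta>" by (rule bdry_chain[OF b(1)]) (rule that; assumption)
  obtain h1 where h1: "h1 \<in> H" using no[OF uf_halfspace[OF bu c0[of 0]]] by blast
  obtain p where p: "\<And>s. s \<in> H \<Longrightarrow> p s \<in> V - s" by (rule pick_outside[OF Hh]) (rule that; assumption)
  have PV: "finite (p ` H)" "p ` H \<subseteq> V" using fin p by auto
  have h1b: "h1 \<in> \<beta>" using h1 b(3) by blast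
  obtain k0 where k0: "k0 \<in> \<beta>" "k0 \<subset> h1" "k0 \<inter> p ` H = {}" by (rule nonterm_avoid[OF bu b(2) h1b PV])
  let ?R = "H - {h1}"
  have deep: "cross k r" if k: "k \<in> \<beta>" "k \<subseteq> k0" "r \<in> ?R" for k r
  proof (rule minimal_bad_cross[OF H min b(1,3) h1 k(1), of r])
    show "k \<subset> h1" using k k0 by blast
    show "\<not> V - s \<subseteq> k" if "s \<in> H" for s using p[OF that] k(2) k0(3) that by blast
  qed (use k in auto)
  have ne: "?R \<noteq> {}"
  proof
    assume "?R = {}"
    then have "\<forall>h\<in>H. inside k0 h" using k0(2) h1 unfolding inside_def by blast
    then show False using no[OF uf_halfspace[OF bu k0(1)]] by blast
  qed
  obtain c :: "nat \<Rightarrow> 'v set" where c: "c 0 = k0" "\<And>n. c n \<in> \<beta>" "\<And>n. c (Suc n) \<subset> c n"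
    by (rule nonterm_chain[OF b(2) k0(1)]) (rule that; assumption)
  have ch: "c n \<in> hss" for n using uf_halfspace[OF bu c(2)] .
  have st: "i < j \<Longrightarrow> c j \<subset> c i" for i j using chain_strict[of c i j, OF c(3)] .
  have ck: "c n \<subseteq> k0" for n using st[of 0 n] c(1) by (cases n) auto
  have cR: "cross (c n) r" if "r \<in> ?R" for n r using deep[OF c(2) ck that] .
  have Rh: "?R \<subseteq> hss" and finR: "finite ?R" using Hh fin by auto
  have Rc: "cross r r'" if "r \<in> ?R" "r' \<in> ?R" "r \<noteq> r'" for r r' using cr that by blast
  have "\<forall>n. \<exists>y. y \<in> car (c n) \<and> y \<in> core X {} ?R"
  proof
    fix n
    have m: "car (c n) \<inter> car r \<noteq> {}" if "r \<in> ?R" for r using cross_car[OF ch _ cR[OF that]] that Rh by blast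
    have "\<exists>y. y \<in> car (c n) \<and> y \<in> car (c n) \<and> y \<in> core X {} ?R"
      by (rule cross_core[OF finR Rh Rc conv_car[OF ch] car_ne[OF ch] m conv_car[OF ch] _ m]) (use car_ne[OF ch] in auto)
    then show "\<exists>y. y \<in> car (c n) \<and> y \<in> core X {} ?R" by blast
  qed
  then obtain y where y: "\<forall>n. y n \<in> car (c n) \<and> y n \<in> core X {} ?R" by (rule choice[THEN exE])
  \<comment> \<open>every \<open>r\<close> is followed separately and hence fixed by \<open>g\<close>\<close>
  define A where "A n i = (case i of None \<Rightarrow> {c n} | Some r \<Rightarrow> {r})" for n and i :: "'v set option"
  have "k \<in> hss \<and> y n \<in> car k" if "i \<in> insert None (Some ` ?R)" "k \<in> A n i" for n i k
  proof (cases i)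
    case None
    then show ?thesis using that ch y unfolding A_def by auto
  next
    case (Some r)
    then have r: "k = r" "r \<in> ?R" using that unfolding A_def by auto
    then have "y n \<in> car r" using y unfolding core_mem by blast
    then show ?thesis using Rh r by blast
  qed
  moreover have "y n \<in> V" for n using y unfolding core_mem by blast
  moreover have "finite (insert None (Some ` ?R))" using finR by simp
  ultimately obtain J where J: "infinite J" "\<And>n m. n \<in> J \<Longrightarrow> m \<in> J \<Longrightarrow>
      \<exists>g. aut g \<and> g (y n) = y m \<and> (\<forall>i\<in>insert None (Some ` ?R). image g ` A n i = A m i)"
    using orbit_pigeonhole[of y "insert None (Some ` ?R)" A] by metis
  obtain i where i: "i \<in> J" using J(1) by (metis finite.emptyI equals0I)
  obtain j where j: "j \<in> J" "i < j" using J(1) by (metis infinite_nat_iff_unbounded)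
  obtain g where g: "aut g" "\<forall>l\<in>insert None (Some ` ?R). image g ` A i l = A j l" using J(2)[OF i j(1)] by blast
  have gc: "g ` c i = c j" using g(2) unfolding A_def by auto
  have gr: "g ` r = r" if "r \<in> ?R" for r
  proof -
    have "image g ` A i (Some r) = A j (Some r)" using g(2) that by blast
    then show ?thesis unfolding A_def by simp
  qed
  obtain f where f: "aut f" "\<And>x. x \<in> V \<Longrightarrow> f (g x) = x" using aut_inverse[OF g(1)] by metis
  have fg: "f ` g ` h = h" if "h \<subseteq> V" for h using f(2) that by (force simp: image_image)
  have fr: "f ` r = r" if "r \<in> ?R" for r
  proof -
    have "r \<subseteq> V" using that Rh halfspace_sub by blast
    then show ?thesis using fg[of r] gr[OF that] by simp
  qed
  have fc: "f ` c j = c i" using fg[OF halfspace_sub[OF ch[of i]]] gc by simp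
  define q where "q m = (f ^^ m) ` c i" for m
  note af = aut_pow[OF f(1)]
  have fmr: "(f ^^ m) ` r = r" if "r \<in> ?R" for m r
  proof (induction m)
    case (Suc m)
    have "(f ^^ Suc m) ` r = f ` (f ^^ m) ` r" by (simp add: image_comp)
    then show ?case using Suc fr[OF that] by simp
  qed simp
  have qh: "q m \<in> hss" for m unfolding q_def using aut_halfspace[OF af ch] .
  have qs: "q m \<subset> q (Suc m)" for m
  proof -
    have "f ` c j \<subset> f ` c i" by (rule aut_psub[OF f(1) st[OF j(2)] halfspace_sub[OF ch]])
    then have 1: "c i \<subset> f ` c i" using fc by simp
    have 2: "f ` c i \<subseteq> V" using halfspace_sub[OF aut_halfspace[OF f(1) ch]] .
    have "(f ^^ Suc m) ` c i = (f ^^ m) ` f ` c i" by (simp add: image_comp funpow_swap1 comp_def)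
    then show ?thesis unfolding q_def using aut_psub[OF af 1 2] by simp
  qed
  have qR: "cross (q m) r" if r: "r \<in> ?R" for m r
  proof -
    have "r \<in> hss" using r Rh by blast
    from aut_cross[OF af halfspace_sub[OF ch] halfspace_sub[OF this] cR[OF r], of m]
    show ?thesis unfolding q_def fmr[OF r] .
  qed
  \<comment> \<open>\<open>e\<close> inverts the power of \<open>f\<close> and would carry \<open>x\<close> to a halfspace inside every member of \<open>H\<close>\<close>
  have qbad: False if x: "x \<in> hss" "inside x (q m)" "\<And>r. r \<in> ?R \<Longrightarrow> inside x r" for x m
  proof -
    obtain e where e: "aut e" "\<And>x. x \<in> V \<Longrightarrow> e ((f ^^ m) x) = x" using aut_inverse[OF af[of m]] by metis
    have em: "e ` (f ^^ m) ` h = h" if "h \<subseteq> V" for h using e(2) that by (force simp: image_image)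
    have "inside (e ` x) (e ` q m)" using aut_inside[OF e(1) x(1) qh x(2)] .
    then have "inside (e ` x) (c i)" unfolding q_def em[OF halfspace_sub[OF ch]] .
    then have 1: "inside (e ` x) h1" using inside_sub ck[of i] k0(2) by blast
    have "inside (e ` x) r" if r: "r \<in> ?R" for r
    proof -
      have rh: "r \<in> hss" using r Rh by blast
      have "e ` r = r" using em[OF halfspace_sub[OF rh]] fmr[OF r] by simp
      then show ?thesis using aut_inside[OF e(1) x(1) rh x(3)[OF r]] by simp
    qed
    then have "\<forall>h\<in>H. inside (e ` x) h" using 1 by blast
    then show False using no[OF aut_halfspace[OF e(1) x(1)]] by blast
  qed
  have small: "card ?R < card H'" if "bad H'" for H'
    using min[OF that] card_Diff1_less[OF fin h1] by linarith
  interpret ascending_bad X ?R q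
    by (intro ascending_bad.intro ascending_bad_axioms.intro; (rule cat0_cocompact_axioms assms finR ne Rh Rc qh qs qR qbad small; assumption?))
  show False by (rule no_ascending_bad)
qed

end

section \<open>The equivalences\<close>

theorem theorem7p2:
  fixes X :: "'v set set"
  assumes "CAT0_cube_complex X"
    and "essential_cc X"
    and "locally_finite_cc X"
    and "cocompact_cc X"
  shows "(roller_boundary X = B_boundary X \<longleftrightarrow> caged_hyperplanes X) \<and>
         (caged_hyperplanes X \<longleftrightarrow>
            (\<forall>U. openin (uf_topology X) U \<and> U \<inter> roller_boundary X \<noteq> {} \<longrightarrow>
               (\<exists>H\<in>hyperplanes X. uf_set_contains_hyp X U H))) \<and>
         (straight_links X \<longrightarrow>
            (caged_hyperplanes X \<longleftrightarrow> \<not> (\<exists>S T. tight_cage X S T)))"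
proof -
  interpret cat0_cocompact X
    using assms by unfold_locales
  have 1: "roller_boundary X = B_boundary X \<longleftrightarrow> hyp_dense"
    using bdry_eq_B_iff nonterm_dense_hyp_dense hyp_dense_deepening[OF assms(2)] deepening_dense by blast
  have 2: "straight_links X \<Longrightarrow> hyp_dense \<longleftrightarrow> \<not> (\<exists>S T. tight_cage X S T)"
    using tight_cage_not_hyp_dense straight_tight_cage deepening_dense nonterm_dense_hyp_dense by blast
  show ?thesis
    using 1 2 caged_iff_hyp_dense hyp_dense_iff_open by simp
qed

end
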